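(* Let $\delta>2$ and let $F:\mathbb{C}^2\to\mathbb{C}^2$ be the automorphism $F(z,w)=(e^{-z^2}+e^{\pi i}\delta w,\,z)=(e^{-z^2}-\delta w,\,z)$. Then $F$ has a cycle of four Fatou components $\Omega^{ab}$, $a,b\in\{+,-\}$ (four pairwise distinct Fatou components permuted cyclically by $F$), each of which is biholomorphic to $\mathbb{H}\times\mathbb{H}$. On these components there are exactly two limit functions $h_1,h_2$, both of (generic) rank $1$ and with values in the line at infinity $\ell_\infty\cong\hat{\mathbb{C}}$, and they satisfy $$h_1(\Omega^{aa})=h_2(\Omega^{a(-a)})=\mathbb{H}\quad\text{and}\quad h_1(\Omega^{a(-a)})=h_2(\Omega^{aa})=-\mathbb{H}\qquad\text{for all } a\in\{+,-\}.$$ Moreover, $F$ is conjugate to its linear part $L(z,w)=(-\delta w,z)$ on every $\Omega^{ab}$; that is, there is a biholomorphism $\varphi$ from $\bigcup_{a,b}\Omega^{ab}$ onto its image such that $\varphi\circ F=L\circ\varphi$.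
   Context: $\mathbb{H}=\{\zeta\in\mathbb{C}:\operatorname{Re}\zeta>0\}$ is the open right half plane and $-\mathbb{H}$ the open left half plane. $\mathbb{P}^2$ is the complex projective plane, obtained from $\mathbb{C}^2$ by adding the line at infinity $\ell_\infty$. The line $\ell_\infty$ is identified with $\hat{\mathbb{C}}$ via $[z:w:0]\mapsto z/w$; subsets of $\hat{\mathbb{C}}$ such as $\pm\mathbb{H}$ are regarded as subsets of $\ell_\infty$ in this way. The Fatou set of $F$ is the set of points of $\mathbb{C}^2$ having a neighborhood on which the iterates $\{F^n\}$ form a normal family as maps into $\mathbb{P}^2$; a Fatou component is a connected component of the Fatou set. A function $h:\Omega\to\mathbb{P}^2$ is a limit function for a Fatou component $\Omega$ if there is a subsequence $n_k\to\infty$ with $F^{n_k}\to h$ uniformly on compact subsets of $\Omega$. The signs $a,b\in\{+,-\}$ are identified with $\pm1$, so $-a$ is the opposite sign. *)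

theory Defs
  imports "HOL-Analysis.Analysis"
begin

section \<open>The complex projective plane\<close>

definition same_line :: "complex^3 \<Rightarrow> complex^3 \<Rightarrow> bool" where
  "same_line u v \<longleftrightarrow> u \<noteq> 0 \<and> v \<noteq> 0 \<and> (\<exists>c. c \<noteq> 0 \<and> u = c *s v)"

quotient_type cp2 = "complex^3" / partial: same_line
  morphisms rep_cp2 abs_cp2
proof (rule part_equivpI)
  have "same_line 1 1"
    unfolding same_line_def by (auto intro!: exI[of _ 1])
  then show "\<exists>x. same_line x x" by blast
  show "symp same_line"
  proof (rule sympI)
    fix u v assume "same_line u v"
    then obtain c where c: "u \<noteq> 0" "v \<noteq> 0" "c \<noteq> 0" "u = c *s v"
      by (auto simp: same_line_def)
    then have "v = inverse c *s u" by simp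
    with c show "same_line v u"
      unfolding same_line_def by (metis inverse_nonzero_iff_nonzero)
  qed
  show "transp same_line"
  proof (rule transpI)
    fix u v w assume "same_line u v" "same_line v w"
    then obtain c d where "u \<noteq> 0" "w \<noteq> 0" "c \<noteq> 0" "u = c *s v" "d \<noteq> 0" "v = d *s w"
      by (auto simp: same_line_def)
    then show "same_line u w"
      unfolding same_line_def by (metis mult_eq_0_iff vector_smult_assoc)
  qed
qed

text \<open>
  The topology and the uniformity of the projective plane are given by the chordal form
  \<open>sin \<theta>\<close> of the Fubini-Study distance, \<open>\<theta>\<close> being the Hermitian angle
  between the lines. Up to the factor \<open>sqrt 2\<close> it is the Frobenius distance of the
  orthogonal projections onto the lines, which is how the triangle inequality is obtained.
\<close>

definition hermitian :: "complex^3 \<Rightarrow> complex^3 \<Rightarrow> complex" where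
  "hermitian u v = (\<Sum>i\<in>UNIV. u $ i * cnj (v $ i))"

definition chordal :: "complex^3 \<Rightarrow> complex^3 \<Rightarrow> real" where
  "chordal u v = sqrt (1 - (cmod (hermitian u v) / (norm u * norm v))\<^sup>2)"

definition line_projection :: "complex^3 \<Rightarrow> complex^3^3" where
  "line_projection u = (\<chi> i j. u $ i * cnj (u $ j) / complex_of_real ((norm u)\<^sup>2))"

lemma norm_scale_complex: "norm (c *s u) = cmod c * norm (u :: complex^'n)"
  by (simp add: norm_vec_def norm_mult L2_set_right_distrib)

lemma norm_square_complex: "complex_of_real ((norm (u :: complex^3))\<^sup>2) = hermitian u u"
proof -
  have "(norm u)\<^sup>2 = (\<Sum>i\<in>UNIV. (cmod (u $ i))\<^sup>2)"
    by (simp add: norm_vec_def L2_set_def sum_nonneg)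
  then show ?thesis
    by (simp only: hermitian_def complex_norm_square of_real_sum)
qed

lemma line_projection_scale:
  assumes "c \<noteq> 0"
  shows "line_projection (c *s u) = line_projection u"
proof -
  have "complex_of_real ((norm (c *s u))\<^sup>2) = c * cnj c * complex_of_real ((norm u)\<^sup>2)"
    by (simp only: norm_scale_complex power_mult_distrib of_real_mult complex_norm_square)
  then show ?thesis
    using assms by (simp add: line_projection_def vec_eq_iff)
qed

lemma norm_square_matrix:
  "(norm (A :: complex^3^3))\<^sup>2 = (\<Sum>i\<in>UNIV. \<Sum>j\<in>UNIV. (cmod (A $ i $ j))\<^sup>2)"
  by (simp add: norm_vec_def L2_set_def sum_nonneg)

lemma chordal_eq:
  assumes "u \<noteq> 0" "v \<noteq> 0"
  shows "chordal u v = norm (line_projection u - line_projection v) / sqrt 2"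
proof -
  let ?a = "complex_of_real ((norm u)\<^sup>2)" and ?b = "complex_of_real ((norm v)\<^sup>2)"
  have nz: "?a \<noteq> 0" "?b \<noteq> 0" using assms by auto
  have a: "?a = (\<Sum>i\<in>UNIV. u $ i * cnj (u $ i))" and b: "?b = (\<Sum>i\<in>UNIV. v $ i * cnj (v $ i))"
    by (simp_all only: norm_square_complex hermitian_def)
  have "complex_of_real ((norm (line_projection u - line_projection v))\<^sup>2)
      = (\<Sum>i\<in>UNIV. \<Sum>j\<in>UNIV.
          (u $ i * cnj (u $ j) / ?a - v $ i * cnj (v $ j) / ?b)
          * (cnj (u $ i) * u $ j / ?a - cnj (v $ i) * v $ j / ?b))"
    by (simp only: norm_square_matrix of_real_sum complex_norm_square)
       (simp add: line_projection_def)
  also have "\<dots> = (hermitian u u * hermitian u u) / (?a * ?a)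
       + (hermitian v v * hermitian v v) / (?b * ?b)
       - 2 * (hermitian u v * cnj (hermitian u v)) / (?a * ?b)"
    by (simp add: hermitian_def sum_3 algebra_simps add_divide_distrib diff_divide_distrib)
  also have "\<dots> = 2 - 2 * (hermitian u v * cnj (hermitian u v)) / (?a * ?b)"
    using nz by (simp add: norm_square_complex[symmetric])
  also have "\<dots> = complex_of_real (2 * (1 - (cmod (hermitian u v) / (norm u * norm v))\<^sup>2))"
    unfolding complex_norm_square[symmetric] by (simp add: power_divide power_mult_distrib)
  finally have "(norm (line_projection u - line_projection v))\<^sup>2
      = 2 * (1 - (cmod (hermitian u v) / (norm u * norm v))\<^sup>2)"
    using of_real_eq_iff by blast
  then have "(norm (line_projection u - line_projection v) / sqrt 2)\<^sup>2
      = 1 - (cmod (hermitian u v) / (norm u * norm v))\<^sup>2"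
    by (simp add: power_divide)
  then show ?thesis
    unfolding chordal_def by (metis real_sqrt_abs abs_of_nonneg norm_ge_zero
        divide_nonneg_nonneg real_sqrt_ge_zero zero_le_numeral)
qed

lemma line_projection_eq_iff:
  assumes "u \<noteq> 0" "v \<noteq> 0"
  shows "line_projection u = line_projection v \<longleftrightarrow> same_line u v"
proof
  assume eq: "line_projection u = line_projection v"
  obtain j where j: "u $ j \<noteq> 0" using assms by (auto simp: vec_eq_iff)
  define c where "c = (cnj (v $ j) / complex_of_real ((norm v)\<^sup>2))
      / (cnj (u $ j) / complex_of_real ((norm u)\<^sup>2))"
  have "u $ i = c * v $ i" for i
  proof -
    have "u $ i * (cnj (u $ j) / complex_of_real ((norm u)\<^sup>2))
        = v $ i * (cnj (v $ j) / complex_of_real ((norm v)\<^sup>2))"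
      using arg_cong[OF eq, of "\<lambda>A. A $ i $ j"] by (simp add: line_projection_def)
    moreover have "cnj (u $ j) / complex_of_real ((norm u)\<^sup>2) \<noteq> 0"
      using j assms by auto
    ultimately show ?thesis unfolding c_def by (metis nonzero_eq_divide_eq times_divide_eq_left
          times_divide_eq_right mult.commute)
  qed
  then have "u = c *s v" by (simp add: vec_eq_iff)
  moreover from this assms have "c \<noteq> 0" by auto
  ultimately show "same_line u v" using assms by (auto simp: same_line_def)
next
  assume "same_line u v"
  then show "line_projection u = line_projection v"
    by (auto simp: same_line_def line_projection_scale)
qed

lemma chordal_cong: "same_line u u' \<Longrightarrow> same_line v v' \<Longrightarrow> chordal u v = chordal u' v'"
  using line_projection_eq_iff by (auto simp: same_line_def chordal_eq line_projection_scale)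

lemma same_line_nonzero: "same_line u u \<longleftrightarrow> u \<noteq> 0"
  unfolding same_line_def by (metis one_neq_zero vector_smult_lid)

instantiation cp2 :: metric_space
begin

lift_definition dist_cp2 :: "cp2 \<Rightarrow> cp2 \<Rightarrow> real" is chordal
  by (rule chordal_cong)

definition uniformity_cp2 :: "(cp2 \<times> cp2) filter" where
  "uniformity_cp2 = (INF e\<in>{0<..}. principal {(p, q). dist p q < e})"

definition open_cp2 :: "cp2 set \<Rightarrow> bool" where
  "open_cp2 U \<longleftrightarrow> (\<forall>p\<in>U. eventually (\<lambda>(p', q). p' = p \<longrightarrow> q \<in> U) uniformity)"

instance
proof
  show "uniformity = (INF e\<in>{0<..}. principal {(p::cp2, q). dist p q < e})"
    by (rule uniformity_cp2_def)
  show "open U = (\<forall>p\<in>U. eventually (\<lambda>(p', q). p' = p \<longrightarrow> q \<in> U) uniformity)"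
    for U :: "cp2 set" by (rule open_cp2_def)
  show "dist p q = 0 \<longleftrightarrow> p = q" for p q :: cp2
    by transfer (use line_projection_eq_iff same_line_nonzero in \<open>auto simp: chordal_eq\<close>)
  show "dist p q \<le> dist p r + dist q r" for p q r :: cp2
  proof transfer
    fix u v w assume "same_line u u" "same_line v v" "same_line w w"
    then have nz: "u \<noteq> 0" "v \<noteq> 0" "w \<noteq> 0" by (simp_all add: same_line_nonzero)
    have "norm (line_projection u - line_projection v)
        \<le> norm (line_projection u - line_projection w) + norm (line_projection v - line_projection w)"
      by (metis dist_norm dist_triangle2)
    then show "chordal u v \<le> chordal u w + chordal v w"
      using nz by (simp add: chordal_eq divide_right_mono flip: add_divide_distrib)
  qed
qed

end

definition affine_point :: "complex^2 \<Rightarrow> cp2" where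
  "affine_point p = abs_cp2 (vector [p $ 1, p $ 2, 1])"

text \<open>The point \<open>\<zeta>\<close> of the line at infinity under \<open>[z:w:0] \<mapsto> z/w\<close>; the remaining
  point \<open>[1:0:0]\<close> corresponds to \<open>\<infinity>\<close>.\<close>

definition point_at_infinity :: "complex \<Rightarrow> cp2" where
  "point_at_infinity \<zeta> = abs_cp2 (vector [\<zeta>, 1, 0])"

definition line_at_infinity :: "cp2 set" where
  "line_at_infinity = {abs_cp2 (vector [z, w, 0]) | z w. (z, w) \<noteq> (0, 0)}"

definition chart_domain :: "3 \<Rightarrow> cp2 set" where
  "chart_domain i = {abs_cp2 u | u. u $ i \<noteq> 0}"

text \<open>
  The affine chart \<open>[u] \<mapsto> u / u\<^sub>i\<close> on \<^term>\<open>chart_domain i\<close>. The constant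
  coordinate \<open>u\<^sub>i / u\<^sub>i = 1\<close> is kept; it does not affect ranks of differentials.
\<close>

lift_definition chart :: "3 \<Rightarrow> cp2 \<Rightarrow> complex^3" is "\<lambda>i u. \<chi> j. u $ j / u $ i"
  by (auto simp: same_line_def vec_eq_iff)


section \<open>Holomorphic maps\<close>

abbreviation complex_linear :: "(complex^'n \<Rightarrow> complex^'m) \<Rightarrow> bool" where
  "complex_linear D \<equiv> Vector_Spaces.linear (*s) (*s) D"

text \<open>Only meant for open \<open>U\<close>.\<close>

definition holomorphic_map :: "(complex^'n \<Rightarrow> complex^'m) \<Rightarrow> (complex^'n) set \<Rightarrow> bool" where
  "holomorphic_map f U \<longleftrightarrow>
     (\<forall>p\<in>U. \<exists>D. complex_linear D \<and> (f has_derivative D) (at p))"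

definition biholomorphism ::
    "(complex^'n \<Rightarrow> complex^'m) \<Rightarrow> (complex^'n) set \<Rightarrow> (complex^'m) set \<Rightarrow> bool" where
  "biholomorphism f U V \<longleftrightarrow> open U \<and> open V \<and> bij_betw f U V \<and>
     holomorphic_map f U \<and> holomorphic_map (inv_into U f) V"

definition biholomorphic :: "(complex^'n) set \<Rightarrow> (complex^'m) set \<Rightarrow> bool" where
  "biholomorphic U V \<longleftrightarrow> (\<exists>f. biholomorphism f U V)"

definition has_rank_at :: "(complex^'n \<Rightarrow> cp2) \<Rightarrow> complex^'n \<Rightarrow> nat \<Rightarrow> bool" where
  "has_rank_at h p r \<longleftrightarrow> (\<exists>i D. h p \<in> chart_domain i \<and> complex_linear D \<and>
     ((\<lambda>q. chart i (h q)) has_derivative D) (at p) \<and> vec.dim (range D) = r)"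

text \<open>
  A holomorphic map into the projective plane, of rank at most \<open>r\<close> everywhere and of rank
  exactly \<open>r\<close> on a dense open subset. (Existence of a rank at every point of the open set
  \<open>U\<close> amounts to holomorphy on \<open>U\<close>.)
\<close>

definition has_generic_rank :: "(complex^'n \<Rightarrow> cp2) \<Rightarrow> (complex^'n) set \<Rightarrow> nat \<Rightarrow> bool" where
  "has_generic_rank h U r \<longleftrightarrow> (\<forall>p\<in>U. \<exists>k\<le>r. has_rank_at h p k) \<and>
     (\<exists>V. open V \<and> V \<subseteq> U \<and> U \<subseteq> closure V \<and> (\<forall>p\<in>V. has_rank_at h p r))"


section \<open>Fatou components and limit functions\<close>

definition converges_on_compacts ::
    "(nat \<Rightarrow> 'a::topological_space \<Rightarrow> 'b::metric_space) \<Rightarrow> ('a \<Rightarrow> 'b) \<Rightarrow> 'a set \<Rightarrow> bool" where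
  "converges_on_compacts f h U \<longleftrightarrow>
     (\<forall>K. compact K \<and> K \<subseteq> U \<longrightarrow> uniform_limit K f h sequentially)"

definition normal_family :: "('a::topological_space \<Rightarrow> 'b::metric_space) set \<Rightarrow> 'a set \<Rightarrow> bool" where
  "normal_family A U \<longleftrightarrow> (\<forall>f. range f \<subseteq> A \<longrightarrow>
     (\<exists>(r :: nat \<Rightarrow> nat) h. strict_mono r \<and> converges_on_compacts (f \<circ> r) h U))"

definition iterate :: "(complex^2 \<Rightarrow> complex^2) \<Rightarrow> nat \<Rightarrow> complex^2 \<Rightarrow> cp2" where
  "iterate F n p = affine_point ((F ^^ n) p)"

definition fatou_set :: "(complex^2 \<Rightarrow> complex^2) \<Rightarrow> (complex^2) set" where
  "fatou_set F = {p. \<exists>U. open U \<and> p \<in> U \<and> normal_family (range (iterate F)) U}"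

definition fatou_component :: "(complex^2 \<Rightarrow> complex^2) \<Rightarrow> (complex^2) set \<Rightarrow> bool" where
  "fatou_component F \<Omega> \<longleftrightarrow> \<Omega> \<in> components (fatou_set F)"

definition fatou_cycle :: "(complex^2 \<Rightarrow> complex^2) \<Rightarrow> nat \<Rightarrow> (complex^2) set set \<Rightarrow> bool" where
  "fatou_cycle F n C \<longleftrightarrow> (\<exists>X. bij_betw X {..<n} C \<and>
     (\<forall>k<n. fatou_component F (X k) \<and> F ` X k = X (Suc k mod n)))"

text \<open>
  The values of \<open>h\<close> outside \<open>\<Omega>\<close> are irrelevant, so limit functions on \<open>\<Omega>\<close>
  have to be compared on \<open>\<Omega>\<close> only.
\<close>

definition limit_function ::
    "(complex^2 \<Rightarrow> complex^2) \<Rightarrow> (complex^2) set \<Rightarrow> (complex^2 \<Rightarrow> cp2) \<Rightarrow> bool" where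
  "limit_function F \<Omega> h \<longleftrightarrow>
     (\<exists>r. strict_mono r \<and> converges_on_compacts (iterate F \<circ> r) h \<Omega>)"

definition exactly_two_limit_functions ::
    "(complex^2 \<Rightarrow> complex^2) \<Rightarrow> (complex^2) set \<Rightarrow> (complex^2 \<Rightarrow> cp2) \<Rightarrow> (complex^2 \<Rightarrow> cp2) \<Rightarrow> bool" where
  "exactly_two_limit_functions F \<Omega> h1 h2 \<longleftrightarrow>
     (\<exists>p\<in>\<Omega>. h1 p \<noteq> h2 p) \<and>
     (\<forall>h. limit_function F \<Omega> h \<longleftrightarrow> (\<forall>p\<in>\<Omega>. h p = h1 p) \<or> (\<forall>p\<in>\<Omega>. h p = h2 p))"


section \<open>The maps and the half planes\<close>

definition henon :: "real \<Rightarrow> complex^2 \<Rightarrow> complex^2" where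
  "henon \<delta> p = vector [exp (- (p $ 1)\<^sup>2) - complex_of_real \<delta> * p $ 2, p $ 1]"

definition henon_linear_part :: "real \<Rightarrow> complex^2 \<Rightarrow> complex^2" where
  "henon_linear_part \<delta> p = vector [- complex_of_real \<delta> * p $ 2, p $ 1]"

definition right_half_plane :: "complex set" where
  "right_half_plane = {\<zeta>. Re \<zeta> > 0}"

definition half_plane_squared :: "(complex^2) set" where
  "half_plane_squared = {p. p $ 1 \<in> right_half_plane \<and> p $ 2 \<in> right_half_plane}"


section \<open>The map is an automorphism\<close>

lemma vector_2_eq_axis: "vector [a, b] = (axis 1 a + axis 2 b :: complex^2)"
  by (simp add: vec_eq_iff forall_2 axis_def)

lemma bounded_linear_axis: "bounded_linear (axis k :: complex \<Rightarrow> complex^'n)"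
  by (intro linear_conv_bounded_linear[THEN iffD1] linearI) (auto simp: vec_eq_iff axis_def)

lemma has_derivative_vector_2:
  assumes "(f has_derivative f') F" "(g has_derivative g') F"
  shows "((\<lambda>p. vector [f p, g p] :: complex^2) has_derivative (\<lambda>p. vector [f' p, g' p])) F"
  unfolding vector_2_eq_axis
  by (intro has_derivative_add bounded_linear.has_derivative[OF bounded_linear_axis] assms)

lemma has_derivative_component: "((\<lambda>p. p $ k :: complex) has_derivative (\<lambda>p. p $ k)) (at (x :: complex^'n))"
  by (intro bounded_linear_imp_has_derivative bounded_linear_vec_nth)

lemma holomorphic_map_vector_2:
  assumes "\<And>p. ((\<lambda>q. f q) has_derivative (\<lambda>q. a p * q $ 1 + b p * q $ 2)) (at p)"
    and "\<And>p. ((\<lambda>q. g q) has_derivative (\<lambda>q. c p * q $ 1 + d p * q $ 2)) (at p)"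
  shows "holomorphic_map (\<lambda>p :: complex^2. vector [f p, g p] :: complex^2) U"
  unfolding holomorphic_map_def
proof
  fix p
  show "\<exists>D. complex_linear D \<and> ((\<lambda>p. vector [f p, g p] :: complex^2) has_derivative D) (at p)"
    by (intro exI conjI, rule_tac [2] has_derivative_vector_2[OF assms])
       (unfold_locales, auto simp: vec_eq_iff forall_2 algebra_simps)
qed

lemma henon_automorphism:
  assumes "\<delta> \<noteq> 0"
  shows "biholomorphism (henon \<delta>) UNIV UNIV"
proof -
  let ?d = "complex_of_real \<delta>"
  define G :: "complex^2 \<Rightarrow> complex^2"
    where "G = (\<lambda>p. vector [p $ 2, (exp (- (p $ 2)\<^sup>2) - p $ 1) / ?d])"
  have GF: "G (henon \<delta> p) = p" and FG: "henon \<delta> (G p) = p" for p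
    using assms by (auto simp: G_def henon_def vec_eq_iff forall_2)
  have sq: "((\<lambda>q :: complex^2. exp (- (q $ k)\<^sup>2)) has_derivative
      (\<lambda>q. (- 2 * p $ k * exp (- (p $ k)\<^sup>2)) * q $ k)) (at p)" for p k
  proof -
    have "((\<lambda>z. exp (- z\<^sup>2)) has_field_derivative - 2 * p $ k * exp (- (p $ k)\<^sup>2)) (at (p $ k))"
      by (auto intro!: derivative_eq_intros)
    from has_derivative_compose[OF has_derivative_component has_field_derivative_imp_has_derivative[OF this]]
    show ?thesis .
  qed
  have F: "holomorphic_map (henon \<delta>) UNIV"
    unfolding henon_def [abs_def]
  proof (rule holomorphic_map_vector_2)
    show "((\<lambda>q. exp (- (q $ 1)\<^sup>2) - ?d * q $ 2) has_derivative
      (\<lambda>q. (- 2 * p $ 1 * exp (- (p $ 1)\<^sup>2)) * q $ 1 + (- ?d) * q $ 2)) (at p)" for p :: "complex^2"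
      by (rule has_derivative_eq_rhs,
          (rule sq has_derivative_component has_derivative_diff has_derivative_mult_right)+) auto
    show "((\<lambda>q. q $ 1) has_derivative (\<lambda>q. 1 * q $ 1 + 0 * q $ 2)) (at p)" for p :: "complex^2"
      using has_derivative_component[of 1 p] by simp
  qed
  have "holomorphic_map G UNIV"
    unfolding G_def
  proof (rule holomorphic_map_vector_2)
    show "((\<lambda>q. (exp (- (q $ 2)\<^sup>2) - q $ 1) / ?d) has_derivative
      (\<lambda>q. (- 1 / ?d) * q $ 1 + (- 2 * p $ 2 * exp (- (p $ 2)\<^sup>2) / ?d) * q $ 2)) (at p)"
      for p :: "complex^2"
      unfolding divide_inverse
      by (rule has_derivative_eq_rhs,
          (rule has_derivative_mult_left has_derivative_diff sq has_derivative_component)+)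
         (auto simp: algebra_simps)
    show "((\<lambda>q. q $ 2) has_derivative (\<lambda>q. 0 * q $ 1 + 1 * q $ 2)) (at p)" for p :: "complex^2"
      using has_derivative_component[of 2 p] by simp
  qed
  moreover have "inv (henon \<delta>) = G"
    by (rule inv_equality) (simp_all add: GF FG)
  moreover have "bij (henon \<delta>)"
    by (rule o_bij[of G]) (auto simp: GF FG)
  ultimately show ?thesis
    using F by (simp add: biholomorphism_def)
qed

end

theory Submission
  imports Defs "HOL-Complex_Analysis.Great_Picard" "HOL-Homology.Invariance_of_Domain"
    "HOL-Real_Asymp.Real_Asymp"
begin

text \<open>
  Write \<open>F\<^sup>n (z, w) = (z\<^sub>n, z\<^sub>n\<^sub>-\<^sub>1)\<close>, so that \<open>z\<^sub>n\<^sub>+\<^sub>1 = exp (- z\<^sub>n\<^sup>2) - \<delta> z\<^sub>n\<^sub>-\<^sub>1\<close>. Deep inside the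
  sectors \<open>\<bar>Im z\<bar> < \<bar>Re z\<bar>\<close> the exponential is tiny and the linear part pushes the orbit deeper,
  so \<open>\<phi> = lim (-\<delta>)\<^sup>-\<^sup>k F\<^sup>2\<^sup>k\<close> exists on the basins of the four products of sectors, conjugates \<open>F\<close> to its
  linear part and is close to the identity near infinity; a contraction argument makes it a
  biholomorphism of each basin onto a product of two sectors, that is, onto \<open>H \<times> H\<close> after squaring
  the coordinates. The limit functions are \<open>[\<phi>\<^sub>1 : \<phi>\<^sub>2 : 0]\<close> and \<open>[-\<delta> \<phi>\<^sub>2 : \<phi>\<^sub>1 : 0]\<close>.

  The basins are whole Fatou components because no boundary point \<open>p\<close> lies in the Fatou set:
  otherwise equicontinuity extends the limits of \<open>z\<^sub>n / z\<^sub>n\<^sub>-\<^sub>1\<close> to \<open>p\<close>. If they are neither \<open>0\<close> nor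
  \<open>\<infinity>\<close>, then \<open>exp (- z\<^sub>n\<^sup>2) / z\<^sub>n\<close> is bounded near \<open>p\<close>, and Harnack's inequality for
  \<open>- Re (z\<^sub>n\<^sup>2) - ln \<bar>z\<^sub>n\<bar>\<close> carries the growth of \<open>Re (z\<^sub>n\<^sup>2)\<close> from a nearby point of the basin to \<open>p\<close>,
  which puts \<open>p\<close> into a basin. A zero of the limiting ratio contradicts the open mapping theorem,
  and a pole becomes a zero after one application of \<open>F\<close>.
\<close>

section \<open>Topology of the projective plane\<close>

text \<open>The linear part \<open>L\<close> squares to the scalar \<open>-\<delta>\<close>, so
  \<open>(-\<delta>)^-k F^(2k)\<close> is \<open>L^(-2k) F^(2k)\<close>, the usual comparison of two
  dynamics that conjugates one to the other wherever it converges. A scalar acts trivially on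
  directions, which is why the even iterates alone converge at infinity and the odd ones have a
  limit of their own. On signs \<open>L\<close> acts by \<open>(a, b) \<mapsto> (-b, a)\<close>, of
  order four: hence four basins, and fourth iterates in their definition. The bound
  \<open>\<delta> > 2\<close> enters through \<open>2 R - 2/5 \<ge> 3/2 R\<close> for
  \<open>R \<ge> 2\<close>, which makes depth grow, and through increments of the conjugacy that
  shrink at least like \<open>2^-k\<close>. The obstacle is maximality of the basins. Normality as
  maps into the projective plane controls only directions of orbits near a boundary point, whereas
  membership in a basin needs \<open>Re (z^2)\<close> to beat \<open>\<bar>z\<bar>\<close>. A
  multiplicative loss such as that in Harnack's inequality is affordable because of the gap between
  the quadratic growth of \<open>Re (z^2)\<close> and the exponent \<open>3/2\<close> with which
  \<open>\<bar>z\<bar>\<close> is transported.\<close>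

lemma cp2_cases:
  obtains u where "u \<noteq> 0" "P = abs_cp2 u"
  by (metis Quotient3_abs_rep Quotient3_cp2 Quotient3_rep_reflp same_line_nonzero)

lemma abs_cp2_eq_iff:
  assumes "u \<noteq> 0" "v \<noteq> 0"
  shows "abs_cp2 u = abs_cp2 v \<longleftrightarrow> same_line u v"
  using assms Quotient3_rel[OF Quotient3_cp2, of u v] by (simp add: same_line_nonzero)

lemma dist_abs_cp2:
  assumes "u \<noteq> 0" "v \<noteq> 0"
  shows "dist (abs_cp2 u) (abs_cp2 v) = norm (line_projection u - line_projection v) / sqrt 2"
  using assms chordal_eq by (simp add: dist_cp2.abs_eq same_line_nonzero)

lemma chart_abs_cp2: "u \<noteq> 0 \<Longrightarrow> chart i (abs_cp2 u) = (\<chi> j. u $ j / u $ i)"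
  by (simp add: chart.abs_eq same_line_nonzero)

lemma abs_cp2_in_chart_domain:
  assumes "u \<noteq> 0"
  shows "abs_cp2 u \<in> chart_domain i \<longleftrightarrow> u $ i \<noteq> 0"
proof
  assume "abs_cp2 u \<in> chart_domain i"
  then obtain v where v: "abs_cp2 u = abs_cp2 v" "v $ i \<noteq> 0" by (auto simp: chart_domain_def)
  then have "same_line u v" using assms by (subst abs_cp2_eq_iff[symmetric]) auto
  with v show "u $ i \<noteq> 0" by (auto simp: same_line_def)
qed (auto simp: chart_domain_def)

text \<open>An embedding of the projective plane into the matrices that is isometric up to
  \<open>sqrt 2\<close>. Continuity and openness in \<open>cp2\<close> are read off from matrix
  entries through it.\<close>

lift_definition projection_cp2 :: "cp2 \<Rightarrow> complex^3^3" is line_projection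
  using line_projection_eq_iff by (auto simp: same_line_def)

lemma projection_abs_cp2: "u \<noteq> 0 \<Longrightarrow> projection_cp2 (abs_cp2 u) = line_projection u"
  by (simp add: projection_cp2.abs_eq same_line_nonzero)

lemma dist_cp2_projection: "dist P Q = dist (projection_cp2 P) (projection_cp2 Q) / sqrt 2"
  by (cases P rule: cp2_cases; cases Q rule: cp2_cases)
    (simp add: dist_abs_cp2 projection_abs_cp2 dist_norm)

lemma continuous_on_projection_cp2: "continuous_on A projection_cp2"
proof (rule continuous_onI)
  fix P Q :: cp2 and e :: real assume "e > 0"
  show "\<exists>d>0. \<forall>x'\<in>A. dist x' P < d \<longrightarrow> dist (projection_cp2 x') (projection_cp2 P) \<le> e"
    using \<open>e > 0\<close> by (intro exI[of _ "e / sqrt 2"]) (auto simp: dist_cp2_projection divide_simps)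
qed

lemma line_projection_continuous: "continuous_on {u. u \<noteq> 0} line_projection"
  unfolding line_projection_def by (intro continuous_intros) auto

lemma continuous_on_abs_cp2: "continuous_on {u. u \<noteq> 0} abs_cp2"
proof (rule continuous_onI)
  fix u :: "complex^3" and e :: real assume "u \<in> {u. u \<noteq> 0}" "e > 0"
  then obtain d where "d > 0" "\<And>v. v \<noteq> 0 \<Longrightarrow> dist v u < d \<Longrightarrow>
      dist (line_projection v) (line_projection u) < e"
    using line_projection_continuous unfolding continuous_on_iff by fastforce
  moreover have "x / sqrt 2 \<le> e" if "x < e" "0 \<le> x" for x :: real
  proof -
    have "x * 1 \<le> e * sqrt 2" using that by (intro mult_mono) auto
    then show ?thesis by (simp add: field_simps)
  qed
  ultimately show "\<exists>d>0. \<forall>v\<in>{u. u \<noteq> 0}. dist v u < d \<longrightarrow> dist (abs_cp2 v) (abs_cp2 u) \<le> e"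
    using \<open>u \<in> {u. u \<noteq> 0}\<close>
    by (intro exI[of _ d]) (auto simp: dist_abs_cp2 dist_norm[symmetric])
qed

text \<open>The diagonal entry is \<open>\<bar>u_i\<bar>^2 / \<bar>u\<bar>^2\<close>, which vanishes
  exactly when \<open>u_i\<close> does.\<close>

lemma chart_domain_projection: "chart_domain i = {P. projection_cp2 P $ i $ i \<noteq> 0}"
proof -
  have "P \<in> chart_domain i \<longleftrightarrow> projection_cp2 P $ i $ i \<noteq> 0" for P
    by (cases P rule: cp2_cases)
      (auto simp: abs_cp2_in_chart_domain projection_abs_cp2 line_projection_def)
  then show ?thesis by auto
qed

text \<open>Column \<open>i\<close> of the projection is a multiple of \<open>u\<close>, so dividing
  it by its own \<open>i\<close>-th entry normalizes \<open>u\<close> as the chart does.\<close>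

lemma chart_projection:
  assumes "P \<in> chart_domain i"
  shows "chart i P $ j = projection_cp2 P $ j $ i / projection_cp2 P $ i $ i"
  using assms by (cases P rule: cp2_cases)
    (auto simp: abs_cp2_in_chart_domain projection_abs_cp2 line_projection_def chart_abs_cp2)

lemma open_chart_domain: "open (chart_domain i)"
  unfolding chart_domain_projection
  by (intro open_Collect_neq continuous_intros continuous_on_projection_cp2)

lemma continuous_on_chart: "continuous_on (chart_domain i) (\<lambda>P. chart i P $ j)"
proof -
  have "continuous_on (chart_domain i) (\<lambda>P. projection_cp2 P $ j $ i / projection_cp2 P $ i $ i)"
    by (intro continuous_intros continuous_on_projection_cp2) (auto simp: chart_domain_projection)
  then show ?thesis by (subst continuous_on_cong[OF refl chart_projection])
qed

text \<open>\<open>abs_cp2\<close> is not uniformly continuous near the origin. By compactness of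
  \<open>K\<close> the values of \<open>v\<close> lie in a closed shell around \<open>0\<close>;
  with \<open>m\<close> half of the least norm, the shell \<open>A\<close> also contains the values
  of \<open>u n\<close> for large \<open>n\<close>, and uniform continuity on the compact set
  \<open>A\<close> suffices.\<close>

lemma uniform_limit_abs_cp2:
  fixes u :: "nat \<Rightarrow> 'a::topological_space \<Rightarrow> complex^3"
  assumes K: "compact K" and c: "continuous_on K v" and nz: "\<And>p. p \<in> K \<Longrightarrow> v p \<noteq> 0"
    and ul: "uniform_limit K u v sequentially"
  shows "uniform_limit K (\<lambda>n p. abs_cp2 (u n p)) (\<lambda>p. abs_cp2 (v p)) sequentially"
proof (cases "K = {}")
  case False
  obtain q where q: "q \<in> K" "\<And>p. p \<in> K \<Longrightarrow> norm (v q) \<le> norm (v p)"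
    using continuous_attains_inf[OF K False continuous_on_norm[OF c]] by auto
  obtain r where r: "r \<in> K" "\<And>p. p \<in> K \<Longrightarrow> norm (v p) \<le> norm (v r)"
    using continuous_attains_sup[OF K False continuous_on_norm[OF c]] by auto
  define m where "m = norm (v q) / 2"
  have m: "m > 0" using nz[OF q(1)] by (simp add: m_def)
  define A where "A = cball 0 (norm (v r) + m) - ball (0 :: complex^3) m"
  have A: "compact A" unfolding A_def by (intro compact_diff) auto
  have A0: "A \<subseteq> {u. u \<noteq> 0}" using m by (auto simp: A_def)
  have vA: "v p \<in> A" if "p \<in> K" for p
    using q(2)[OF that] r(2)[OF that] m norm_ge_zero[of "v q"]
    by (auto simp: A_def m_def simp del: norm_ge_zero)
  have "\<forall>\<^sub>F n in sequentially. \<forall>p\<in>K. dist (u n p) (v p) < m"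
    using ul m by (auto simp: uniform_limit_iff)
  then have ev: "\<forall>\<^sub>F n in sequentially. u n ` K \<subseteq> A"
  proof eventually_elim
    case (elim n)
    have "u n p \<in> A" if "p \<in> K" for p
    proof -
      have "norm (u n p - v p) < m" using elim that by (simp add: dist_norm)
      moreover have "norm (v p) \<ge> 2 * m" using q(2)[OF that] by (simp add: m_def)
      ultimately show ?thesis
        using r(2)[OF that] norm_triangle_ineq2[of "v p" "u n p"] norm_triangle_ineq2[of "u n p" "v p"]
        by (auto simp: A_def norm_minus_commute)
    qed
    then show ?case by auto
  qed
  have "uniformly_continuous_on A abs_cp2"
    using A continuous_on_subset[OF continuous_on_abs_cp2 A0] by (rule compact_uniformly_continuous[rotated])
  from uniform_limit_compose[OF ul this ev] show ?thesis using vA by (auto simp: o_def)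
qed auto

lemma affine_point_nonzero: "(vector [a, b, 1] :: complex^3) \<noteq> 0"
  by (auto simp: vec_eq_iff forall_3)

lemma abs_cp2_scale: "c \<noteq> 0 \<Longrightarrow> u \<noteq> 0 \<Longrightarrow> abs_cp2 (c *s u) = abs_cp2 u"
  by (subst abs_cp2_eq_iff) (auto simp: same_line_def)

lemma continuous_on_vector_3:
  assumes "continuous_on A f" "continuous_on A g" "continuous_on A h"
  shows "continuous_on A (\<lambda>x. vector [f x, g x, h x] :: complex^3)"
proof -
  have "continuous_on A (\<lambda>x. if i = 1 then f x else if i = 2 then g x else h x)" for i :: 3
    using assms by (cases "i = 1"; cases "i = 2") auto
  then have "continuous_on A (\<lambda>x. (\<chi> i. if i = 1 then f x else if i = 2 then g x else h x) :: complex^3)"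
    by (rule continuous_on_vec_lambda)
  also have "(\<lambda>x. \<chi> i. if i = 1 then f x else if i = 2 then g x else h x) =
      (\<lambda>x. vector [f x, g x, h x] :: complex^3)"
    by (auto simp: vec_eq_iff forall_3 fun_eq_iff)
  finally show ?thesis .
qed

lemma continuous_on_affine_point: "continuous_on A affine_point"
proof -
  have "continuous_on A (abs_cp2 \<circ> (\<lambda>p. vector [p $ 1, p $ 2, 1]))"
    by (intro continuous_on_compose continuous_on_vector_3 continuous_intros
        continuous_on_subset[OF continuous_on_abs_cp2]) (auto simp: affine_point_nonzero)
  then show ?thesis by (simp add: affine_point_def[abs_def] o_def)
qed

section \<open>Holomorphic maps of several variables\<close>

lemma bounded_linear_scale_vector: "bounded_linear (\<lambda>s :: complex. s *s (v :: complex^'n))"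
  by (intro linear_conv_bounded_linear[THEN iffD1] linearI) (auto simp: vec_eq_iff algebra_simps)

text \<open>Restriction to a complex line is how one-variable function theory is brought to maps of
  several variables.\<close>

lemma has_field_derivative_slice:
  fixes f :: "complex^'n \<Rightarrow> complex^'m"
  assumes D: "complex_linear D" "(f has_derivative D) (at (p + t *s v))"
  shows "((\<lambda>s. f (p + s *s v) $ i) has_field_derivative D v $ i) (at t)"
proof -
  have "((\<lambda>s. p + s *s v) has_derivative (\<lambda>s. s *s v)) (at t)"
    using has_derivative_add[OF has_derivative_const
        bounded_linear_imp_has_derivative[OF bounded_linear_scale_vector]] by simp
  from has_derivative_compose[OF this D(2)]
  have "((\<lambda>s. f (p + s *s v)) has_derivative (\<lambda>s. D (s *s v))) (at t)" .
  from has_derivative_compose[OF this has_derivative_component]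
  have "((\<lambda>s. f (p + s *s v) $ i) has_derivative (\<lambda>s. D (s *s v) $ i)) (at t)" .
  moreover have "(\<lambda>s. D (s *s v) $ i) = (*) (D v $ i)"
  proof
    interpret Vector_Spaces.linear "(*s)" "(*s)" D by (rule D(1))
    show "D (s *s v) $ i = D v $ i * s" for s by (simp add: scale)
  qed
  ultimately show ?thesis by (simp add: has_field_derivative_def)
qed

lemma holomorphic_on_slice:
  assumes "holomorphic_map f U" "\<And>t. t \<in> T \<Longrightarrow> p + t *s v \<in> U"
  shows "(\<lambda>t. f (p + t *s v) $ i) holomorphic_on T"
proof -
  have "\<exists>f'. ((\<lambda>s. f (p + s *s v) $ i) has_field_derivative f') (at t)" if "t \<in> T" for t
    using assms that has_field_derivative_slice unfolding holomorphic_map_def by blast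
  then show ?thesis
    unfolding holomorphic_on_def field_differentiable_def
    using has_field_derivative_at_within by blast
qed

lemma holomorphic_map_continuous_on: "holomorphic_map f U \<Longrightarrow> continuous_on U f"
  unfolding holomorphic_map_def
  by (meson continuous_at_imp_continuous_on has_derivative_continuous)

lemma holomorphic_map_subset: "holomorphic_map f U \<Longrightarrow> V \<subseteq> U \<Longrightarrow> holomorphic_map f V"
  unfolding holomorphic_map_def by blast

lemma complex_linear_id: "complex_linear (\<lambda>v. v)"
  by unfold_locales auto

lemma holomorphic_map_diff:
  fixes f g :: "complex^'n \<Rightarrow> complex^'m"
  assumes "holomorphic_map f U" "holomorphic_map g U"
  shows "holomorphic_map (\<lambda>p. f p - g p) U"
  unfolding holomorphic_map_def
proof
  fix p assume "p \<in> U"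
  then obtain D E where D: "complex_linear D" "(f has_derivative D) (at p)"
    and E: "complex_linear E" "(g has_derivative E) (at p)"
    using assms unfolding holomorphic_map_def by blast
  interpret D: Vector_Spaces.linear "(*s)" "(*s)" D by (rule D(1))
  interpret E: Vector_Spaces.linear "(*s)" "(*s)" E by (rule E(1))
  have "complex_linear (\<lambda>v. D v - E v)"
    by unfold_locales (simp_all add: D.add E.add D.scale E.scale vector_ssub_ldistrib)
  then show "\<exists>D. complex_linear D \<and> ((\<lambda>p. f p - g p) has_derivative D) (at p)"
    using has_derivative_diff[OF D(2) E(2)] by blast
qed

lemma complex_linear_compose:
  "complex_linear D \<Longrightarrow> complex_linear E \<Longrightarrow> complex_linear (\<lambda>v. E (D v))"
  using Vector_Spaces.linear_compose by (auto simp: o_def)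

text \<open>Cauchy's inequality for each component on the slice in direction \<open>v\<close>, whose
  disc of radius \<open>r / norm v\<close> stays in the ball. The factor \<open>CARD('m)\<close>
  comes from bounding the norm by the sum over the components.\<close>

lemma Cauchy_estimate_map:
  fixes f :: "complex^'n \<Rightarrow> complex^'m"
  assumes f: "holomorphic_map f U" "cball p r \<subseteq> U" "0 < r"
    and B: "\<And>q. q \<in> cball p r \<Longrightarrow> norm (f q) \<le> B"
    and D: "complex_linear D" "(f has_derivative D) (at p)"
  shows "norm (D v) \<le> real CARD('m) * B / r * norm v"
proof (cases "v = 0")
  case True
  interpret Vector_Spaces.linear "(*s)" "(*s)" D by (rule D(1))
  show ?thesis using True by (simp add: zero)
next
  case False
  define s where "s = r / norm v"
  have s: "s > 0" using False f(3) by (simp add: s_def)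
  have in_ball: "p + t *s v \<in> cball p r" if "t \<in> cball 0 s" for t
    using that False by (simp add: dist_norm norm_scale_complex s_def field_simps)
  have "norm (D v $ i) \<le> B / r * norm v" for i
  proof -
    let ?g = "\<lambda>t. f (p + t *s v) $ i"
    have hol: "?g holomorphic_on cball 0 s"
      using f(1) by (rule holomorphic_on_slice) (use in_ball f(2) in blast)
    have "norm ((deriv ^^ 1) ?g 0) \<le> fact 1 * B / s ^ 1"
    proof (rule Cauchy_inequality[OF _ _ s])
      show "?g holomorphic_on ball 0 s" using hol by (rule holomorphic_on_subset) auto
      show "continuous_on (cball 0 s) ?g" using hol by (rule holomorphic_on_imp_continuous_on)
      show "norm (?g t) \<le> B" if "norm (0 - t) = s" for t
        using B[OF in_ball[of t]] that by (intro order_trans[OF Finite_Cartesian_Product.norm_nth_le]) auto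
    qed
    moreover have "deriv ?g 0 = D v $ i"
      by (intro DERIV_imp_deriv has_field_derivative_slice) (use D in auto)
    ultimately show ?thesis by (simp add: s_def)
  qed
  then have "(\<Sum>i\<in>UNIV. norm (D v $ i)) \<le> (\<Sum>i\<in>(UNIV :: 'm set). B / r * norm v)"
    by (intro sum_mono)
  moreover have "norm (D v) \<le> (\<Sum>i\<in>UNIV. norm (D v $ i))"
    unfolding norm_vec_def by (intro L2_set_le_sum) auto
  ultimately show ?thesis by simp
qed

text \<open>Weierstrass' theorem in several variables. The Cauchy estimate, applied to differences
  \<open>f m - f n\<close>, makes the derivatives uniformly Cauchy, so they converge to the
  derivative of the limit; complex linearity survives pointwise limits.\<close>

lemma holomorphic_map_uniform_limit:
  fixes f :: "nat \<Rightarrow> complex^'n \<Rightarrow> complex^'m"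
  assumes "open U" and hol: "\<And>n. holomorphic_map (f n) U"
    and ul: "\<And>K. compact K \<Longrightarrow> K \<subseteq> U \<Longrightarrow> uniform_limit K f g sequentially"
  shows "holomorphic_map g U"
  unfolding holomorphic_map_def
proof
  fix p assume "p \<in> U"
  then obtain r0 where r0: "r0 > 0" "cball p r0 \<subseteq> U"
    using \<open>open U\<close> open_contains_cball by blast
  \<comment> \<open>Half of the radius, so that the Cauchy estimate is available on a ball of radius
    \<open>r\<close> about every point of \<open>cball p r\<close>.\<close>
  define r where "r = r0 / 2"
  have r: "r > 0" "2 * r = r0" using r0 by (auto simp: r_def)
  have sub: "cball q r \<subseteq> cball p r0" if "q \<in> cball p r" for q
  proof
    fix y assume "y \<in> cball q r"
    then show "y \<in> cball p r0" using that r dist_triangle[of p y q] by auto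
  qed
  have ex: "\<exists>D. complex_linear D \<and> (f n has_derivative D) (at q)" if "q \<in> cball p r" for n q
  proof -
    have "q \<in> U" using that r0 r by auto
    then show ?thesis using hol unfolding holomorphic_map_def by blast
  qed
  define f' where "f' = (\<lambda>n q. SOME D. complex_linear D \<and> (f n has_derivative D) (at q))"
  have f': "complex_linear (f' n q)" "(f n has_derivative f' n q) (at q)"
    if "q \<in> cball p r" for n q
    using someI_ex[OF ex[OF that]] by (auto simp: f'_def)
  define M where "M = real CARD('m) / r"
  have M: "M > 0" using r by (simp add: M_def)
  have ulr: "uniform_limit (cball p r0) f g sequentially"
    using ul r0 by auto
  have cauchy: "\<exists>N. \<forall>m\<ge>N. \<forall>n\<ge>N. \<forall>q\<in>cball p r. \<forall>v. norm (f' m q v - f' n q v) \<le> e * norm v"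
    if "e > 0" for e
  proof -
    have "uniformly_Cauchy_on (cball p r0) f"
      using ulr uniformly_convergent_Cauchy uniformly_convergent_on_def by blast
    then obtain N where N: "\<And>q m n. q \<in> cball p r0 \<Longrightarrow> m \<ge> N \<Longrightarrow> n \<ge> N \<Longrightarrow> dist (f m q) (f n q) < e / M"
      using divide_pos_pos[OF \<open>e > 0\<close> M] unfolding uniformly_Cauchy_on_def by blast
    have "norm (f' m q v - f' n q v) \<le> e * norm v" if "m \<ge> N" "n \<ge> N" "q \<in> cball p r" for m n q v
    proof -
      have lin: "complex_linear (\<lambda>v. f' m q v - f' n q v)"
      proof -
        interpret D: Vector_Spaces.linear "(*s)" "(*s)" "f' m q" by (rule f') (rule that)
        interpret E: Vector_Spaces.linear "(*s)" "(*s)" "f' n q" by (rule f') (rule that)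
        show ?thesis
          by unfold_locales (simp_all add: D.add E.add D.scale E.scale vector_ssub_ldistrib)
      qed
      have "norm (f' m q v - f' n q v) \<le> real CARD('m) * (e / M) / r * norm v"
      proof (rule Cauchy_estimate_map[of "\<lambda>q. f m q - f n q" U q r])
        show "holomorphic_map (\<lambda>q. f m q - f n q) U" by (rule holomorphic_map_diff[OF hol hol])
        show "cball q r \<subseteq> U" using sub[OF that(3)] r0 by blast
        show "norm (f m y - f n y) \<le> e / M" if "y \<in> cball q r" for y
          using N[of y m n] sub[OF \<open>q \<in> cball p r\<close>] that \<open>m \<ge> N\<close> \<open>n \<ge> N\<close>
          by (force simp: dist_norm)
        show "((\<lambda>q. f m q - f n q) has_derivative (\<lambda>v. f' m q v - f' n q v)) (at q)"
          by (intro has_derivative_diff f' that)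
      qed (use r lin in auto)
      then show ?thesis using r by (simp add: M_def)
    qed
    then show ?thesis by blast
  qed
  have conv: "convergent (\<lambda>n. f' n q v)" if "q \<in> cball p r" for q v
  proof (rule Cauchy_convergent, rule CauchyI)
    fix e :: real assume "e > 0"
    then have "e / (norm v + 1) > 0" by (simp add: add_nonneg_pos)
    from cauchy[OF this] that
    obtain N where N: "\<And>m n. m \<ge> N \<Longrightarrow> n \<ge> N \<Longrightarrow>
        norm (f' m q v - f' n q v) \<le> e / (norm v + 1) * norm v"
      by blast
    have "e / (norm v + 1) * norm v < e"
      using \<open>e > 0\<close> by (simp add: divide_simps add_nonneg_pos)
    then show "\<exists>N. \<forall>m\<ge>N. \<forall>n\<ge>N. norm (f' m q v - f' n q v) < e"
      using N le_less_trans by blast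
  qed
  define g' where "g' = (\<lambda>q v. lim (\<lambda>n. f' n q v))"
  have g': "(\<lambda>n. f' n q v) \<longlonglongrightarrow> g' q v" if "q \<in> cball p r" for q v
    using conv[OF that] by (simp add: g'_def convergent_LIMSEQ_iff)
  have "\<exists>G. \<forall>q\<in>cball p r. (\<lambda>n. f n q) \<longlonglongrightarrow> G q \<and> (G has_derivative g' q) (at q within cball p r)"
  proof (rule has_derivative_sequence)
    show "(f n has_derivative f' n q) (at q within cball p r)" if "q \<in> cball p r" for n q
      using f'(2)[OF that] by (rule has_derivative_at_withinI)
    show "\<forall>\<^sub>F n in sequentially. \<forall>q\<in>cball p r. \<forall>v. norm (f' n q v - g' q v) \<le> e * norm v"
      if "e > 0" for e
    proof -
      obtain N where N: "\<And>m n q v. m \<ge> N \<Longrightarrow> n \<ge> N \<Longrightarrow> q \<in> cball p r \<Longrightarrow>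
          norm (f' m q v - f' n q v) \<le> e * norm v"
        using cauchy[OF \<open>e > 0\<close>] by blast
      have "norm (f' n q v - g' q v) \<le> e * norm v" if "n \<ge> N" "q \<in> cball p r" for n q v
      proof (rule LIMSEQ_le_const2)
        show "(\<lambda>m. norm (f' n q v - f' m q v)) \<longlonglongrightarrow> norm (f' n q v - g' q v)"
          by (intro tendsto_intros g' that)
        show "\<exists>M. \<forall>m\<ge>M. norm (f' n q v - f' m q v) \<le> e * norm v"
          using N that by blast
      qed
      then show ?thesis unfolding eventually_sequentially by blast
    qed
    show "(\<lambda>n. f n p) \<longlonglongrightarrow> g p" using tendsto_uniform_limitI[OF ulr] r0 by auto
  qed (use r in auto)
  then obtain G where G: "\<And>q. q \<in> cball p r \<Longrightarrow> (\<lambda>n. f n q) \<longlonglongrightarrow> G q"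
    "\<And>q. q \<in> cball p r \<Longrightarrow> (G has_derivative g' q) (at q within cball p r)" by blast
  have Gg: "G q = g q" if "q \<in> cball p r" for q
    using LIMSEQ_unique[OF G(1)[OF that]] tendsto_uniform_limitI[OF ulr, of q] that r by auto
  have "at p within cball p r = at p" using r by (intro at_within_interior) simp
  then have "(G has_derivative g' p) (at p)" using G(2)[of p] r by auto
  from has_derivative_transform_within_open[OF this open_ball[of p r]]
  have "(g has_derivative g' p) (at p)" using r Gg by auto
  moreover have "complex_linear (g' p)"
  proof -
    have p: "p \<in> cball p r" using r by simp
    have "g' p (u + v) = g' p u + g' p v" for u v
    proof (rule LIMSEQ_unique[OF g'[OF p]])
      have "f' n p (u + v) = f' n p u + f' n p v" for n
      proof -
        interpret D: Vector_Spaces.linear "(*s)" "(*s)" "f' n p" by (rule f'(1)[OF p])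
        show ?thesis by (rule D.add)
      qed
      then show "(\<lambda>n. f' n p (u + v)) \<longlonglongrightarrow> g' p u + g' p v"
        using tendsto_add[OF g'[OF p] g'[OF p]] by simp
    qed
    moreover have "g' p (c *s v) = c *s g' p v" for c v
    proof (rule LIMSEQ_unique[OF g'[OF p]])
      have "f' n p (c *s v) = c *s f' n p v" for n
      proof -
        interpret D: Vector_Spaces.linear "(*s)" "(*s)" "f' n p" by (rule f'(1)[OF p])
        show ?thesis by (rule D.scale)
      qed
      moreover have "(\<lambda>n. c *s f' n p v) \<longlonglongrightarrow> c *s g' p v"
        by (intro vec_tendstoI) (auto intro!: tendsto_intros tendsto_vec_nth[OF g'[OF p]])
      ultimately show "(\<lambda>n. f' n p (c *s v)) \<longlonglongrightarrow> c *s g' p v" by simp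
    qed
    ultimately show ?thesis by unfold_locales auto
  qed
  ultimately show "\<exists>D. complex_linear D \<and> (g has_derivative D) (at p)" by blast
qed

text \<open>In equal dimensions this is invertibility of the differential. The pointwise form passes
  through compositions, so that it can be carried along the orbit by functional equations.\<close>

definition regular_at :: "(complex^'n \<Rightarrow> complex^'m) \<Rightarrow> complex^'n \<Rightarrow> bool" where
  "regular_at f p \<longleftrightarrow> (\<exists>D. complex_linear D \<and> inj D \<and> (f has_derivative D) (at p))"

lemma regular_at_compose:
  assumes "regular_at f p" "regular_at g (f p)"
  shows "regular_at (\<lambda>x. g (f x)) p"
proof -
  obtain D E where "complex_linear D" "inj D" "(f has_derivative D) (at p)"
    "complex_linear E" "inj E" "(g has_derivative E) (at (f p))"
    using assms unfolding regular_at_def by blast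
  then show ?thesis
    unfolding regular_at_def
    by (intro exI[of _ "\<lambda>v. E (D v)"])
      (auto intro: complex_linear_compose has_derivative_compose simp: inj_def)
qed

lemma regular_at_cong:
  assumes "regular_at f p" "open U" "p \<in> U" "\<And>x. x \<in> U \<Longrightarrow> f x = g x"
  shows "regular_at g p"
  using assms has_derivative_transform_within_open unfolding regular_at_def by metis

lemma regular_at_scale:
  assumes "c \<noteq> 0"
  shows "regular_at (\<lambda>p. c *s p) p"
proof -
  have lin: "complex_linear (\<lambda>p. c *s p)"
    by unfold_locales (auto simp: vector_add_ldistrib vector_smult_assoc mult.commute)
  have "linear (\<lambda>p :: complex^'n. c *s p)"
    by (intro linearI) (auto simp: vec_eq_iff algebra_simps)
  then have "((\<lambda>p. c *s p) has_derivative (\<lambda>p. c *s p)) (at p)"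
    by (intro bounded_linear_imp_has_derivative) (simp add: linear_conv_bounded_linear)
  moreover have "inj (\<lambda>p :: complex^'n. c *s p)"
    using assms by (auto simp: inj_def vec_eq_iff)
  ultimately show ?thesis using lin unfolding regular_at_def by blast
qed

text \<open>Invariance of domain gives the open image and a continuous inverse. With a continuous
  inverse, invertibility of the differential at each point already gives differentiability of the
  inverse there.\<close>

lemma biholomorphism_image:
  fixes f :: "complex^'n \<Rightarrow> complex^'n"
  assumes U: "open U" and inj: "inj_on f U" and reg: "\<And>p. p \<in> U \<Longrightarrow> regular_at f p"
  shows "biholomorphism f U (f ` U)"
proof -
  have hol: "holomorphic_map f U" using reg by (auto simp: holomorphic_map_def regular_at_def)
  note cont = holomorphic_map_continuous_on[OF hol]
  have op: "open (f ` U)" by (rule invariance_of_domain[OF cont U inj])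
  have icont: "continuous_on (f ` U) (inv_into U f)"
    by (rule continuous_on_inverse_open[OF U cont _ inv_into_f_f[OF inj]]) auto
  have "holomorphic_map (inv_into U f) (f ` U)"
    unfolding holomorphic_map_def
  proof
    fix y assume y: "y \<in> f ` U"
    define x where "x = inv_into U f y"
    have x: "x \<in> U" "f x = y" using y by (auto simp: x_def inv_into_into f_inv_into_f)
    obtain D where D: "complex_linear D" "inj D" "(f has_derivative D) (at x)"
      using reg[OF x(1)] by (auto simp: regular_at_def)
    interpret D: Vector_Spaces.linear "(*s)" "(*s)" D by (rule D(1))
    have bij: "bij D" using D(1,2) vec.linear_inj_imp_surj[of D] by (auto simp: bij_def)
    define E where "E = inv_into UNIV D"
    have DE: "D (E v) = v" and ED: "E (D v) = v" for v
      using bij by (auto simp: E_def bij_is_surj surj_f_inv_f D(2) inv_f_f)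
    have E: "complex_linear E"
    proof unfold_locales
      show "E (u + v) = E u + E v" for u v by (metis DE ED D.add)
      show "E (c *s v) = c *s E v" for c v by (metis DE ED D.scale)
    qed
    have scaleR: "r *\<^sub>R v = complex_of_real r *s v" for r and v :: "complex^'n"
      unfolding vec_eq_iff vector_scaleR_component vector_smult_component
      by (simp add: scaleR_conv_of_real)
    have "linear E"
    proof (rule linearI)
      show "E (u + v) = E u + E v" for u v by (metis DE ED D.add)
      show "E (r *\<^sub>R v) = r *\<^sub>R E v" for r v by (metis DE ED D.scale scaleR)
    qed
    then have "bounded_linear E" by (simp add: linear_conv_bounded_linear)
    moreover have "continuous (at y) (inv_into U f)"
      using icont op y continuous_on_eq_continuous_at by blast
    ultimately have "(inv_into U f has_derivative E) (at y)"
      using has_derivative_inverse_basic[of f D "inv_into U f" y E "f ` U"] D(3) op y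
      by (auto simp: x_def[symmetric] ED f_inv_into_f o_def id_def)
    with E show "\<exists>D. complex_linear D \<and> (inv_into U f has_derivative D) (at y)" by blast
  qed
  with U op inj hol show ?thesis by (auto simp: biholomorphism_def inj_on_imp_bij_betw)
qed

text \<open>The chain rule for \<open>inv_into U f o f = id\<close> gives the differential a left
  inverse.\<close>

lemma biholomorphism_regular_at:
  assumes f: "biholomorphism f U V" and p: "p \<in> U"
  shows "regular_at f p"
proof -
  have U: "open U" "inj_on f U" "f ` U = V"
    using f by (auto simp: biholomorphism_def bij_betw_def)
  obtain D where D: "complex_linear D" "(f has_derivative D) (at p)"
    using f p by (auto simp: biholomorphism_def holomorphic_map_def)
  have "f p \<in> V" using p U by auto
  then obtain E where E: "(inv_into U f has_derivative E) (at (f p))"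
    using f by (auto simp: biholomorphism_def holomorphic_map_def)
  have "((\<lambda>x. inv_into U f (f x)) has_derivative (\<lambda>v. E (D v))) (at p)"
    by (rule has_derivative_compose[OF D(2) E])
  moreover have "((\<lambda>x. inv_into U f (f x)) has_derivative (\<lambda>v. v)) (at p)"
    by (rule has_derivative_transform_within_open[OF has_derivative_ident U(1) p])
      (simp add: inv_into_f_f U(2))
  ultimately have "(\<lambda>v. E (D v)) = (\<lambda>v. v)" by (rule has_derivative_unique)
  then have "inj D" by (metis injI)
  with D show ?thesis by (auto simp: regular_at_def)
qed

section \<open>Sectors around the real axes\<close>

text \<open>For \<open>z\<close> in the closed quarter plane around the half axis of sign
  \<open>a\<close> this is \<open>sqrt 2\<close> times the distance from \<open>z\<close> to its
  boundary. It is concave and positively homogeneous.\<close>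

definition depth :: "int \<Rightarrow> complex \<Rightarrow> real" where
  "depth a z = of_int a * Re z - \<bar>Im z\<bar>"

definition sector :: "real \<Rightarrow> int \<Rightarrow> int \<Rightarrow> (complex^2) set" where
  "sector R a b = {p. R < depth a (p $ 1) \<and> R < depth b (p $ 2)}"

text \<open>Adding \<open>v\<close> changes each of \<open>Re\<close> and \<open>Im\<close> by at
  most \<open>norm v\<close>.\<close>

lemma depth_add:
  assumes "a \<in> {1, -1}"
  shows "depth a u - 2 * norm v \<le> depth a (u + v)"
  using assms abs_Re_le_cmod[of v] abs_Im_le_cmod[of v] by (auto simp: depth_def)

lemma depth_scale_neg: "r \<ge> 0 \<Longrightarrow> depth (- a) (- complex_of_real r * z) = r * depth a z"
  by (simp add: depth_def abs_mult algebra_simps)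

lemma depth_scale: "r \<ge> 0 \<Longrightarrow> depth a (complex_of_real r * z) = r * depth a z"
  by (simp add: depth_def abs_mult algebra_simps)

text \<open>\<open>Re (z^2)\<close> factors as
  \<open>(a Re z - \<bar>Im z\<bar>) (a Re z + \<bar>Im z\<bar>)\<close>, and the second factor
  dominates the first. This is why quarter planes are the right regions for
  \<open>exp (- z^2)\<close>.\<close>

lemma Re_square_ge:
  assumes "a \<in> {1, -1}" "0 \<le> r" "r \<le> depth a z"
  shows "r\<^sup>2 \<le> Re (z\<^sup>2)"
proof -
  let ?x = "of_int a * Re z" and ?y = "\<bar>Im z\<bar>"
  have "r * r \<le> (?x - ?y) * (?x + ?y)"
    using assms by (intro mult_mono) (auto simp: depth_def)
  also have "\<dots> = Re (z\<^sup>2)"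
    using assms(1) by (auto simp: power2_eq_square algebra_simps)
  finally show ?thesis by (simp add: power2_eq_square)
qed

lemma norm_exp_neg_square_le:
  assumes "a \<in> {1, -1}" "0 \<le> r" "r \<le> depth a z"
  shows "norm (exp (- z\<^sup>2)) \<le> exp (- r\<^sup>2)"
  using Re_square_ge[OF assms] by simp

text \<open>Concavity makes the sectors convex, as needed for the mean value inequality and for
  connectedness of the basins.\<close>

lemma depth_convex:
  assumes "0 \<le> u" "0 \<le> v"
  shows "u * depth a x + v * depth a y \<le> depth a (u *\<^sub>R x + v *\<^sub>R y)"
proof -
  have "\<bar>u * Im x + v * Im y\<bar> \<le> u * \<bar>Im x\<bar> + v * \<bar>Im y\<bar>"
    using assms by (metis abs_mult abs_of_nonneg abs_triangle_ineq)
  then show ?thesis by (simp add: depth_def algebra_simps)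
qed

lemma convex_sector: "convex (sector R a b)"
proof (rule convexI)
  fix x y u v assume *: "x \<in> sector R a b" "y \<in> sector R a b" "0 \<le> u" "0 \<le> v" "u + v = (1::real)"
  have "R < u * s + v * t" if "R < s" "R < t" for s t
    using convex_bound_lt[of "- s" "- R" "- t" u v] * that by simp
  with * depth_convex[OF *(3,4)] show "u *\<^sub>R x + v *\<^sub>R y \<in> sector R a b"
    unfolding sector_def by (fastforce intro: less_le_trans)
qed

lemma open_sector: "open (sector R a b)"
  unfolding sector_def depth_def
  by (intro open_Collect_conj open_Collect_less continuous_intros)

lemma sector_mono: "R \<le> R' \<Longrightarrow> sector R' a b \<subseteq> sector R a b"
  by (auto simp: sector_def)

lemma sector_add:
  assumes "a \<in> {1, -1}" "b \<in> {1, -1}" "p \<in> sector R a b" "norm v \<le> r"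
  shows "p + v \<in> sector (R - 2 * r) a b"
  using assms depth_add[of a "p $ 1" "v $ 1"] depth_add[of b "p $ 2" "v $ 2"]
    Finite_Cartesian_Product.norm_nth_le[of v 1] Finite_Cartesian_Product.norm_nth_le[of v 2]
  by (auto simp: sector_def)

lemma sector_scale:
  assumes "r > 0"
  shows "complex_of_real r *s p \<in> sector (r * R) a b \<longleftrightarrow> p \<in> sector R a b"
  using assms by (simp add: sector_def depth_scale)

lemma sector_signs:
  assumes "p \<in> sector R a b" "p \<in> sector R' a' b'" "R \<ge> 0" "R' \<ge> 0"
    "a \<in> {1, -1}" "b \<in> {1, -1}" "a' \<in> {1, -1}" "b' \<in> {1, -1}"
  shows "a = a'" "b = b'"
  using assms by (auto simp: sector_def depth_def)

lemma uniform_limit_shift: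
  assumes "uniform_limit A (\<lambda>n. f (n + k)) g sequentially"
  shows "uniform_limit A f g sequentially"
  unfolding uniform_limit_iff
proof (intro allI impI)
  fix e :: real assume "e > 0"
  then have "\<forall>\<^sub>F n in sequentially. \<forall>x\<in>A. dist (f (n + k) x) (g x) < e"
    using assms by (simp add: uniform_limit_iff)
  then show "\<forall>\<^sub>F n in sequentially. \<forall>x\<in>A. dist (f n x) (g x) < e"
    by (rule eventually_sequentially_seg[THEN iffD1])
qed

lemma vector_2_norm_le: "norm (vector [a, b] :: complex^2) \<le> norm a + norm b"
proof -
  have "norm (vector [a, b] :: complex^2) \<le> (\<Sum>i\<in>UNIV. norm ((vector [a, b] :: complex^2) $ i))"
    unfolding norm_vec_def by (intro L2_set_le_sum) auto
  then show ?thesis by (simp add: sum_2)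
qed

section \<open>Conjugation to the linear part\<close>

locale henon_map =
  fixes \<delta> :: real
  assumes delta: "\<delta> > 2"
begin

abbreviation F :: "complex^2 \<Rightarrow> complex^2" where "F \<equiv> henon \<delta>"

lemma F_biholomorphism: "biholomorphism F UNIV UNIV"
  using henon_automorphism delta by simp

lemma F_bij: "bij F"
  using F_biholomorphism by (simp add: biholomorphism_def)

lemma iterate_bij: "bij (F ^^ n)"
  using F_bij by (rule bij_betw_funpow)

lemma iterate_regular_at: "regular_at (F ^^ n) p"
proof (induction n)
  case 0
  show ?case using regular_at_scale[of 1 p] by (simp add: id_def)
next
  case (Suc n)
  from regular_at_compose[OF this biholomorphism_regular_at[OF F_biholomorphism UNIV_I]]
  show ?case by (simp add: o_def)
qed

lemma iterate_holomorphic: "holomorphic_map (F ^^ n) U"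
  using iterate_regular_at by (auto simp: holomorphic_map_def regular_at_def)

lemma iterate_continuous: "continuous_on U (F ^^ n)"
  using iterate_holomorphic by (rule holomorphic_map_continuous_on)

lemma F_1: "F p $ 1 = - of_real \<delta> * p $ 2 + exp (- (p $ 1)\<^sup>2)"
  and F_2: "F p $ 2 = p $ 1"
  by (simp_all add: henon_def)

lemma iterate_iterate: "(F ^^ m) ((F ^^ n) p) = (F ^^ (m + n)) p"
  by (simp add: funpow_add)

text \<open>Over two steps the linear part is a scalar, so the normalization in
  \<open>phi_approx\<close> only divides by a power of \<open>-\<delta>\<close>.\<close>

lemma F_F: "F (F p) = - of_real \<delta> *s p + vector [exp (- (F p $ 1)\<^sup>2), exp (- (p $ 1)\<^sup>2)]"
  by (simp add: vec_eq_iff forall_2 F_1 F_2)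

text \<open>The new first coordinate is \<open>-\<delta> w\<close> up to an error of modulus at most
  \<open>exp (-4) \<le> 1/5\<close>, so its depth exceeds \<open>2 R - 2/5 \<ge> 3/2 R\<close>. The
  second coordinate is the old \<open>z\<close>, whose depth has not grown; hence only
  \<open>R\<close> in the second claim.\<close>

lemma sector_step:
  assumes ab: "a \<in> {1, -1}" "b \<in> {1, -1}" and R: "R \<ge> 2" and p: "p \<in> sector R a b"
  shows "3 / 2 * R < depth (- b) (F p $ 1)" "F p \<in> sector R (- b) a"
proof -
  have d: "R < depth a (p $ 1)" "R < depth b (p $ 2)" using p by (auto simp: sector_def)
  have "exp (4::real) \<ge> 5" using exp_ge_add_one_self[of "4::real"] by simp
  then have "exp (- (2::real)\<^sup>2) \<le> 1 / 5" by (simp add: exp_minus field_simps)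
  moreover have "norm (exp (- (p $ 1)\<^sup>2)) \<le> exp (- (2::real)\<^sup>2)"
    using d R ab by (intro norm_exp_neg_square_le[of a]) auto
  ultimately have e: "norm (exp (- (p $ 1)\<^sup>2)) \<le> 1 / 5" by linarith
  have "\<delta> * depth b (p $ 2) - 2 * norm (exp (- (p $ 1)\<^sup>2)) \<le> depth (- b) (F p $ 1)"
  proof -
    have "- b \<in> {1, -1}" using ab by auto
    from depth_add[OF this, of "- of_real \<delta> * p $ 2" "exp (- (p $ 1)\<^sup>2)"]
    show ?thesis using depth_scale_neg[of \<delta> b "p $ 2"] delta by (simp only: F_1)
  qed
  moreover have "2 * depth b (p $ 2) \<le> \<delta> * depth b (p $ 2)"
    using delta d R by (intro mult_right_mono) auto
  ultimately show 1: "3 / 2 * R < depth (- b) (F p $ 1)" using e d R by linarith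
  then show "F p \<in> sector R (- b) a" using d R by (simp add: sector_def F_2)
qed

text \<open>After two steps both coordinates have been replaced once, so the growth factor applies
  to the pair.\<close>

lemma sector_two_steps:
  assumes "a \<in> {1, -1}" "b \<in> {1, -1}" "R \<ge> 2" "p \<in> sector R a b"
  shows "F (F p) \<in> sector (3 / 2 * R) (- a) (- b)"
  using sector_step[OF assms] sector_step(1)[of "- b" a R "F p"] assms
  by (auto simp: sector_def F_2)

lemma sector_even_steps:
  assumes ab: "a \<in> {1, -1}" "b \<in> {1, -1}" "R \<ge> 2" "p \<in> sector R a b"
  shows "(F ^^ (2 * m)) p \<in> sector ((3 / 2) ^ m * R) ((-1) ^ m * a) ((-1) ^ m * b)"
proof (induction m)
  case (Suc m)
  have s: "(-1) ^ m * a \<in> {1, -1}" "(-1) ^ m * b \<in> {1, -1}"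
    using ab(1,2) minus_one_power_iff[of m, where 'a = int] by (auto split: if_splits)
  have "(3 / 2) ^ m * R \<ge> 1 * 2" using ab(3) by (intro mult_mono) auto
  from sector_two_steps[OF s _ Suc] this show ?case by (simp add: algebra_simps)
qed (use ab in simp)

lemma sector_four_steps:
  assumes "a \<in> {1, -1}" "b \<in> {1, -1}" "R \<ge> 2" "p \<in> sector R a b"
  shows "(F ^^ (4 * m)) p \<in> sector ((9 / 4) ^ m * R) a b"
  using sector_even_steps[OF assms, of "2 * m"] by (simp add: power_mult power2_eq_square)

section \<open>Construction of the conjugacy on the sectors\<close>

definition phi_approx :: "nat \<Rightarrow> complex^2 \<Rightarrow> complex^2" where
  "phi_approx k p = inverse ((- of_real \<delta>) ^ k) *s (F ^^ (2 * k)) p"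

text \<open>Where the sequence diverges, \<open>lim\<close> is an arbitrary value;
  \<open>phi\<close> is used on the basins only.\<close>

definition phi :: "complex^2 \<Rightarrow> complex^2" where
  "phi p = lim (\<lambda>k. phi_approx k p)"

lemma phi_approx_Suc:
  fixes p k
  defines "x \<equiv> (F ^^ (2 * k)) p"
  shows "phi_approx (Suc k) p - phi_approx k p =
    inverse ((- of_real \<delta>) ^ Suc k) *s vector [exp (- (F x $ 1)\<^sup>2), exp (- (x $ 1)\<^sup>2)]"
proof -
  have "(F ^^ (2 * Suc k)) p = F (F x)" by (simp add: x_def)
  then have "phi_approx (Suc k) p = inverse ((- of_real \<delta>) ^ Suc k) *s
      (- of_real \<delta> *s x + vector [exp (- (F x $ 1)\<^sup>2), exp (- (x $ 1)\<^sup>2)])"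
    unfolding phi_approx_def by (simp only: F_F)
  moreover have "phi_approx k p = inverse ((- of_real \<delta>) ^ Suc k) *s (- of_real \<delta> *s x)"
    using delta by (simp add: phi_approx_def x_def vector_smult_assoc)
  ultimately show ?thesis by (simp add: vector_add_ldistrib)
qed

text \<open>The orbit never leaves sectors of threshold \<open>R\<close>, so both exponentials are
  at most \<open>exp (- R^2)\<close>; dividing by \<open>\<delta>^(k+1) \<ge> 2^(k+1)\<close> makes
  the increments geometric. The bound is uniform on the unbounded sector and decays in
  \<open>R\<close>, which yields both convergence and closeness to the identity.\<close>

lemma phi_approx_step_bound:
  assumes ab: "a \<in> {1, -1}" "b \<in> {1, -1}" "R \<ge> 2" "p \<in> sector R a b"
  shows "norm (phi_approx (Suc k) p - phi_approx k p) \<le> exp (- R\<^sup>2) * (1 / 2) ^ k"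
proof -
  define x where "x = (F ^^ (2 * k)) p"
  define a' b' where "a' = (-1) ^ k * a" and "b' = (-1) ^ k * b"
  have s: "a' \<in> {1, -1}" "b' \<in> {1, -1}"
    using ab(1,2) minus_one_power_iff[of k, where 'a = int] by (auto simp: a'_def b'_def split: if_splits)
  have "(3 / 2) ^ k * R \<ge> 1 * R" using ab(3) by (intro mult_right_mono) auto
  then have x: "x \<in> sector R a' b'"
    using sector_even_steps[OF ab, of k] sector_mono[of R "(3/2)^k*R"]
    by (auto simp: x_def a'_def b'_def)
  have "norm (exp (- (x $ 1)\<^sup>2)) \<le> exp (- R\<^sup>2)"
    using x s(1) ab(3) by (intro norm_exp_neg_square_le[of a']) (auto simp: sector_def)
  moreover have "norm (exp (- (F x $ 1)\<^sup>2)) \<le> exp (- R\<^sup>2)"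
    using sector_step(2)[OF s ab(3) x] s ab(3)
    by (intro norm_exp_neg_square_le[of "- b'"]) (auto simp: sector_def)
  ultimately have e: "norm (vector [exp (- (F x $ 1)\<^sup>2), exp (- (x $ 1)\<^sup>2)] :: complex^2) \<le> 2 * exp (- R\<^sup>2)"
    using vector_2_norm_le[of "exp (- (F x $ 1)\<^sup>2)" "exp (- (x $ 1)\<^sup>2)"] by linarith
  have "norm (phi_approx (Suc k) p - phi_approx k p) =
      inverse (\<delta> ^ Suc k) * norm (vector [exp (- (F x $ 1)\<^sup>2), exp (- (x $ 1)\<^sup>2)] :: complex^2)"
    unfolding phi_approx_Suc x_def[symmetric] norm_scale_complex
    using delta by (simp add: norm_mult norm_inverse norm_power)
  also have "\<dots> \<le> inverse (2 ^ Suc k) * (2 * exp (- R\<^sup>2))"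
    using e delta by (intro mult_mono le_imp_inverse_le power_mono) auto
  also have "\<dots> = exp (- R\<^sup>2) * (1 / 2) ^ k" by (simp add: field_simps)
  finally show ?thesis .
qed

lemma phi_approx_sum: "phi_approx n p = p + (\<Sum>k<n. phi_approx (Suc k) p - phi_approx k p)"
  using sum_lessThan_telescope[of "\<lambda>k. phi_approx k p" n] by (simp add: phi_approx_def)

text \<open>The threshold \<open>2\<close> is the one from which \<open>sector_step\<close>
  applies.\<close>

definition sectors :: "(complex^2) set" where
  "sectors = (\<Union>a\<in>{1, -1}. \<Union>b\<in>{1, -1}. sector 2 a b)"

lemma phi_uniform_limit_sectors: "uniform_limit sectors phi_approx phi sequentially"
proof -
  let ?d = "\<lambda>k p. phi_approx (Suc k) p - phi_approx k p"
  have "uniform_limit sectors (\<lambda>n p. \<Sum>k<n. ?d k p) (\<lambda>p. suminf (\<lambda>k. ?d k p)) sequentially"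
    using phi_approx_step_bound[of _ _ 2]
    by (intro Weierstrass_m_test[of _ _ "\<lambda>k. exp (- 2\<^sup>2) * (1 / 2) ^ k"] summable_mult summable_geometric)
      (auto simp: sectors_def)
  then have "uniform_limit sectors (\<lambda>n p. p + (\<Sum>k<n. ?d k p)) (\<lambda>p. p + suminf (\<lambda>k. ?d k p)) sequentially"
    by (intro uniform_limit_intros) auto
  then have ul: "uniform_limit sectors phi_approx (\<lambda>p. p + suminf (\<lambda>k. ?d k p)) sequentially"
    by (simp only: phi_approx_sum[symmetric])
  moreover have "p + suminf (\<lambda>k. ?d k p) = phi p" if "p \<in> sectors" for p
    using tendsto_uniform_limitI[OF ul that] by (simp add: phi_def limI)
  ultimately show ?thesis by (simp cong: uniform_limit_cong')
qed

lemma phi_near_identity: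
  assumes ab: "a \<in> {1, -1}" "b \<in> {1, -1}" "R \<ge> 2" "p \<in> sector R a b"
  shows "norm (phi p - p) \<le> 2 * exp (- R\<^sup>2)"
proof -
  let ?d = "\<lambda>k. phi_approx (Suc k) p - phi_approx k p"
  have "p \<in> sectors" using sector_mono[OF ab(3)] ab by (auto simp: sectors_def)
  then have "(\<lambda>n. phi_approx n p) \<longlonglongrightarrow> phi p"
    using tendsto_uniform_limitI[OF phi_uniform_limit_sectors] by blast
  then have "(\<lambda>n. norm (phi_approx n p - p)) \<longlonglongrightarrow> norm (phi p - p)"
    by (intro tendsto_intros)
  moreover have "norm (phi_approx n p - p) \<le> 2 * exp (- R\<^sup>2)" for n
  proof -
    have "norm (phi_approx n p - p) \<le> (\<Sum>k<n. exp (- R\<^sup>2) * (1 / 2) ^ k)"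
      unfolding phi_approx_sum[of n] using phi_approx_step_bound[OF ab]
      by (auto intro!: sum_norm_le)
    also have "\<dots> = exp (- R\<^sup>2) * (\<Sum>k<n. (1 / 2) ^ k)" by (simp add: sum_distrib_left)
    also have "\<dots> \<le> exp (- R\<^sup>2) * 2"
      by (intro mult_left_mono) (simp_all add: sum_gp_strict)
    finally show ?thesis by simp
  qed
  ultimately show ?thesis by (intro LIMSEQ_le_const2) auto
qed

text \<open>Only multiples of four are considered, since \<open>F\<close> returns to the same pair
  of signs after four steps; other iterates of a point of the basin lie in sectors with other
  signs.\<close>

definition basin :: "int \<Rightarrow> int \<Rightarrow> (complex^2) set" where
  "basin a b = {p. \<exists>m. (F ^^ (4 * m)) p \<in> sector 2 a b}"

definition basins :: "(complex^2) set" where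
  "basins = (\<Union>a\<in>{1, -1}. \<Union>b\<in>{1, -1}. basin a b)"

lemma basins_eq: "basins = (\<Union>m. (F ^^ (4 * m)) -` sectors)"
  by (auto simp: basins_def basin_def sectors_def)

lemma basin_deep:
  assumes ab: "a \<in> {1, -1}" "b \<in> {1, -1}" and p: "p \<in> basin a b"
  shows "\<exists>m0. \<forall>m\<ge>m0. (F ^^ (4 * m)) p \<in> sector R a b"
proof -
  obtain k where k: "(F ^^ (4 * k)) p \<in> sector 2 a b" using p by (auto simp: basin_def)
  obtain n where n: "R < (9 / 4) ^ n" using real_arch_pow[of "9 / 4" R] by auto
  have "(F ^^ (4 * m)) p \<in> sector R a b" if "m \<ge> n + k" for m
  proof -
    have "(F ^^ (4 * m)) p = (F ^^ (4 * (m - k))) ((F ^^ (4 * k)) p)"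
      using that by (simp add: iterate_iterate flip: distrib_left)
    moreover have "(9 / 4) ^ n \<le> (9 / 4 :: real) ^ (m - k)"
      using that by (intro power_increasing) auto
    then have "R \<le> (9 / 4) ^ (m - k) * 2"
      using n zero_le_power[of "9 / 4 :: real" "m - k"] by linarith
    ultimately show ?thesis
      using sector_four_steps[OF ab order_refl k, of "m - k"] sector_mono[of R "(9 / 4) ^ (m - k) * 2"]
      by auto
  qed
  then show ?thesis by blast
qed

lemma sectors_iterate: "p \<in> sectors \<Longrightarrow> (F ^^ (4 * m)) p \<in> sectors"
proof -
  assume "p \<in> sectors"
  then obtain a b where ab: "a \<in> {1, -1}" "b \<in> {1, -1}" "p \<in> sector 2 a b"
    unfolding sectors_def by blast
  have "(2::real) \<le> (9 / 4) ^ m * 2" by simp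
  from sector_mono[OF this] sector_four_steps[OF ab(1,2) order_refl ab(3), of m]
  have "(F ^^ (4 * m)) p \<in> sector 2 a b" by blast
  then show ?thesis using ab unfolding sectors_def by blast
qed

lemma open_sectors: "open sectors"
  unfolding sectors_def by (intro open_UN ballI open_sector)

lemma open_vimage_iterate: "open A \<Longrightarrow> open ((F ^^ n) -` A)"
  by (rule open_vimage[OF _ iterate_continuous])

lemma open_basin: "open (basin a b)"
proof -
  have "basin a b = (\<Union>m. (F ^^ (4 * m)) -` sector 2 a b)" by (auto simp: basin_def)
  then show ?thesis by (simp add: open_UN open_vimage_iterate open_sector)
qed

lemma open_basins: "open basins"
  unfolding basins_eq by (intro open_UN ballI open_vimage_iterate open_sectors)

text \<open>The open preimages of \<open>sectors\<close> increase with \<open>m\<close> by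
  \<open>sectors_iterate\<close>, so one member of a finite subcover is enough.\<close>

lemma compact_subset_basins:
  assumes K: "compact K" "K \<subseteq> basins"
  obtains m where "K \<subseteq> (F ^^ (4 * m)) -` sectors"
proof -
  obtain C where C: "finite C" "K \<subseteq> (\<Union>m\<in>C. (F ^^ (4 * m)) -` sectors)"
  proof (rule compactE_image[OF K(1)])
    show "open ((F ^^ (4 * m)) -` sectors)" for m by (rule open_vimage_iterate[OF open_sectors])
    show "K \<subseteq> (\<Union>m\<in>UNIV. (F ^^ (4 * m)) -` sectors)" using K(2) by (simp only: basins_eq)
  qed
  define M where "M = Max (insert 0 C)"
  have "(F ^^ (4 * M)) p \<in> sectors" if "m \<in> C" "(F ^^ (4 * m)) p \<in> sectors" for m p
  proof -
    have "m \<le> M" using that(1) C(1) by (simp add: M_def)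
    then have "(F ^^ (4 * M)) p = (F ^^ (4 * (M - m))) ((F ^^ (4 * m)) p)"
      by (simp add: iterate_iterate flip: distrib_left)
    then show ?thesis using sectors_iterate[OF that(2)] by simp
  qed
  then have "K \<subseteq> (F ^^ (4 * M)) -` sectors" using C(2) by blast
  then show ?thesis by (rule that)
qed

section \<open>The conjugacy on the basins\<close>

lemma phi_approx_iterate:
  "phi_approx (k + m) p = inverse ((- of_real \<delta>) ^ m) *s phi_approx k ((F ^^ (2 * m)) p)"
  by (simp add: phi_approx_def vector_smult_assoc power_add mult.commute iterate_iterate
      flip: distrib_left)

text \<open>The convergence on the sectors is pulled back by \<open>F^(4m)\<close>. This costs a
  constant factor and an index shift by \<open>2 * m\<close>, neither of which affects uniform
  convergence.\<close>

lemma phi_uniform_limit_vimage: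
  "uniform_limit ((F ^^ (4 * m)) -` sectors) phi_approx phi sequentially"
proof -
  let ?c = "inverse ((- of_real \<delta>) ^ (2 * m)) :: complex" and ?V = "(F ^^ (4 * m)) -` sectors"
  have "uniform_limit ?V (\<lambda>n p. phi_approx n ((F ^^ (4 * m)) p)) (\<lambda>p. phi ((F ^^ (4 * m)) p)) sequentially"
    by (rule uniform_limit_compose'[OF phi_uniform_limit_sectors]) auto
  moreover have "bounded_linear (\<lambda>v :: complex^2. ?c *s v)"
    by (intro linear_conv_bounded_linear[THEN iffD1] linearI) (auto simp: vec_eq_iff algebra_simps)
  ultimately have "uniform_limit ?V (\<lambda>n p. ?c *s phi_approx n ((F ^^ (4 * m)) p))
      (\<lambda>p. ?c *s phi ((F ^^ (4 * m)) p)) sequentially"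
    using bounded_linear.uniform_limit by blast
  moreover have "?c *s phi_approx n ((F ^^ (4 * m)) p) = phi_approx (n + 2 * m) p" for n p
    using phi_approx_iterate[of n "2 * m" p] by simp
  ultimately have "uniform_limit ?V (\<lambda>n. phi_approx (n + 2 * m)) (\<lambda>p. ?c *s phi ((F ^^ (4 * m)) p)) sequentially"
    by (simp only:)
  then have ul: "uniform_limit ?V phi_approx (\<lambda>p. ?c *s phi ((F ^^ (4 * m)) p)) sequentially"
    by (rule uniform_limit_shift)
  have "?c *s phi ((F ^^ (4 * m)) p) = phi p" if "p \<in> ?V" for p
    using tendsto_uniform_limitI[OF ul that] by (simp only: phi_def limI)
  then have "uniform_limit ?V phi_approx (\<lambda>p. ?c *s phi ((F ^^ (4 * m)) p)) sequentially \<longleftrightarrow>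
      uniform_limit ?V phi_approx phi sequentially"
    by (intro uniform_limit_cong') auto
  with ul show ?thesis by blast
qed

lemma phi_uniform_limit:
  assumes "compact K" "K \<subseteq> basins"
  shows "uniform_limit K phi_approx phi sequentially"
proof -
  obtain m where "K \<subseteq> (F ^^ (4 * m)) -` sectors" using compact_subset_basins[OF assms] .
  then show ?thesis using phi_uniform_limit_vimage uniform_limit_on_subset by blast
qed

lemma phi_limit: "p \<in> basins \<Longrightarrow> (\<lambda>k. phi_approx k p) \<longlonglongrightarrow> phi p"
  using tendsto_uniform_limitI[OF phi_uniform_limit[of "{p}"]] by auto

lemma phi_holomorphic: "holomorphic_map phi basins"
proof (rule holomorphic_map_uniform_limit[OF open_basins])
  show "holomorphic_map (phi_approx n) basins" for n
  proof -
    have "regular_at (phi_approx n) p" for p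
      unfolding phi_approx_def[abs_def]
      by (rule regular_at_compose[OF iterate_regular_at regular_at_scale]) (use delta in auto)
    then show ?thesis by (auto simp: holomorphic_map_def regular_at_def)
  qed
qed (rule phi_uniform_limit)


lemma phi_iterate:
  assumes "p \<in> basins"
  shows "phi p = inverse ((- of_real \<delta>) ^ m) *s phi ((F ^^ (2 * m)) p)"
    and "phi ((F ^^ (2 * m)) p) = (- of_real \<delta>) ^ m *s phi p"
proof -
  have "phi_approx k ((F ^^ (2 * m)) p) = (- of_real \<delta>) ^ m *s phi_approx (k + m) p" for k
    using delta by (simp add: phi_approx_iterate vector_smult_assoc)
  moreover have "(\<lambda>k. (- of_real \<delta>) ^ m *s phi_approx (k + m) p) \<longlonglongrightarrow> (- of_real \<delta>) ^ m *s phi p"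
    using LIMSEQ_ignore_initial_segment[OF phi_limit[OF assms], of m]
    by (intro vec_tendstoI) (auto intro!: tendsto_intros tendsto_vec_nth)
  ultimately show "phi ((F ^^ (2 * m)) p) = (- of_real \<delta>) ^ m *s phi p"
    by (simp add: phi_def limI)
  then show "phi p = inverse ((- of_real \<delta>) ^ m) *s phi ((F ^^ (2 * m)) p)"
    using delta by (simp add: vector_smult_assoc)
qed

lemma phi_four_steps: "p \<in> basins \<Longrightarrow> phi ((F ^^ (4 * m)) p) = of_real (\<delta> ^ (2 * m)) *s phi p"
  using phi_iterate(2)[of p "2 * m"] by (simp add: power_mult)

lemma basin_subset: "a \<in> {1, -1} \<Longrightarrow> b \<in> {1, -1} \<Longrightarrow> basin a b \<subseteq> basins"
  unfolding basins_def by blast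

lemma sector_subset_basin:
  assumes "R \<ge> 2"
  shows "sector R a b \<subseteq> basin a b"
proof
  fix p assume "p \<in> sector R a b"
  then have "(F ^^ (4 * 0)) p \<in> sector 2 a b" using sector_mono[OF assms] by auto
  then show "p \<in> basin a b" unfolding basin_def by blast
qed

section \<open>Contraction estimates deep inside the sectors\<close>

lemma exp_neg_9: "exp (- 9 :: real) \<le> 1 / 10"
  using exp_ge_add_one_self[of "9::real"] by (simp add: exp_minus field_simps)

lemma phi_near_identity_3:
  assumes "a \<in> {1, -1}" "b \<in> {1, -1}" "p \<in> sector 3 a b"
  shows "norm (phi p - p) \<le> 1 / 5"
  using phi_near_identity[OF assms(1,2) _ assms(3)] exp_neg_9 by simp

text \<open>A unit ball about a point of threshold \<open>5\<close> stays in threshold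
  \<open>3\<close>, because moving by \<open>1\<close> costs at most \<open>2\<close> in depth.
  There \<open>phi - id\<close> is bounded by \<open>1/5\<close>, and the Cauchy estimate in
  dimension two gives \<open>2/5 \<le> 1/2\<close>.\<close>

lemma phi_minus_id_derivative:
  assumes ab: "a \<in> {1, -1}" "b \<in> {1, -1}" and p: "p \<in> sector 5 a b"
  shows "\<exists>D. complex_linear D \<and> (phi has_derivative D) (at p) \<and>
    (\<forall>v. norm (D v - v) \<le> 1 / 2 * norm v)"
proof -
  have pb: "p \<in> basins" using sector_subset_basin[of 5 a b] basin_subset[OF ab] p by auto
  obtain D where D: "complex_linear D" "(phi has_derivative D) (at p)"
    using phi_holomorphic pb unfolding holomorphic_map_def by blast
  have sub: "cball p 1 \<subseteq> sector 3 a b"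
  proof
    fix q assume "q \<in> cball p 1"
    then show "q \<in> sector 3 a b"
      using sector_add[OF ab p, of "q - p" 1] by (simp add: dist_norm norm_minus_commute)
  qed
  have s3: "sector 3 a b \<subseteq> basins" using sector_subset_basin[of 3 a b] basin_subset[OF ab] by auto
  interpret D: Vector_Spaces.linear "(*s)" "(*s)" D by (rule D(1))
  have "complex_linear (\<lambda>v. D v - v)"
    by unfold_locales (simp_all add: D.add D.scale vector_ssub_ldistrib)
  moreover have "holomorphic_map (\<lambda>x. x) (sector 3 a b)"
    unfolding holomorphic_map_def using complex_linear_id has_derivative_ident by blast
  then have "holomorphic_map (\<lambda>x. phi x - x) (sector 3 a b)"
    by (rule holomorphic_map_diff[OF holomorphic_map_subset[OF phi_holomorphic s3]])
  ultimately have "norm (D v - v) \<le> real CARD(2) * (1 / 5) / 1 * norm v" for v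
    using sub phi_near_identity_3[OF ab] has_derivative_diff[OF D(2) has_derivative_ident]
    by (intro Cauchy_estimate_map[of "\<lambda>x. phi x - x" "sector 3 a b" p 1]) auto
  then have "norm (D v - v) \<le> 2 / 5 * norm v" for v by simp
  moreover have "2 / 5 * norm v \<le> 1 / 2 * norm v" for v :: "complex^2" by simp
  ultimately have "norm (D v - v) \<le> 1 / 2 * norm v" for v using order_trans by blast
  with D show ?thesis by blast
qed

lemma phi_minus_id_onorm:
  fixes x a b
  defines "D \<equiv> frechet_derivative phi (at x)"
  assumes ab: "a \<in> {1, -1}" "b \<in> {1, -1}" and x: "x \<in> sector 5 a b"
  shows "((\<lambda>x. phi x - x) has_derivative (\<lambda>v. D v - v)) (at x)"
    and "onorm (\<lambda>v. D v - v) \<le> 1 / 2"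
proof -
  obtain E where E: "(phi has_derivative E) (at x)" "\<forall>v. norm (E v - v) \<le> 1 / 2 * norm v"
    using phi_minus_id_derivative[OF ab x] by blast
  have DE: "D = E" unfolding D_def by (rule frechet_derivative_at[OF E(1), symmetric])
  show "((\<lambda>x. phi x - x) has_derivative (\<lambda>v. D v - v)) (at x)"
    unfolding DE by (rule has_derivative_diff[OF E(1) has_derivative_ident])
  show "onorm (\<lambda>v. D v - v) \<le> 1 / 2"
    unfolding DE by (rule onorm_bound) (use E(2) in auto)
qed

lemma phi_minus_id_contraction:
  assumes ab: "a \<in> {1, -1}" "b \<in> {1, -1}" and pq: "p \<in> sector 5 a b" "q \<in> sector 5 a b"
  shows "norm ((phi p - p) - (phi q - q)) \<le> 1 / 2 * norm (p - q)"
proof -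
  define g where "g = (\<lambda>x. phi x - x)"
  define g' where "g' = (\<lambda>x v. frechet_derivative phi (at x) v - v)"
  have 1: "\<And>x. x \<in> sector 5 a b \<Longrightarrow> (g has_derivative g' x) (at x within sector 5 a b)"
    unfolding g_def g'_def by (rule has_derivative_at_withinI[OF phi_minus_id_onorm(1)[OF ab]])
  have 2: "\<And>x. x \<in> sector 5 a b \<Longrightarrow> onorm (g' x) \<le> 1 / 2"
    unfolding g_def g'_def by (rule phi_minus_id_onorm(2)[OF ab])
  have "norm (g p - g q) \<le> 1 / 2 * norm (p - q)"
    by (rule differentiable_bound[OF convex_sector 1 2 pq])
  then show ?thesis by (simp only: g_def)
qed

lemma phi_inj_on_sector:
  assumes ab: "a \<in> {1, -1}" "b \<in> {1, -1}"
  shows "inj_on phi (sector 5 a b)"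
proof (rule inj_onI)
  fix p q assume pq: "p \<in> sector 5 a b" "q \<in> sector 5 a b" "phi p = phi q"
  have "(phi p - p) - (phi q - q) = - (p - q)" by (simp add: pq(3))
  then have "norm (p - q) = norm ((phi p - p) - (phi q - q))" by (simp only: norm_minus_cancel)
  also have "\<dots> \<le> 1 / 2 * norm (p - q)" by (rule phi_minus_id_contraction[OF ab pq(1,2)])
  finally show "p = q" by simp
qed

text \<open>\<open>phi x = y\<close> is the fixed point equation \<open>x = y - (phi x - x)\<close>,
  whose right side contracts \<open>cball y 1\<close> into itself with factor \<open>1/2\<close>.
  The loss from \<open>7\<close> to \<open>5\<close> is twice the radius of this ball.\<close>

lemma phi_sector_onto:
  assumes ab: "a \<in> {1, -1}" "b \<in> {1, -1}" and y: "y \<in> sector 7 a b"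
  obtains p where "p \<in> sector 5 a b" "phi p = y"
proof -
  have sub: "cball y 1 \<subseteq> sector 5 a b"
  proof
    fix q assume "q \<in> cball y 1"
    then show "q \<in> sector 5 a b"
      using sector_add[OF ab y, of "q - y" 1] by (simp add: dist_norm norm_minus_commute)
  qed
  have "\<exists>!x. x \<in> cball y 1 \<and> y - (phi x - x) = x"
  proof (rule Banach_fix[of _ "1/2"])
    show "(\<lambda>x. y - (phi x - x)) ` cball y 1 \<subseteq> cball y 1"
    proof
      fix z assume "z \<in> (\<lambda>x. y - (phi x - x)) ` cball y 1"
      then obtain x where x: "x \<in> sector 5 a b" "z = y - (phi x - x)" using sub by blast
      have "x \<in> sector 3 a b" using x(1) sector_mono[of 3 5 a b] by auto
      then have "norm (phi x - x) \<le> 1 / 5" by (rule phi_near_identity_3[OF ab])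
      then show "z \<in> cball y 1" by (simp add: x dist_norm)
    qed
    show "dist (y - (phi p - p)) (y - (phi q - q)) \<le> 1 / 2 * dist p q"
      if "p \<in> cball y 1" "q \<in> cball y 1" for p q
    proof -
      have "p \<in> sector 5 a b" "q \<in> sector 5 a b" using sub that by blast+
      from phi_minus_id_contraction[OF ab this]
      have "norm ((phi p - p) - (phi q - q)) \<le> 1 / 2 * norm (p - q)" .
      moreover have "(y - (phi p - p)) - (y - (phi q - q)) = - ((phi p - p) - (phi q - q))" by simp
      ultimately show ?thesis by (simp only: dist_norm norm_minus_cancel)
    qed
  qed (auto simp: complete_eq_closed)
  then obtain x where x: "x \<in> cball y 1" "y - (phi x - x) = x" by blast
  show ?thesis
  proof (rule that)
    show "x \<in> sector 5 a b" using x(1) sub by blast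
    have "phi x = y - x + x" by (subst (2) x(2)[symmetric]) simp
    then show "phi x = y" by simp
  qed
qed

text \<open>A late iterate lies at threshold \<open>3\<close>, where \<open>phi\<close> loses at
  most \<open>2/5\<close> of depth and so keeps the signs. Dividing by the positive number
  \<open>\<delta>^(2m)\<close> preserves a sector of threshold \<open>0\<close>.\<close>

lemma phi_basin_subset:
  assumes ab: "a \<in> {1, -1}" "b \<in> {1, -1}" and p: "p \<in> basin a b"
  shows "phi p \<in> sector 0 a b"
proof -
  obtain m where m: "(F ^^ (4 * m)) p \<in> sector 3 a b" using basin_deep[OF ab p, of 3] by blast
  define x where "x = (F ^^ (4 * m)) p"
  have x: "x \<in> sector 3 a b" using m by (simp only: x_def)
  from sector_add[OF ab x phi_near_identity_3[OF ab x]]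
  have "phi x \<in> sector (3 - 2 * (1 / 5)) a b" by simp
  then have "phi x \<in> sector 0 a b" using sector_mono[of 0 "3 - 2 * (1 / 5)" a b] by auto
  moreover have "phi x = of_real (\<delta> ^ (2 * m)) *s phi p"
    unfolding x_def using phi_four_steps[of p m] p basin_subset[OF ab] by blast
  ultimately show ?thesis using sector_scale[of "\<delta> ^ (2 * m)" "phi p" 0] delta by simp
qed

text \<open>Equal values force equal signs, so both orbits enter the same deep sector. Injectivity
  there, together with that of the iterates of \<open>F\<close>, gives it on all basins at
  once.\<close>

lemma phi_inj_on: "inj_on phi basins"
proof (rule inj_onI)
  fix p q assume pq: "p \<in> basins" "q \<in> basins" "phi p = phi q"
  obtain a b where ab: "a \<in> {1, -1}" "b \<in> {1, -1}" "p \<in> basin a b"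
    using pq(1) unfolding basins_def by blast
  obtain a' b' where ab': "a' \<in> {1, -1}" "b' \<in> {1, -1}" "q \<in> basin a' b'"
    using pq(2) unfolding basins_def by blast
  have "phi p \<in> sector 0 a' b'" using phi_basin_subset[OF ab'] pq(3) by simp
  from sector_signs[OF phi_basin_subset[OF ab] this order_refl order_refl ab(1,2) ab'(1,2)]
  have eq: "a = a'" "b = b'" .
  obtain m1 where m1: "\<forall>m\<ge>m1. (F ^^ (4 * m)) p \<in> sector 5 a b" using basin_deep[OF ab, of 5] by blast
  obtain m2 where m2: "\<forall>m\<ge>m2. (F ^^ (4 * m)) q \<in> sector 5 a' b'" using basin_deep[OF ab', of 5] by blast
  define m where "m = max m1 m2"
  have "(F ^^ (4 * m)) p \<in> sector 5 a b" "(F ^^ (4 * m)) q \<in> sector 5 a b"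
    using m1 m2 eq by (simp_all add: m_def)
  note deep = this
  have "phi ((F ^^ (4 * m)) p) = phi ((F ^^ (4 * m)) q)"
    unfolding phi_four_steps[OF pq(1)] phi_four_steps[OF pq(2)] pq(3) ..
  from inj_onD[OF phi_inj_on_sector[OF ab(1,2)] this deep]
  have "(F ^^ (4 * m)) p = (F ^^ (4 * m)) q" .
  then show "p = q" by (rule injD[OF bij_is_inj[OF iterate_bij]])
qed

text \<open>For surjectivity, \<open>y\<close> is scaled by \<open>\<delta>^(2m)\<close> until it is
  deep enough to be a value of \<open>phi\<close>; the preimage, pulled back by the bijection
  \<open>F^(4m)\<close>, is the required point.\<close>

lemma phi_image_basin:
  assumes ab: "a \<in> {1, -1}" "b \<in> {1, -1}"
  shows "phi ` basin a b = sector 0 a b"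
proof
  show "phi ` basin a b \<subseteq> sector 0 a b" using phi_basin_subset[OF ab] by blast
  show "sector 0 a b \<subseteq> phi ` basin a b"
  proof
    fix y assume y: "y \<in> sector 0 a b"
    \<comment> \<open>Half of the smaller depth is positive and strictly below both depths, so it is
      a threshold for \<open>y\<close>.\<close>
    define e where "e = min (depth a (y $ 1)) (depth b (y $ 2)) / 2"
    have e: "e > 0" "y \<in> sector e a b" using y by (auto simp: sector_def e_def min_def)
    obtain m where m: "7 / e < (\<delta>\<^sup>2) ^ m"
      using real_arch_pow[of "\<delta>\<^sup>2" "7 / e"] delta one_less_power[of \<delta> 2] by auto
    have "of_real (\<delta> ^ (2 * m)) *s y \<in> sector (\<delta> ^ (2 * m) * e) a b"
      using e delta by (subst sector_scale) auto
    moreover have "7 < (\<delta>\<^sup>2) ^ m * e" using m e by (simp add: pos_divide_less_eq)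
    then have "7 \<le> \<delta> ^ (2 * m) * e" unfolding power_mult by simp
    ultimately have "of_real (\<delta> ^ (2 * m)) *s y \<in> sector 7 a b" using sector_mono by blast
    then obtain x where x: "x \<in> sector 5 a b" "phi x = of_real (\<delta> ^ (2 * m)) *s y"
      using phi_sector_onto[OF ab] by blast
    obtain p where p: "x = (F ^^ (4 * m)) p" using bij_is_surj[OF iterate_bij] by (meson surjD)
    have pb: "p \<in> basin a b"
      using x(1) sector_mono[of 2 5 a b] by (auto simp: p basin_def)
    then have "of_real (\<delta> ^ (2 * m)) *s phi p = of_real (\<delta> ^ (2 * m)) *s y"
      using phi_four_steps[of p m] basin_subset[OF ab] x(2) by (auto simp: p)
    then have "phi p = y" using delta by (auto simp: vec_eq_iff)
    then show "y \<in> phi ` basin a b" using pb by auto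
  qed
qed

text \<open>A linear map within \<open>1/2\<close> of the identity has trivial kernel, which settles
  the deep sectors. The functional equation carries regularity back to the whole basin.\<close>

lemma phi_regular_at:
  assumes "p \<in> basins"
  shows "regular_at phi p"
proof -
  obtain a b where ab: "a \<in> {1, -1}" "b \<in> {1, -1}" "p \<in> basin a b"
    using assms unfolding basins_def by blast
  obtain m where m: "(F ^^ (4 * m)) p \<in> sector 5 a b" using basin_deep[OF ab, of 5] by blast
  have "regular_at phi x" if x: "x \<in> sector 5 a b" for x
  proof -
    obtain D where D: "complex_linear D" "(phi has_derivative D) (at x)"
      "\<forall>v. norm (D v - v) \<le> 1 / 2 * norm v"
      using phi_minus_id_derivative[OF ab(1,2) x] by blast
    interpret D: Vector_Spaces.linear "(*s)" "(*s)" D by (rule D(1))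
    have "inj D"
    proof (rule injI)
      fix u v assume "D u = D v"
      then have "D (u - v) = 0" by (simp add: D.diff)
      then have "norm (u - v) \<le> 1 / 2 * norm (u - v)" using D(3)[rule_format, of "u - v"] by (simp add: norm_minus_commute)
      then show "u = v" by simp
    qed
    with D show ?thesis by (auto simp: regular_at_def)
  qed
  from regular_at_compose[OF regular_at_compose[OF iterate_regular_at this[OF m]]
      regular_at_scale[of "inverse ((- of_real \<delta>) ^ (2 * m))"]]
  have "regular_at (\<lambda>x. inverse ((- of_real \<delta>) ^ (2 * m)) *s phi ((F ^^ (4 * m)) x)) p"
    using delta by simp
  then show ?thesis
    by (rule regular_at_cong[OF _ open_basins assms]) (simp add: phi_iterate(1)[of _ "2 * m"])
qed

text \<open>Since \<open>phi_approx\<close> involves even iterates only, commutation with a single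
  \<open>F\<close> is not formal. Each approximant satisfies the identity up to
  \<open>(-\<delta>)^-k exp (- z^2)\<close> in the first coordinate, and this error tends to
  \<open>0\<close>.\<close>

lemma phi_F:
  assumes "p \<in> basins"
  shows "phi (F p) = henon_linear_part \<delta> (phi p)"
proof -
  obtain a b where ab: "a \<in> {1, -1}" "b \<in> {1, -1}" "p \<in> basin a b"
    using assms unfolding basins_def by blast
  define c where "c = (\<lambda>k. inverse ((- of_real \<delta>) ^ k) :: complex)"
  define x where "x = (\<lambda>k. (F ^^ (2 * k)) p)"
  have "phi_approx k (F p) = henon_linear_part \<delta> (phi_approx k p) + vector [c k * exp (- (x k $ 1)\<^sup>2), 0]" for k
  proof -
    have "(F ^^ (2 * k)) (F p) = F (x k)" by (simp add: x_def funpow_swap1)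
    then have "phi_approx k (F p) = c k *s F (x k)" by (simp only: phi_approx_def c_def)
    moreover have "phi_approx k p = c k *s x k" by (simp only: phi_approx_def c_def x_def)
    ultimately show ?thesis
      by (simp add: vec_eq_iff forall_2 F_1 F_2 henon_linear_part_def algebra_simps)
  qed
  moreover have "(\<lambda>k. henon_linear_part \<delta> (phi_approx k p) + vector [c k * exp (- (x k $ 1)\<^sup>2), 0])
      \<longlonglongrightarrow> henon_linear_part \<delta> (phi p) + 0"
  proof (rule tendsto_add)
    have t: "(\<lambda>k. phi_approx k p $ i) \<longlonglongrightarrow> phi p $ i" for i
      using phi_limit[OF assms] by (rule tendsto_vec_nth)
    show "(\<lambda>k. henon_linear_part \<delta> (phi_approx k p)) \<longlonglongrightarrow> henon_linear_part \<delta> (phi p)"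
      unfolding henon_linear_part_def
      by (rule vec_tendstoI, rename_tac i, case_tac i rule: exhaust_2[THEN disjE])
        (auto intro!: tendsto_intros t)
    show "(\<lambda>k. vector [c k * exp (- (x k $ 1)\<^sup>2), 0] :: complex^2) \<longlonglongrightarrow> 0"
    proof (rule Lim_null_comparison)
      obtain m where m: "(F ^^ (4 * m)) p \<in> sector 2 a b" using ab(3) by (auto simp: basin_def)
      \<comment> \<open>Once the orbit has entered the sector, every later even iterate lies in one
        of the sectors, where the exponential is bounded by \<open>1\<close>; the factor
        \<open>c k\<close> then provides the decay.\<close>
      have "norm (exp (- (x k $ 1)\<^sup>2)) \<le> 1" if "k \<ge> 2 * m" for k
      proof -
        define j where "j = k - 2 * m"
        have "x k = (F ^^ (2 * j)) ((F ^^ (4 * m)) p)"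
          using that by (simp add: x_def j_def iterate_iterate diff_mult_distrib2)
        then have "x k \<in> sector ((3 / 2) ^ j * 2) ((-1) ^ j * a) ((-1) ^ j * b)"
          using sector_even_steps[OF ab(1,2) order_refl m, of j] by simp
        then have "x k \<in> sector 0 ((-1) ^ j * a) ((-1) ^ j * b)"
          using sector_mono[of 0 "(3 / 2) ^ j * 2"] by auto
        moreover have "(-1) ^ j * a \<in> {1, -1}"
          using ab(1) minus_one_power_iff[of j, where 'a = int] by (auto split: if_splits)
        ultimately have "norm (exp (- (x k $ 1)\<^sup>2)) \<le> exp (- 0\<^sup>2)"
          by (intro norm_exp_neg_square_le[of "(-1) ^ j * a"]) (auto simp: sector_def)
        then show ?thesis by simp
      qed
      then have "norm (vector [c k * exp (- (x k $ 1)\<^sup>2), 0] :: complex^2) \<le> inverse (\<delta> ^ k)"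
        if "k \<ge> 2 * m" for k
        using vector_2_norm_le[of "c k * exp (- (x k $ 1)\<^sup>2)" 0] that delta
        by (fastforce simp: c_def norm_mult norm_inverse norm_power intro: order_trans mult_left_le)
      then show "\<forall>\<^sub>F k in sequentially. norm (vector [c k * exp (- (x k $ 1)\<^sup>2), 0] :: complex^2) \<le> inverse (\<delta> ^ k)"
        unfolding eventually_sequentially by blast
      show "(\<lambda>k. inverse (\<delta> ^ k)) \<longlonglongrightarrow> 0" using delta by (intro LIMSEQ_inverse_realpow_zero) auto
    qed
  qed
  ultimately show ?thesis by (simp add: phi_def limI)
qed

end

section \<open>Points and ranks at infinity\<close>

lemma infinity_vector_nonzero: "(vector [\<zeta>, 1, 0] :: complex^3) \<noteq> 0"
  by (auto simp: vec_eq_iff forall_3)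

lemma point_at_infinity_inj: "point_at_infinity \<zeta> = point_at_infinity \<xi> \<longleftrightarrow> \<zeta> = \<xi>"
proof
  assume "point_at_infinity \<zeta> = point_at_infinity \<xi>"
  then have "same_line (vector [\<zeta>, 1, 0]) (vector [\<xi>, 1, 0])"
    unfolding point_at_infinity_def
    by (subst abs_cp2_eq_iff[symmetric]) (simp_all add: infinity_vector_nonzero)
  then obtain c where "vector [\<zeta>, 1, 0] = c *s (vector [\<xi>, 1, 0] :: complex^3)"
    unfolding same_line_def by blast
  from arg_cong[OF this, of "\<lambda>u. u $ 1"] arg_cong[OF this, of "\<lambda>u. u $ 2"]
  show "\<zeta> = \<xi>" by simp
qed simp

lemma abs_cp2_infinity:
  assumes "w \<noteq> 0"
  shows "abs_cp2 (vector [z, w, 0]) = point_at_infinity (z / w)"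
proof -
  have "vector [z, w, 0] = w *s (vector [z / w, 1, 0] :: complex^3)"
    using assms by (simp add: vec_eq_iff forall_3)
  then show ?thesis
    using assms by (simp add: point_at_infinity_def abs_cp2_scale infinity_vector_nonzero)
qed

lemma point_at_infinity_in_line: "point_at_infinity \<zeta> \<in> line_at_infinity"
  unfolding point_at_infinity_def line_at_infinity_def
  by (rule CollectI, rule exI[of _ \<zeta>], rule exI[of _ 1]) simp

text \<open>In the chart of the second homogeneous coordinate the map is \<open>(f, 1, 0)\<close>,
  so its differential is \<open>d\<close> times a fixed vector and has rank one as soon as
  \<open>d\<close> is nonzero.\<close>

lemma has_rank_at_point_at_infinity:
  fixes f :: "complex^'n \<Rightarrow> complex"
  assumes U: "open U" "p \<in> U" "\<And>q. q \<in> U \<Longrightarrow> h q = point_at_infinity (f q)"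
    and lin: "\<And>u v. d (u + v) = d u + d v" "\<And>c v. d (c *s v) = c * d v"
    and der: "(f has_derivative d) (at p)" and nz: "d w \<noteq> 0"
  shows "has_rank_at h p 1"
proof -
  let ?e = "vector [1, 0, 0] :: complex^3"
  define D where "D = (\<lambda>v. d v *s ?e)"
  have "h p \<in> chart_domain 2"
    using U(2,3) by (simp add: point_at_infinity_def abs_cp2_in_chart_domain infinity_vector_nonzero)
  moreover have "complex_linear D"
    unfolding D_def by unfold_locales (simp_all add: lin vector_sadd_rdistrib vector_smult_assoc)
  moreover have "((\<lambda>q. chart 2 (h q)) has_derivative D) (at p)"
  proof (rule has_derivative_transform_within_open[OF _ U(1,2)])
    have "((\<lambda>q. f q *s ?e) has_derivative D) (at p)"
      unfolding D_def
      by (rule has_derivative_compose[OF der bounded_linear_imp_has_derivative[OF bounded_linear_scale_vector]])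
    from has_derivative_add[OF this has_derivative_const[of "vector [0, 1, 0] :: complex^3"]]
    show "((\<lambda>q. f q *s ?e + vector [0, 1, 0]) has_derivative D) (at p)" by simp
    show "f q *s ?e + vector [0, 1, 0] = chart 2 (h q)" if "q \<in> U" for q
      using U(3)[OF that]
      by (simp add: point_at_infinity_def chart_abs_cp2 infinity_vector_nonzero vec_eq_iff forall_3)
  qed
  moreover have "range D = vec.span {?e}"
  proof -
    have "c *s ?e \<in> range D" for c
      using lin(2)[of "c / d w" w] nz by (intro image_eqI[of _ _ "(c / d w) *s w"]) (simp_all add: D_def)
    then show ?thesis by (auto simp: vec.span_singleton D_def)
  qed
  moreover have "vec.independent {?e}"
    by (simp add: vec.dependent_single vec_eq_iff forall_3)
  ultimately show ?thesis
    unfolding has_rank_at_def by (intro exI[of _ "2 :: 3"] exI[of _ D]) (simp add: vec.dim_span_eq_card_independent)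
qed

section \<open>Sectors and half planes\<close>

lemma depth_pos_iff:
  assumes "a \<in> {1, -1}"
  shows "0 < depth a z \<longleftrightarrow> 0 < of_int a * Re z \<and> 0 < Re (z\<^sup>2)"
proof -
  have "Re (z\<^sup>2) = (\<bar>Re z\<bar> - \<bar>Im z\<bar>) * (\<bar>Re z\<bar> + \<bar>Im z\<bar>)"
    by (simp add: power2_eq_square algebra_simps abs_mult_self_eq)
  then have "0 < Re (z\<^sup>2) \<longleftrightarrow> \<bar>Im z\<bar> < \<bar>Re z\<bar>"
    by (smt (verit) mult_pos_pos mult_nonpos_nonneg abs_ge_zero)
  then show ?thesis using assms by (auto simp: depth_def)
qed

lemma csqrt_depth:
  assumes "Re \<zeta> > 0"
  shows "0 < depth 1 (csqrt \<zeta>)"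
proof -
  have "0 < cmod \<zeta> + Re \<zeta>" using assms norm_ge_zero[of \<zeta>] by linarith
  then have "0 < Re (csqrt \<zeta>)" by simp
  then show ?thesis using assms depth_pos_iff[of 1 "csqrt \<zeta>"] by (simp del: csqrt.simps)
qed

lemma depth_minus: "depth (- a) (- z) = depth a z"
  by (simp add: depth_def)

text \<open>Two numbers in the same open quarter plane have arguments differing by less than a right
  angle, so \<open>Re (z / w) > 0\<close>. The case of opposite signs follows by replacing
  \<open>w\<close> with \<open>- w\<close>.\<close>

lemma sector_ratio_image:
  assumes a: "a \<in> {1, -1}"
  shows "(\<lambda>p. p $ 1 / p $ 2) ` sector 0 a a = right_half_plane"
    and "(\<lambda>p. p $ 1 / p $ 2) ` sector 0 a (- a) = uminus ` right_half_plane"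
proof -
  have half: "0 < Re (z / w)" if "0 < depth a z" "0 < depth a w" for z w
  proof -
    have "\<bar>Im z\<bar> * \<bar>Im w\<bar> < (of_int a * Re z) * (of_int a * Re w)"
      using that by (intro mult_strict_mono') (auto simp: depth_def)
    moreover have "- (Im z * Im w) \<le> \<bar>Im z\<bar> * \<bar>Im w\<bar>" by (metis abs_mult abs_minus_le_zero abs_ge_minus_self)
    ultimately have "0 < Re z * Re w + Im z * Im w" using a by auto
    moreover have "w \<noteq> 0" using that by (auto simp: depth_def)
    ultimately show ?thesis by (simp add: Re_divide complex_neq_0 zero_less_divide_iff)
  qed
  have onto: "\<exists>z w. 0 < depth a z \<and> 0 < depth a w \<and> z / w = \<zeta>" if "0 < Re \<zeta>" for \<zeta>
  proof -
    \<comment> \<open>Splitting \<open>\<zeta>\<close> evenly: both roots lie in the open quarter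
      plane around the positive axis, \<open>(s / t)^2 = \<zeta>^2\<close>, and the sign of
      \<open>s / t\<close> is settled by its positive real part.\<close>
    define s t where "s = csqrt \<zeta>" and "t = csqrt (1 / \<zeta>)"
    have "\<zeta> \<noteq> 0" using that by auto
    have "0 < (Re \<zeta>)\<^sup>2 + (Im \<zeta>)\<^sup>2" using that by (simp add: sum_power2_gt_zero_iff)
    then have "0 < Re (1 / \<zeta>)" using that by (simp add: Re_divide)
    then have st: "0 < depth 1 s" "0 < depth 1 t"
      unfolding s_def t_def using that by (auto intro: csqrt_depth)
    have "s\<^sup>2 = \<zeta>" "t\<^sup>2 = 1 / \<zeta>" by (simp_all add: s_def t_def)
    then have "(s / t)\<^sup>2 = \<zeta>\<^sup>2" by (simp add: power_divide power2_eq_square[of \<zeta>])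
    then have "s / t = \<zeta> \<or> s / t = - \<zeta>" by (simp only: power2_eq_iff)
    moreover have "0 < Re (s / t)"
      using half[of "of_int a * s" "of_int a * t"] st a by (auto simp: depth_def)
    ultimately have "s / t = \<zeta>" using that by auto
    then show ?thesis
      using st a by (intro exI[of _ "of_int a * s"] exI[of _ "of_int a * t"]) (auto simp: depth_def)
  qed
  show "(\<lambda>p. p $ 1 / p $ 2) ` sector 0 a a = right_half_plane"
  proof
    show "(\<lambda>p. p $ 1 / p $ 2) ` sector 0 a a \<subseteq> right_half_plane"
      using half by (auto simp: sector_def right_half_plane_def)
    show "right_half_plane \<subseteq> (\<lambda>p. p $ 1 / p $ 2) ` sector 0 a a"
    proof
      fix \<zeta> assume "\<zeta> \<in> right_half_plane"
      then obtain z w where "0 < depth a z" "0 < depth a w" "z / w = \<zeta>"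
        using onto[of \<zeta>] unfolding right_half_plane_def by blast
      then show "\<zeta> \<in> (\<lambda>p. p $ 1 / p $ 2) ` sector 0 a a"
        by (intro image_eqI[of _ _ "vector [z, w]"]) (auto simp: sector_def)
    qed
  qed
  show "(\<lambda>p. p $ 1 / p $ 2) ` sector 0 a (- a) = uminus ` right_half_plane"
  proof
    show "(\<lambda>p. p $ 1 / p $ 2) ` sector 0 a (- a) \<subseteq> uminus ` right_half_plane"
    proof
      fix \<xi> assume "\<xi> \<in> (\<lambda>p. p $ 1 / p $ 2) ` sector 0 a (- a)"
      then obtain p where p: "p \<in> sector 0 a (- a)" "\<xi> = p $ 1 / p $ 2" by blast
      then have "0 < Re (p $ 1 / (- p $ 2))"
        using depth_minus[of "- a" "p $ 2"] by (intro half) (auto simp: sector_def)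
      then show "\<xi> \<in> uminus ` right_half_plane"
        by (intro image_eqI[of _ _ "- \<xi>"]) (simp_all add: p(2) right_half_plane_def)
    qed
    show "uminus ` right_half_plane \<subseteq> (\<lambda>p. p $ 1 / p $ 2) ` sector 0 a (- a)"
    proof
      fix \<xi> assume "\<xi> \<in> uminus ` right_half_plane"
      then obtain \<zeta> where \<zeta>: "0 < Re \<zeta>" "\<xi> = - \<zeta>" unfolding right_half_plane_def by blast
      obtain z w where zw: "0 < depth a z" "0 < depth a w" "z / w = \<zeta>" using onto[OF \<zeta>(1)] by blast
      then show "\<xi> \<in> (\<lambda>p. p $ 1 / p $ 2) ` sector 0 a (- a)"
        by (intro image_eqI[of _ _ "vector [z, - w]"]) (simp_all add: sector_def depth_minus \<zeta>(2))
    qed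
  qed
qed

text \<open>In each coordinate squaring opens a quarter plane up to a half plane; this turns the
  product of sectors, the natural image of \<open>phi\<close>, into the product of half
  planes.\<close>

definition square_map :: "complex^2 \<Rightarrow> complex^2" where
  "square_map p = vector [(p $ 1)\<^sup>2, (p $ 2)\<^sup>2]"

lemma square_map_regular_at:
  assumes "p $ 1 \<noteq> 0" "p $ 2 \<noteq> 0"
  shows "regular_at square_map p"
proof -
  define D :: "complex^2 \<Rightarrow> complex^2" where "D = (\<lambda>v. vector [2 * p $ 1 * v $ 1, 2 * p $ 2 * v $ 2])"
  have sq: "((\<lambda>q :: complex^2. (q $ k)\<^sup>2) has_derivative (\<lambda>v. 2 * p $ k * v $ k)) (at p)" for k
  proof -
    have "((\<lambda>z. z\<^sup>2) has_field_derivative 2 * p $ k) (at (p $ k))"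
      by (auto intro!: derivative_eq_intros)
    from has_derivative_compose[OF has_derivative_component has_field_derivative_imp_has_derivative[OF this]]
    show ?thesis .
  qed
  have "(square_map has_derivative D) (at p)"
    unfolding square_map_def[abs_def] D_def by (rule has_derivative_vector_2[OF sq sq])
  moreover have "complex_linear D"
    unfolding D_def by unfold_locales (auto simp: vec_eq_iff forall_2 algebra_simps)
  moreover have "inj D"
    using assms by (auto simp: D_def inj_def vec_eq_iff forall_2)
  ultimately show ?thesis by (auto simp: regular_at_def)
qed

lemma square_map_inj_on:
  assumes "a \<in> {1, -1}" "b \<in> {1, -1}"
  shows "inj_on square_map (sector 0 a b)"
proof (rule inj_onI)
  have eq: "z = w" if "z\<^sup>2 = w\<^sup>2" "0 < depth s z" "0 < depth s w" for s z w
    using that by (auto simp: power2_eq_iff depth_def)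
  fix p q assume "p \<in> sector 0 a b" "q \<in> sector 0 a b" "square_map p = square_map q"
  then show "p = q"
    using eq[of "p $ 1" "q $ 1" a] eq[of "p $ 2" "q $ 2" b]
    by (simp add: square_map_def vec_eq_iff forall_2 sector_def)
qed

lemma square_map_image:
  assumes ab: "a \<in> {1, -1}" "b \<in> {1, -1}"
  shows "square_map ` sector 0 a b = half_plane_squared"
proof
  show "square_map ` sector 0 a b \<subseteq> half_plane_squared"
    by (auto simp: square_map_def sector_def half_plane_squared_def right_half_plane_def
        depth_pos_iff[OF ab(1)] depth_pos_iff[OF ab(2)])
  show "half_plane_squared \<subseteq> square_map ` sector 0 a b"
  proof
    fix y assume "y \<in> half_plane_squared"
    then have "0 < depth 1 (csqrt (y $ k))" for k
      using exhaust_2[of k] by (auto simp: half_plane_squared_def right_half_plane_def intro: csqrt_depth)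
    moreover have "0 < depth s (of_int s * u)" if "0 < depth 1 u" "s \<in> {1, -1}" for s u
      using that by (auto simp: depth_def)
    ultimately have "0 < depth s (of_int s * csqrt (y $ k))" if "s \<in> {1, -1}" for s k
      using that by blast
    then show "y \<in> square_map ` sector 0 a b"
      using ab
      by (intro image_eqI[of _ _ "vector [of_int a * csqrt (y $ 1), of_int b * csqrt (y $ 2)]"])
        (auto simp: square_map_def sector_def vec_eq_iff forall_2 power_mult_distrib)
  qed
qed

section \<open>Limit functions\<close>

text \<open>Even and odd iterates have different limits, so sequences of iterates are thinned to
  constant parity before their limits are identified.\<close>

lemma parity_subsequence:
  fixes n :: "nat \<Rightarrow> nat"
  assumes n: "filterlim n at_top sequentially"
  obtains s t where "strict_mono s" "filterlim t at_top sequentially" "\<And>k. n (s k) = 2 * t k"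
  | s t where "strict_mono s" "filterlim t at_top sequentially" "\<And>k. n (s k) = Suc (2 * t k)"
proof -
  have half: "filterlim (\<lambda>k. n (s k) div 2) at_top sequentially" if "strict_mono s" for s :: "nat \<Rightarrow> nat"
  proof -
    have "filterlim (\<lambda>k. n (s k)) at_top sequentially"
      by (rule filterlim_compose[OF n filterlim_subseq[OF that]])
    then show ?thesis
      unfolding filterlim_at_top_ge[where c = 0]
    proof (intro allI impI)
      fix Z :: nat
      assume "\<forall>Z\<ge>0. \<forall>\<^sub>F k in sequentially. Z \<le> n (s k)"
      then have "\<forall>\<^sub>F k in sequentially. 2 * Z \<le> n (s k)" by simp
      then show "\<forall>\<^sub>F k in sequentially. Z \<le> n (s k) div 2"
        by (rule eventually_mono) linarith
    qed
  qed
  have "infinite {j. even (n j)} \<or> infinite {j. odd (n j)}"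
    using finite_UnI[of "{j. even (n j)}" "{j. odd (n j)}"] by (auto simp: Collect_disj_eq[symmetric])
  then show thesis
  proof
    assume "infinite {j. even (n j)}"
    from infinite_enumerate[OF this] obtain s :: "nat \<Rightarrow> nat" where s: "strict_mono s" "\<forall>k. s k \<in> {j. even (n j)}"
      by blast
    show thesis using s by (intro that(1)[OF s(1) half[OF s(1)]]) simp
  next
    assume "infinite {j. odd (n j)}"
    from infinite_enumerate[OF this] obtain s :: "nat \<Rightarrow> nat" where s: "strict_mono s" "\<forall>k. s k \<in> {j. odd (n j)}"
      by blast
    show thesis using s by (intro that(2)[OF s(1) half[OF s(1)]]) simp
  qed
qed

lemma uniform_limit_subsequence:
  assumes "uniform_limit A f g sequentially" "filterlim r at_top sequentially"
  shows "uniform_limit A (\<lambda>k. f (r k)) g sequentially"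
  unfolding uniform_limit_iff
proof (intro allI impI)
  fix e :: real assume "e > 0"
  then have "\<forall>\<^sub>F n in sequentially. \<forall>x\<in>A. dist (f n x) (g x) < e"
    using assms(1) by (simp add: uniform_limit_iff)
  from eventually_compose_filterlim[OF this assms(2)]
  show "\<forall>\<^sub>F k in sequentially. \<forall>x\<in>A. dist (f (r k) x) (g x) < e" .
qed

lemma uniform_limit_vector_3:
  fixes f :: "nat \<Rightarrow> 'a \<Rightarrow> complex^2"
  assumes "uniform_limit A f g sequentially" "c \<longlonglongrightarrow> 0"
  shows "uniform_limit A (\<lambda>n p. vector [f n p $ 1, f n p $ 2, c n] :: complex^3)
    (\<lambda>p. vector [g p $ 1, g p $ 2, 0]) sequentially"
proof -
  let ?T = "\<lambda>v :: complex^2. vector [v $ 1, v $ 2, 0] :: complex^3"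
  have "bounded_linear ?T"
    by (intro linear_conv_bounded_linear[THEN iffD1] linearI) (auto simp: vec_eq_iff forall_3)
  then have 1: "uniform_limit A (\<lambda>n p. ?T (f n p)) (\<lambda>p. ?T (g p)) sequentially"
    by (rule bounded_linear.uniform_limit[OF _ assms(1)])
  have "(\<lambda>n. c n *s axis 3 1) \<longlonglongrightarrow> (0 :: complex^3)"
    using tendsto_mult_left_zero[OF assms(2)] by (intro vec_tendstoI) simp
  then have 2: "uniform_limit A (\<lambda>n p. c n *s axis 3 1) (\<lambda>p. 0 :: complex^3) sequentially"
    unfolding uniform_limit_iff tendsto_iff by (auto elim: eventually_mono)
  from uniform_limit_add[OF 1 2] show ?thesis
    by (rule uniform_limit_cong'[THEN iffD1, rotated -1])
      (auto simp: vec_eq_iff forall_3 axis_def)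
qed

context henon_map
begin

section \<open>Convergence of even and odd iterates\<close>

definition limit_even :: "complex^2 \<Rightarrow> cp2" where
  "limit_even p = abs_cp2 (vector [phi p $ 1, phi p $ 2, 0])"

text \<open>By \<open>F^(2k+1) = F^(2k) o F\<close> the odd limit is the even one after one step, so
  facts about odd iterates are transferred rather than reproved.\<close>

definition limit_odd :: "complex^2 \<Rightarrow> cp2" where
  "limit_odd p = limit_even (F p)"

definition ratio :: "complex^2 \<Rightarrow> complex" where
  "ratio p = phi p $ 1 / phi p $ 2"

lemma basins_cases:
  assumes "p \<in> basins"
  obtains a b where "a \<in> {1, -1}" "b \<in> {1, -1}" "p \<in> basin a b"
  using assms unfolding basins_def by blast

lemma phi_nonzero:
  assumes "p \<in> basins"
  shows "phi p $ 1 \<noteq> 0" "phi p $ 2 \<noteq> 0"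
proof -
  obtain a b where "a \<in> {1, -1}" "b \<in> {1, -1}" "p \<in> basin a b" by (rule basins_cases[OF assms])
  then have "phi p \<in> sector 0 a b" by (rule phi_basin_subset)
  then show "phi p $ 1 \<noteq> 0" "phi p $ 2 \<noteq> 0" by (auto simp: sector_def depth_def)
qed

lemma F_mem_basin:
  assumes "a \<in> {1, -1}" "b \<in> {1, -1}" "p \<in> basin a b"
  shows "F p \<in> basin (- b) a"
proof -
  obtain m where "(F ^^ (4 * m)) p \<in> sector 2 a b" using assms(3) unfolding basin_def by blast
  from sector_step(2)[OF assms(1,2) order_refl this]
  have "(F ^^ (4 * m)) (F p) \<in> sector 2 (- b) a" by (simp add: funpow_swap1)
  then show ?thesis unfolding basin_def by blast
qed

lemma F_basin:
  assumes ab: "a \<in> {1, -1}" "b \<in> {1, -1}"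
  shows "F ` basin a b = basin (- b) a"
proof
  show "F ` basin a b \<subseteq> basin (- b) a" using F_mem_basin[OF ab] by blast
  show "basin (- b) a \<subseteq> F ` basin a b"
  proof
    fix p assume p: "p \<in> basin (- b) a"
    obtain q where q: "p = F q" using F_bij by (meson bij_is_surj surjD)
    have s: "- a \<in> {1, -1}" "- b \<in> {1, -1}" using ab by auto
    have "F p \<in> basin (- a) (- b)" by (rule F_mem_basin[OF s(2) ab(1) p])
    then have "F (F p) \<in> basin b (- a)" using F_mem_basin[OF s] by simp
    then have "F (F (F p)) \<in> basin a b" using F_mem_basin[OF ab(2) s(1)] by simp
    then obtain m where "(F ^^ (4 * m)) (F (F (F (F q)))) \<in> sector 2 a b"
      unfolding q basin_def by blast
    moreover have "F (F (F (F q))) = (F ^^ 4) q" by (simp add: eval_nat_numeral)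
    ultimately have "(F ^^ (4 * Suc m)) q \<in> sector 2 a b" by (simp add: iterate_iterate add.commute)
    then have "q \<in> basin a b" unfolding basin_def by blast
    then show "p \<in> F ` basin a b" using q by blast
  qed
qed

lemma F_mem_basins:
  assumes "p \<in> basins"
  shows "F p \<in> basins"
proof -
  obtain a b where ab: "a \<in> {1, -1}" "b \<in> {1, -1}" "p \<in> basin a b" by (rule basins_cases[OF assms])
  have "- b \<in> {1, -1}" using ab by auto
  from basin_subset[OF this ab(1)] F_mem_basin[OF ab] show ?thesis by blast
qed

lemma limit_even_eq: "p \<in> basins \<Longrightarrow> limit_even p = point_at_infinity (ratio p)"
  by (simp add: limit_even_def ratio_def abs_cp2_infinity phi_nonzero)

lemma limit_odd_eq:
  assumes "p \<in> basins"
  shows "limit_odd p = point_at_infinity (- of_real \<delta> / ratio p)"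
proof -
  have "ratio (F p) = - of_real \<delta> / ratio p"
    by (simp add: ratio_def phi_F[OF assms] henon_linear_part_def)
  then show ?thesis using limit_even_eq[OF F_mem_basins[OF assms]] by (simp add: limit_odd_def)
qed

text \<open>Homogeneous coordinates may be rescaled. The factor \<open>(-\<delta>)^-k\<close> makes
  the first two converge to those of \<open>phi\<close> and the third one to
  \<open>0\<close>.\<close>

lemma iterate_even_eq:
  "iterate F (2 * k) p = abs_cp2 (vector [phi_approx k p $ 1, phi_approx k p $ 2, inverse ((- of_real \<delta>) ^ k)])"
proof -
  let ?c = "inverse ((- of_real \<delta>) ^ k) :: complex"
  have "vector [phi_approx k p $ 1, phi_approx k p $ 2, ?c] =
      ?c *s (vector [(F ^^ (2 * k)) p $ 1, (F ^^ (2 * k)) p $ 2, 1] :: complex^3)"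
    by (simp add: vec_eq_iff forall_3 phi_approx_def)
  then show ?thesis
    using delta by (simp add: iterate_def affine_point_def abs_cp2_scale affine_point_nonzero)
qed

lemma uniform_limit_even:
  assumes K: "compact K" "K \<subseteq> basins"
  shows "uniform_limit K (\<lambda>k. iterate F (2 * k)) limit_even sequentially"
  unfolding iterate_even_eq[abs_def] limit_even_def[abs_def]
proof (rule uniform_limit_abs_cp2[OF K(1)])
  have "continuous_on K phi"
    using continuous_on_subset[OF holomorphic_map_continuous_on[OF phi_holomorphic] K(2)] .
  then show "continuous_on K (\<lambda>p. vector [phi p $ 1, phi p $ 2, 0] :: complex^3)"
    by (intro continuous_on_vector_3 continuous_intros)
  show "(vector [phi p $ 1, phi p $ 2, 0] :: complex^3) \<noteq> 0" if "p \<in> K" for p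
    using that K(2) phi_nonzero[of p] by (auto simp: vec_eq_iff forall_3)
  have "(\<lambda>k. norm (inverse ((- of_real \<delta>) ^ k) :: complex)) \<longlonglongrightarrow> 0"
    using LIMSEQ_inverse_realpow_zero[of \<delta>] delta by (simp add: norm_inverse norm_power)
  then have "(\<lambda>k. inverse ((- of_real \<delta>) ^ k) :: complex) \<longlonglongrightarrow> 0"
    by (rule tendsto_norm_zero_cancel)
  from uniform_limit_vector_3[OF phi_uniform_limit[OF K] this]
  show "uniform_limit K (\<lambda>k p. vector [phi_approx k p $ 1, phi_approx k p $ 2,
      inverse ((- of_real \<delta>) ^ k)] :: complex^3) (\<lambda>p. vector [phi p $ 1, phi p $ 2, 0]) sequentially" .
qed

lemma iterate_Suc: "iterate F (Suc n) p = iterate F n (F p)"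
  by (simp add: iterate_def funpow_swap1)

lemma uniform_limit_odd:
  assumes K: "compact K" "K \<subseteq> basins"
  shows "uniform_limit K (\<lambda>k. iterate F (Suc (2 * k))) limit_odd sequentially"
proof -
  have "compact (F ` K)"
    using compact_continuous_image[OF iterate_continuous[of K 1] K(1)] by simp
  moreover have "F ` K \<subseteq> basins" using K(2) F_mem_basins by blast
  ultimately have "uniform_limit (F ` K) (\<lambda>k. iterate F (2 * k)) limit_even sequentially"
    by (rule uniform_limit_even)
  from uniform_limit_compose'[OF this, of F K] show ?thesis
    by (simp add: iterate_Suc[abs_def] limit_odd_def[abs_def])
qed

lemma limit_even_tendsto: "p \<in> basins \<Longrightarrow> (\<lambda>k. iterate F (2 * k) p) \<longlonglongrightarrow> limit_even p"
  using tendsto_uniform_limitI[OF uniform_limit_even[of "{p}"]] by simp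

lemma iterates_subsequence:
  assumes n: "filterlim n at_top sequentially"
  shows "\<exists>s h. strict_mono s \<and> h \<in> {limit_even, limit_odd} \<and>
    (\<forall>K. compact K \<and> K \<subseteq> basins \<longrightarrow> uniform_limit K (\<lambda>k. iterate F (n (s k))) h sequentially)"
  using n
proof (cases rule: parity_subsequence)
  case (1 s t)
  then show ?thesis
    by (intro exI[of _ s] exI[of _ limit_even] conjI allI impI)
      (simp_all add: uniform_limit_subsequence[OF uniform_limit_even 1(2)])
next
  case (2 s t)
  then show ?thesis
    by (intro exI[of _ s] exI[of _ limit_odd] conjI allI impI)
      (simp_all add: uniform_limit_subsequence[OF uniform_limit_odd 2(2)])
qed

text \<open>A normal family must handle arbitrary sequences of iterates: either one index recurs
  infinitely often, giving a constant subsequence, or the indices tend to infinity.\<close>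

lemma normal_family_basins: "normal_family (range (iterate F)) basins"
  unfolding normal_family_def
proof (intro allI impI)
  fix f :: "nat \<Rightarrow> complex^2 \<Rightarrow> cp2" assume "range f \<subseteq> range (iterate F)"
  then have "\<forall>j. \<exists>n. f j = iterate F n" by blast
  then obtain n where n: "\<And>j. f j = iterate F (n j)" by metis
  show "\<exists>r h. strict_mono r \<and> converges_on_compacts (f \<circ> r) h basins"
  proof (cases "\<exists>c. infinite {j. n j = c}")
    case True
    then obtain c where "infinite {j. n j = c}" by blast
    from infinite_enumerate[OF this] obtain s :: "nat \<Rightarrow> nat" where s: "strict_mono s" "\<forall>k. s k \<in> {j. n j = c}"
      by blast
    have "converges_on_compacts (f \<circ> s) (iterate F c) basins"
      using s(2) by (simp add: converges_on_compacts_def o_def n uniform_limit_const)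
    with s(1) show ?thesis by blast
  next
    case False
    have "finite {j. n j < Z}" for Z
    proof -
      have "{j. n j < Z} = (\<Union>c<Z. {j. n j = c})" by auto
      then show ?thesis using False by simp
    qed
    then have "\<forall>\<^sub>F j in sequentially. Z \<le> n j" for Z
      by (simp add: cofinite_eq_sequentially[symmetric] eventually_cofinite not_le)
    then have "filterlim n at_top sequentially" by (simp add: filterlim_at_top)
    from iterates_subsequence[OF this] obtain s h where "strict_mono s"
      "\<And>K. compact K \<and> K \<subseteq> basins \<Longrightarrow> uniform_limit K (\<lambda>k. iterate F (n (s k))) h sequentially"
      by blast
    then show ?thesis
      by (intro exI[of _ s] exI[of _ h]) (simp add: converges_on_compacts_def o_def n)
  qed
qed

lemma basins_subset_fatou: "basins \<subseteq> fatou_set F"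
  unfolding fatou_set_def using open_basins normal_family_basins by blast

section \<open>Values and ranks of the limit functions\<close>

lemma ratio_image:
  assumes "a \<in> {1, -1}"
  shows "ratio ` basin a a = right_half_plane" "ratio ` basin a (- a) = uminus ` right_half_plane"
proof -
  have "- a \<in> {1, -1}" using assms by auto
  then have "ratio ` basin a b = (\<lambda>p. p $ 1 / p $ 2) ` sector 0 a b" if "b \<in> {a, - a}" for b
    using phi_image_basin[of a b, symmetric] assms that by (auto simp: ratio_def image_image)
  then show "ratio ` basin a a = right_half_plane" "ratio ` basin a (- a) = uminus ` right_half_plane"
    using sector_ratio_image[OF assms] by auto
qed

lemma ratio_sign:
  assumes ab: "a \<in> {1, -1}" "b \<in> {1, -1}" and p: "p \<in> basin a b"
  shows "0 < of_int (a * b) * Re (ratio p)"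
proof (cases "b = a")
  case True
  then have "ratio p \<in> right_half_plane" using p ratio_image(1)[OF ab(1)] by blast
  then show ?thesis using True ab by (auto simp: right_half_plane_def)
next
  case False
  then have b: "b = - a" using ab by auto
  then have "ratio p \<in> uminus ` right_half_plane" using p ratio_image(2)[OF ab(1)] by blast
  then show ?thesis using b ab by (auto simp: right_half_plane_def)
qed

text \<open>Equality would make the square of the ratio equal to \<open>-\<delta> < 0\<close>, hence
  the ratio purely imaginary, while on the basins its real part is nonzero.\<close>

lemma limit_even_noteq_odd:
  assumes "p \<in> basins"
  shows "limit_even p \<noteq> limit_odd p"
proof
  assume "limit_even p = limit_odd p"
  then have eq: "ratio p = - of_real \<delta> / ratio p"
    by (simp add: limit_even_eq limit_odd_eq assms point_at_infinity_inj)
  obtain a b where ab: "a \<in> {1, -1}" "b \<in> {1, -1}" "p \<in> basin a b" by (rule basins_cases[OF assms])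
  have "Re (ratio p) \<noteq> 0" using ratio_sign[OF ab] by auto
  then have nz: "ratio p \<noteq> 0" by auto
  with eq have "(ratio p)\<^sup>2 = - of_real \<delta>" by (simp add: field_simps power2_eq_square)
  then have "Im (ratio p) = 0" "Re ((ratio p)\<^sup>2) = - \<delta>"
    using \<open>Re (ratio p) \<noteq> 0\<close> by (auto simp: complex_eq_iff power2_eq_square)
  then have "(Re (ratio p))\<^sup>2 = - \<delta>" by (simp add: power2_eq_square)
  then show False using delta zero_le_power2[of "Re (ratio p)"] by linarith
qed

text \<open>A convergent sequence of iterates has the same limit as its thinning to constant parity.
  The set is arbitrary in order to cover single basins as well as their union.\<close>

lemma exactly_two_limits:
  assumes \<Omega>: "\<Omega> \<subseteq> basins" "\<Omega> \<noteq> {}"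
  shows "exactly_two_limit_functions F \<Omega> limit_even limit_odd"
  unfolding exactly_two_limit_functions_def
proof (intro conjI allI iffI)
  show "\<exists>p\<in>\<Omega>. limit_even p \<noteq> limit_odd p" using \<Omega> limit_even_noteq_odd by blast
  fix h
  {
    assume "limit_function F \<Omega> h"
    then obtain r where r: "strict_mono r" "converges_on_compacts (iterate F \<circ> r) h \<Omega>"
      unfolding limit_function_def by blast
    obtain s g where s: "strict_mono s" "g \<in> {limit_even, limit_odd}"
      "\<And>K. compact K \<and> K \<subseteq> basins \<Longrightarrow> uniform_limit K (\<lambda>k. iterate F (r (s k))) g sequentially"
      using iterates_subsequence[OF filterlim_subseq[OF r(1)]] by blast
    have "h p = g p" if "p \<in> \<Omega>" for p
    proof (rule LIMSEQ_unique)
      have "uniform_limit {p} (iterate F \<circ> r) h sequentially"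
        using r(2)[unfolded converges_on_compacts_def, rule_format, of "{p}"] that by auto
      from tendsto_uniform_limitI[OF this, of p]
      have "(\<lambda>k. iterate F (r k) p) \<longlonglongrightarrow> h p" by simp
      then show "(\<lambda>k. iterate F (r (s k)) p) \<longlonglongrightarrow> h p"
        by (rule filterlim_compose[OF _ filterlim_subseq[OF s(1)]])
      have "uniform_limit {p} (\<lambda>k. iterate F (r (s k))) g sequentially"
        using s(3)[of "{p}"] that \<Omega>(1) by auto
      from tendsto_uniform_limitI[OF this] show "(\<lambda>k. iterate F (r (s k)) p) \<longlonglongrightarrow> g p" by simp
    qed
    then show "(\<forall>p\<in>\<Omega>. h p = limit_even p) \<or> (\<forall>p\<in>\<Omega>. h p = limit_odd p)" using s(2) by auto
  }
  {
    have lim: "limit_function F \<Omega> h" if "strict_mono r" "\<forall>p\<in>\<Omega>. h p = g p"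
      "\<And>K. compact K \<Longrightarrow> K \<subseteq> basins \<Longrightarrow> uniform_limit K (\<lambda>k. iterate F (r k)) g sequentially" for r g
      unfolding limit_function_def converges_on_compacts_def
    proof (intro exI[of _ r] conjI allI impI)
      fix K assume K: "compact K \<and> K \<subseteq> \<Omega>"
      then have "uniform_limit K (\<lambda>k. iterate F (r k)) g sequentially" using that(3) \<Omega>(1) by blast
      moreover have "uniform_limit K (\<lambda>k. iterate F (r k)) g sequentially \<longleftrightarrow>
          uniform_limit K (iterate F \<circ> r) h sequentially"
        by (rule uniform_limit_cong') (use K that(2) in auto)
      ultimately show "uniform_limit K (iterate F \<circ> r) h sequentially" by blast
    qed (rule that(1))
    assume "(\<forall>p\<in>\<Omega>. h p = limit_even p) \<or> (\<forall>p\<in>\<Omega>. h p = limit_odd p)"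
    then show "limit_function F \<Omega> h"
      using lim[of "\<lambda>k. 2 * k" limit_even, OF _ _ uniform_limit_even]
        lim[of "\<lambda>k. Suc (2 * k)" limit_odd, OF _ _ uniform_limit_odd]
      by (auto simp: strict_mono_def)
  }
qed

text \<open>The ratio is a submersion because \<open>phi\<close> has an invertible differential; the
  odd ratio is its image under \<open>\<zeta> \<mapsto> -\<delta> / \<zeta>\<close>, which is
  locally invertible away from \<open>0\<close>.\<close>

lemma limit_rank:
  assumes p: "p \<in> basins"
  shows "has_rank_at limit_even p 1" "has_rank_at limit_odd p 1"
proof -
  obtain D where D: "complex_linear D" "inj D" "(phi has_derivative D) (at p)"
    using phi_regular_at[OF p] unfolding regular_at_def by blast
  interpret D: Vector_Spaces.linear "(*s)" "(*s)" D by (rule D(1))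
  note nz = phi_nonzero[OF p]
  define d where "d = (\<lambda>v. (D v $ 1 * phi p $ 2 - phi p $ 1 * D v $ 2) / (phi p $ 2 * phi p $ 2))"
  have c: "((\<lambda>q. phi q $ k) has_derivative (\<lambda>v. D v $ k)) (at p)" for k
    by (rule has_derivative_compose[OF D(3) has_derivative_component])
  have der: "(ratio has_derivative d) (at p)"
    unfolding ratio_def[abs_def] d_def by (rule has_derivative_divide'[OF c c nz(2)])
  have lin: "d (u + v) = d u + d v" "d (c *s v) = c * d v" for u v c
    by (simp_all add: d_def D.add D.scale algebra_simps add_divide_distrib diff_divide_distrib)
  have "surj D" using D(1,2) vec.linear_inj_imp_surj by blast
  \<comment> \<open>A direction that moves only the first coordinate of \<open>phi\<close>; along it
    the ratio has derivative \<open>1 / phi p $ 2\<close>.\<close>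
  then obtain w where "D w = axis 1 1" by (metis surjD)
  then have dw: "d w \<noteq> 0" using nz by (simp add: d_def axis_def)
  show "has_rank_at limit_even p 1"
    by (rule has_rank_at_point_at_infinity[OF open_basins p limit_even_eq lin der dw])
  define e where "e = (\<lambda>v. (of_real \<delta> / (ratio p)\<^sup>2) * d v)"
  have rnz: "ratio p \<noteq> 0" using nz by (simp add: ratio_def)
  have "((\<lambda>z. - of_real \<delta> / z) has_field_derivative of_real \<delta> / (ratio p)\<^sup>2) (at (ratio p))"
    using rnz by (auto intro!: derivative_eq_intros simp: power2_eq_square)
  from has_derivative_compose[OF der has_field_derivative_imp_has_derivative[OF this]]
  have der': "((\<lambda>q. - of_real \<delta> / ratio q) has_derivative e) (at p)" by (simp add: e_def)
  have lin': "e (u + v) = e u + e v" "e (c *s v) = c * e v" for u v c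
    by (simp_all add: e_def lin algebra_simps add_divide_distrib)
  have ew: "e w \<noteq> 0" using dw rnz delta by (simp add: e_def)
  show "has_rank_at limit_odd p 1"
    by (rule has_rank_at_point_at_infinity[OF open_basins p limit_odd_eq lin' der' ew])
qed

lemma limit_generic_rank:
  assumes ab: "a \<in> {1, -1}" "b \<in> {1, -1}" and h: "h \<in> {limit_even, limit_odd}"
  shows "has_generic_rank h (basin a b) 1"
proof -
  have "has_rank_at h p 1" if "p \<in> basin a b" for p
  proof -
    have "p \<in> basins" using that basin_subset[OF ab] by blast
    then show ?thesis using h limit_rank by blast
  qed
  then show ?thesis
    unfolding has_generic_rank_def using open_basin[of a b] closure_subset[of "basin a b"] by blast
qed

lemma limit_in_line_at_infinity:
  assumes "p \<in> basins" "h \<in> {limit_even, limit_odd}"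
  shows "h p \<in> line_at_infinity"
  using assms(2) limit_even_eq[OF assms(1)] limit_odd_eq[OF assms(1)] point_at_infinity_in_line
  by auto

lemma limit_even_image:
  assumes "a \<in> {1, -1}" "b \<in> {1, -1}"
  shows "limit_even ` basin a b = point_at_infinity ` ratio ` basin a b"
  unfolding image_image
  by (rule image_cong[OF refl], rule limit_even_eq, rule subsetD[OF basin_subset[OF assms]])

lemma neg_inverse_image:
  "(\<lambda>\<zeta>. - of_real \<delta> / \<zeta>) ` right_half_plane = uminus ` right_half_plane"
  "(\<lambda>\<zeta>. - of_real \<delta> / \<zeta>) ` uminus ` right_half_plane = right_half_plane"
proof -
  have pos: "of_real \<delta> / \<zeta> \<in> right_half_plane" "of_real \<delta> / (of_real \<delta> / \<zeta>) = \<zeta>"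
    if "\<zeta> \<in> right_half_plane" for \<zeta>
  proof -
    have "\<zeta> \<noteq> 0" "0 < Re \<zeta>" using that by (auto simp: right_half_plane_def)
    then show "of_real \<delta> / \<zeta> \<in> right_half_plane" "of_real \<delta> / (of_real \<delta> / \<zeta>) = \<zeta>"
      using delta by (auto simp: right_half_plane_def Re_divide zero_less_divide_iff complex_neq_0)
  qed
  have im: "(\<lambda>\<zeta>. of_real \<delta> / \<zeta>) ` right_half_plane = right_half_plane"
    using pos by (metis (no_types, lifting) equalityI image_iff image_subsetI subsetI)
  have "(\<lambda>\<zeta>. - of_real \<delta> / \<zeta>) ` right_half_plane = uminus ` (\<lambda>\<zeta>. of_real \<delta> / \<zeta>) ` right_half_plane"
    by (simp add: image_image)
  then show "(\<lambda>\<zeta>. - of_real \<delta> / \<zeta>) ` right_half_plane = uminus ` right_half_plane"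
    using im by simp
  show "(\<lambda>\<zeta>. - of_real \<delta> / \<zeta>) ` uminus ` right_half_plane = right_half_plane"
    using im by (simp add: image_image)
qed

lemma limit_odd_image:
  assumes "a \<in> {1, -1}" "b \<in> {1, -1}"
  shows "limit_odd ` basin a b = point_at_infinity ` (\<lambda>\<zeta>. - of_real \<delta> / \<zeta>) ` ratio ` basin a b"
  unfolding image_image
  by (rule image_cong[OF refl], rule limit_odd_eq, rule subsetD[OF basin_subset[OF assms]])

section \<open>Geometry of the basins\<close>

lemma basin_biholomorphic:
  assumes ab: "a \<in> {1, -1}" "b \<in> {1, -1}"
  shows "biholomorphic (basin a b) half_plane_squared"
proof -
  have sub: "basin a b \<subseteq> basins" by (rule basin_subset[OF ab])
  have "biholomorphism (square_map \<circ> phi) (basin a b) ((square_map \<circ> phi) ` basin a b)"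
  proof (rule biholomorphism_image[OF open_basin])
    show "inj_on (square_map \<circ> phi) (basin a b)"
      using square_map_inj_on[OF ab] phi_image_basin[OF ab] inj_on_subset[OF phi_inj_on sub]
      by (intro comp_inj_on) auto
    show "regular_at (square_map \<circ> phi) p" if "p \<in> basin a b" for p
    proof -
      have p: "p \<in> basins" using that sub by blast
      show ?thesis
        unfolding o_def
        by (rule regular_at_compose[OF phi_regular_at[OF p] square_map_regular_at[OF phi_nonzero[OF p]]])
    qed
  qed
  moreover have "(square_map \<circ> phi) ` basin a b = half_plane_squared"
    by (simp only: image_comp[symmetric] phi_image_basin[OF ab] square_map_image[OF ab])
  ultimately show ?thesis unfolding biholomorphic_def by auto
qed

lemma basin_biholomorphism_phi:
  assumes ab: "a \<in> {1, -1}" "b \<in> {1, -1}"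
  shows "biholomorphism phi (basin a b) (sector 0 a b)"
proof -
  have sub: "basin a b \<subseteq> basins" by (rule basin_subset[OF ab])
  have "biholomorphism phi (basin a b) (phi ` basin a b)"
    using sub by (intro biholomorphism_image open_basin inj_on_subset[OF phi_inj_on] phi_regular_at) auto
  then show ?thesis by (simp only: phi_image_basin[OF ab])
qed

text \<open>The basin is the continuous image of a convex set under the inverse of
  \<open>phi\<close>.\<close>

lemma basin_connected:
  assumes ab: "a \<in> {1, -1}" "b \<in> {1, -1}"
  shows "connected (basin a b)"
proof -
  have b: "biholomorphism phi (basin a b) (sector 0 a b)" by (rule basin_biholomorphism_phi[OF ab])
  then have "continuous_on (sector 0 a b) (inv_into (basin a b) phi)"
    unfolding biholomorphism_def by (blast intro: holomorphic_map_continuous_on)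
  then have "connected (inv_into (basin a b) phi ` sector 0 a b)"
    by (rule connected_continuous_image[OF _ convex_connected[OF convex_sector]])
  moreover have "inv_into (basin a b) phi ` sector 0 a b = basin a b"
    using b bij_betw_inv_into[of phi "basin a b" "sector 0 a b"]
    by (simp add: biholomorphism_def bij_betw_imp_surj_on)
  ultimately show ?thesis by simp
qed

lemma basin_nonempty:
  assumes "a \<in> {1, -1}" "b \<in> {1, -1}"
  shows "basin a b \<noteq> {}"
proof -
  have "(vector [of_int a, of_int b] :: complex^2) \<in> sector 0 a b"
    using assms by (auto simp: sector_def depth_def)
  then show ?thesis using phi_image_basin[OF assms] by blast
qed

lemma basin_disjoint:
  assumes "a \<in> {1, -1}" "b \<in> {1, -1}" "a' \<in> {1, -1}" "b' \<in> {1, -1}" "p \<in> basin a b" "p \<in> basin a' b'"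
  shows "a = a'" "b = b'"
proof -
  note signs = sector_signs[OF phi_basin_subset[OF assms(1,2,5)] phi_basin_subset[OF assms(3,4,6)]
      order_refl order_refl assms(1-4)]
  show "a = a'" by (rule signs(1))
  show "b = b'" by (rule signs(2))
qed

end

section \<open>Harnack inequality and equicontinuity\<close>

lemma harnack_disc:
  fixes G :: "complex \<Rightarrow> complex"
  assumes hol: "G holomorphic_on ball 0 1" and pos: "\<And>z. z \<in> ball 0 1 \<Longrightarrow> 0 < Re (G z)"
    and t: "norm t < 1"
  shows "\<bar>Re (G t) - Re (G 0)\<bar> \<le> norm t * (Re (G t) + Re (G 0))"
proof -
  define B where "B = G 0"
  define g where "g = (\<lambda>z. (G z - B) / (G z + cnj B))"
  have B: "0 < Re B" using pos[of 0] by (simp add: B_def)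
  have den: "G z + cnj B \<noteq> 0" if "z \<in> ball 0 1" for z
  proof -
    have "0 < Re (G z + cnj B)" using pos[OF that] B by simp
    then show ?thesis by (metis less_irrefl zero_complex.sel(1))
  qed
  have "norm (g t) \<le> norm t"
  proof (rule Schwarz_Lemma(1)[OF _ _ _ t])
    show "g holomorphic_on ball 0 1"
      unfolding g_def by (intro holomorphic_intros hol den)
    show "g 0 = 0" by (simp add: g_def B_def)
    show "norm (g z) < 1" if "norm z < 1" for z
    proof -
      have z: "z \<in> ball 0 1" using that by simp
      have "(norm (G z - B))\<^sup>2 < (norm (G z + cnj B))\<^sup>2"
        using mult_pos_pos[OF pos[OF z] B] unfolding cmod_power2
        by (simp add: power2_eq_square algebra_simps)
      then have "norm (G z - B) < norm (G z + cnj B)" by (rule power_less_imp_less_base) simp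
      then show ?thesis using den[OF z] by (simp add: g_def norm_divide)
    qed
  qed
  moreover have tb: "t \<in> ball 0 1" using t by simp
  ultimately have "norm (G t - B) \<le> norm t * norm (G t + cnj B)"
    using den[OF tb] by (simp add: g_def norm_divide pos_divide_le_eq)
  then have "(norm (G t - B))\<^sup>2 \<le> (norm t * norm (G t + cnj B))\<^sup>2"
    by (rule power_mono) simp
  then have sq: "(Re (G t) - Re B)\<^sup>2 + (Im (G t) - Im B)\<^sup>2
      \<le> (norm t)\<^sup>2 * (Re (G t) + Re B)\<^sup>2 + (norm t)\<^sup>2 * (Im (G t) - Im B)\<^sup>2"
    unfolding power_mult_distrib cmod_power2[of "G t - B"] cmod_power2[of "G t + cnj B"]
    by (simp add: distrib_left)
  have "(norm t)\<^sup>2 \<le> 1" using t by (simp add: power_le_one)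
  then have "(norm t)\<^sup>2 * (Im (G t) - Im B)\<^sup>2 \<le> 1 * (Im (G t) - Im B)\<^sup>2"
    by (rule mult_right_mono) simp
  with sq have "(Re (G t) - Re B)\<^sup>2 \<le> (norm t * (Re (G t) + Re B))\<^sup>2"
    by (simp add: power_mult_distrib)
  moreover have "0 \<le> norm t * (Re (G t) + Re B)" using pos[OF tb] B by simp
  ultimately have "\<bar>Re (G t) - Re B\<bar> \<le> norm t * (Re (G t) + Re B)"
    unfolding abs_le_square_iff[symmetric] by simp
  then show ?thesis by (simp only: B_def)
qed

text \<open>A nonvanishing \<open>f\<close> on the disc has a logarithm \<open>g\<close>, and
  \<open>- g\<close> has positive real part. At \<open>1/5\<close> the constant is
  \<open>(1 - 1/5) / (1 + 1/5) = 2/3\<close>.\<close>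

lemma harnack_ln_norm:
  fixes f :: "complex \<Rightarrow> complex"
  assumes hol: "f holomorphic_on ball 0 1"
    and f: "\<And>z. z \<in> ball 0 1 \<Longrightarrow> f z \<noteq> 0" "\<And>z. z \<in> ball 0 1 \<Longrightarrow> norm (f z) < 1"
  shows "ln (norm (f 0)) \<le> 2 / 3 * ln (norm (f (1 / 5)))"
    and "ln (norm (f (1 / 5))) \<le> 2 / 3 * ln (norm (f 0))"
proof -
  have "(0::complex) \<in> ball 0 1" by simp
  from holomorphic_logarithm_exists[OF convex_ball open_ball hol f(1) this]
  obtain g where g: "g holomorphic_on ball 0 1" "\<And>z. z \<in> ball 0 1 \<Longrightarrow> exp (g z) = f z" by blast
  have re: "Re (g z) = ln (norm (f z))" if "z \<in> ball 0 1" for z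
    using g(2)[OF that, symmetric] by simp
  have "0 < Re (- g z)" if "z \<in> ball 0 1" for z
    using re[OF that] f(1,2)[OF that] by simp
  from harnack_disc[OF holomorphic_on_minus[OF g(1)] this, of "1 / 5"]
  have "\<bar>Re (g (1 / 5)) - Re (g 0)\<bar> \<le> 1 / 5 * (- Re (g (1 / 5)) - Re (g 0))"
    by (simp add: abs_minus_commute)
  moreover have "Re (g 0) = ln (norm (f 0))" "Re (g (1 / 5)) = ln (norm (f (1 / 5)))"
    by (simp_all add: re)
  ultimately have "\<bar>ln (norm (f (1 / 5))) - ln (norm (f 0))\<bar>
      \<le> 1 / 5 * (- ln (norm (f (1 / 5))) - ln (norm (f 0)))" by simp
  then show "ln (norm (f 0)) \<le> 2 / 3 * ln (norm (f (1 / 5)))"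
    and "ln (norm (f (1 / 5))) \<le> 2 / 3 * ln (norm (f 0))"
    unfolding abs_le_iff by simp_all
qed

text \<open>Failure at every scale produces points \<open>q j\<close> tending to \<open>p\<close>
  with oscillation at least \<open>e\<close>. A subsequence converges uniformly near
  \<open>p\<close> to a limit that is continuous there, and three errors of size
  \<open>e / 3\<close> contradict this.\<close>

lemma normal_family_equicontinuous:
  fixes f :: "nat \<Rightarrow> 'a::heine_borel \<Rightarrow> 'b::metric_space"
  assumes U: "open U" "p \<in> U" and normal: "normal_family (range f) U"
    and cont: "\<And>n. continuous_on U (f n)" and e: "0 < e"
  shows "\<exists>d>0. ball p d \<subseteq> U \<and> (\<forall>n. \<forall>q\<in>ball p d. dist (f n q) (f n p) < e)"
proof (rule ccontr)
  assume contr: "\<not> ?thesis"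
  obtain r where r: "0 < r" "cball p r \<subseteq> U" using U open_contains_cball by blast
  have "\<exists>n q. q \<in> ball p (r / real (Suc j)) \<and> e \<le> dist (f n q) (f n p)" for j
  proof (rule ccontr)
    assume no: "\<not> ?thesis"
    have "r / real (Suc j) \<le> r" using r(1) by (simp add: field_simps)
    then have "ball p (r / real (Suc j)) \<subseteq> U" using r(2) by (meson ball_subset_cball dual_order.trans subset_ball)
    moreover have "0 < r / real (Suc j)" using r(1) by simp
    ultimately show False using contr no not_le by blast
  qed
  then obtain n q where nq: "\<And>j. q j \<in> ball p (r / real (Suc j))"
    "\<And>j. e \<le> dist (f (n j) (q j)) (f (n j) p)" by metis
  have "range (\<lambda>j. f (n j)) \<subseteq> range f" by blast
  then obtain s h where s: "strict_mono s" "converges_on_compacts ((\<lambda>j. f (n j)) \<circ> s) h U"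
    using normal unfolding normal_family_def by blast
  have ul: "uniform_limit (cball p r) ((\<lambda>j. f (n j)) \<circ> s) h sequentially"
    using s(2) r(2) compact_cball unfolding converges_on_compacts_def by blast
  have conth: "continuous_on (cball p r) h"
  proof (rule uniform_limit_theorem[OF _ ul])
    show "\<forall>\<^sub>F k in sequentially. continuous_on (cball p r) (((\<lambda>j. f (n j)) \<circ> s) k)"
      using continuous_on_subset[OF cont r(2)] by simp
  qed simp
  have "(\<lambda>j. dist (q j) p) \<longlonglongrightarrow> 0"
  proof (rule tendsto_sandwich[OF _ _ tendsto_const])
    show "\<forall>\<^sub>F j in sequentially. 0 \<le> dist (q j) p" by simp
    show "\<forall>\<^sub>F j in sequentially. dist (q j) p \<le> r / real (Suc j)"
      using nq(1) by (intro always_eventually allI) (simp add: dist_commute less_imp_le)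
    show "(\<lambda>j. r / real (Suc j)) \<longlonglongrightarrow> 0"
      by (rule LIMSEQ_Suc[OF lim_const_over_n])
  qed
  then have "q \<longlonglongrightarrow> p" by (simp add: tendsto_dist_iff[of q p])
  from LIMSEQ_subseq_LIMSEQ[OF this s(1)] have qs: "(\<lambda>k. q (s k)) \<longlonglongrightarrow> p" by (simp only: o_def)
  have qin: "q j \<in> cball p r" for j
  proof -
    have "r / real (Suc j) \<le> r" using r(1) by (simp add: field_simps)
    then show ?thesis using nq(1)[of j] by simp
  qed
  have "(\<lambda>k. h (q (s k))) \<longlonglongrightarrow> h p"
    by (rule continuous_on_tendsto_compose[OF conth qs])
      (use r(1) qin in auto)
  then have "\<forall>\<^sub>F k in sequentially. dist (h (q (s k))) (h p) < e / 3" using e by (intro tendstoD) auto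
  moreover have "\<forall>\<^sub>F k in sequentially. \<forall>x\<in>cball p r. dist (f (n (s k)) x) (h x) < e / 3"
    using uniform_limitD[OF ul, of "e / 3"] e by (simp only: o_apply)
  ultimately have "\<forall>\<^sub>F k in sequentially. False"
  proof eventually_elim
    case (elim k)
    have "dist (f (n (s k)) (q (s k))) (h (q (s k))) < e / 3" using elim(2) qin by blast
    moreover have "dist (f (n (s k)) p) (h p) < e / 3" using elim(2) r(1) by simp
    ultimately have "dist (f (n (s k)) (q (s k))) (f (n (s k)) p) < e"
      using elim(1) dist_triangle[of "f (n (s k)) (q (s k))" "f (n (s k)) p" "h (q (s k))"]
        dist_triangle[of "h (q (s k))" "f (n (s k)) p" "h p"] dist_commute[of "h p" "f (n (s k)) p"]
      by linarith
    then show False using nq(2)[of "s k"] by linarith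
  qed
  then show False by simp
qed

text \<open>Exhaustion by closed discs, required for the countability of the zeros of a holomorphic
  function on the open disc.\<close>

lemma fsigma_ball: "fsigma (ball (x :: complex) r)"
proof -
  have "ball x r = (\<Union>n. cball x (r - inverse (real (Suc n))))"
  proof
    show "ball x r \<subseteq> (\<Union>n. cball x (r - inverse (real (Suc n))))"
    proof
      fix y assume "y \<in> ball x r"
      then obtain n where "inverse (real (Suc n)) < r - dist x y"
        using reals_Archimedean[of "r - dist x y"] by auto
      then have "y \<in> cball x (r - inverse (real (Suc n)))" by simp
      then show "y \<in> (\<Union>n. cball x (r - inverse (real (Suc n))))" by blast
    qed
    have "y \<in> ball x r" if "y \<in> cball x (r - inverse (real (Suc n)))" for y n
    proof -
      have "0 < inverse (real (Suc n))" by simp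
      then show ?thesis using that unfolding mem_cball mem_ball by linarith
    qed
    then show "(\<Union>n. cball x (r - inverse (real (Suc n)))) \<subseteq> ball x r" by blast
  qed
  then show ?thesis using fsigma.intros[of "\<lambda>n. cball x (r - inverse (real (Suc n)))"] by simp
qed

section \<open>Neighbourhoods of points at infinity\<close>

lemma line_at_infinity_eq: "line_at_infinity = - chart_domain 3"
proof -
  have "abs_cp2 u \<in> line_at_infinity" if "u \<noteq> 0" "u $ 3 = 0" for u :: "complex^3"
  proof -
    have "u = vector [u $ 1, u $ 2, 0]" "(u $ 1, u $ 2) \<noteq> (0, 0)"
      using that by (auto simp: vec_eq_iff forall_3)
    then have "abs_cp2 u = abs_cp2 (vector [u $ 1, u $ 2, 0])" by simp
    with \<open>(u $ 1, u $ 2) \<noteq> (0, 0)\<close> show ?thesis unfolding line_at_infinity_def by blast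
  qed
  moreover have "P \<in> line_at_infinity \<Longrightarrow> P \<notin> chart_domain 3" for P
  proof -
    assume "P \<in> line_at_infinity"
    then obtain z w where P: "P = abs_cp2 (vector [z, w, 0])" "(z, w) \<noteq> (0, 0)"
      unfolding line_at_infinity_def by blast
    have "(vector [z, w, 0] :: complex^3) \<noteq> 0" using P(2) by (auto simp: vec_eq_iff forall_3)
    then show ?thesis by (simp add: P(1) abs_cp2_in_chart_domain)
  qed
  moreover have "P \<in> line_at_infinity" if "P \<notin> chart_domain 3" for P
  proof -
    obtain u where "u \<noteq> 0" "P = abs_cp2 u" by (rule cp2_cases)
    with that calculation(1)[of u] show ?thesis by (simp add: abs_cp2_in_chart_domain)
  qed
  ultimately show ?thesis by blast
qed

lemma line_at_infinity_cases:
  assumes "P \<in> line_at_infinity"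
  shows "(\<exists>\<zeta>. P = point_at_infinity \<zeta>) \<or> P = abs_cp2 (vector [1, 0, 0])"
proof -
  obtain z w where P: "P = abs_cp2 (vector [z, w, 0])" "(z, w) \<noteq> (0, 0)"
    using assms unfolding line_at_infinity_def by blast
  show ?thesis
  proof (cases "w = 0")
    case True
    then have "vector [z, w, 0] = z *s (vector [1, 0, 0] :: complex^3)" "z \<noteq> 0"
      using P(2) by (auto simp: vec_eq_iff forall_3)
    moreover have "(vector [1, 0, 0] :: complex^3) \<noteq> 0" by (auto simp: vec_eq_iff forall_3)
    ultimately show ?thesis using P(1) by (simp add: abs_cp2_scale)
  next
    case False
    then show ?thesis using P(1) abs_cp2_infinity by blast
  qed
qed

lemma continuous_point_at_infinity: "continuous_on A point_at_infinity"
proof -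
  have "continuous_on A (abs_cp2 \<circ> (\<lambda>\<zeta>. vector [\<zeta>, 1, 0]))"
    by (intro continuous_on_compose continuous_on_vector_3 continuous_intros
        continuous_on_subset[OF continuous_on_abs_cp2]) (auto simp: infinity_vector_nonzero)
  then show ?thesis by (simp add: point_at_infinity_def[abs_def] o_def)
qed

lemma tendsto_point_at_infinity:
  "(f \<longlongrightarrow> \<zeta>) G \<Longrightarrow> ((\<lambda>x. point_at_infinity (f x)) \<longlongrightarrow> point_at_infinity \<zeta>) G"
  by (rule continuous_on_tendsto_compose[OF continuous_point_at_infinity[of UNIV]]) auto

lemma tendsto_chart:
  assumes "(f \<longlongrightarrow> P) G" "P \<in> chart_domain i"
  shows "((\<lambda>x. chart i (f x) $ j) \<longlongrightarrow> chart i P $ j) G"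
    and "\<forall>\<^sub>F x in G. f x \<in> chart_domain i"
proof -
  show ev: "\<forall>\<^sub>F x in G. f x \<in> chart_domain i"
    using topological_tendstoD[OF assms(1) open_chart_domain assms(2)] .
  show "((\<lambda>x. chart i (f x) $ j) \<longlongrightarrow> chart i P $ j) G"
    using continuous_on_tendsto_compose[OF continuous_on_chart assms ev] .
qed

lemma chart_affine_point:
  "affine_point x \<in> chart_domain 1 \<longleftrightarrow> x $ 1 \<noteq> 0" "affine_point x \<in> chart_domain 2 \<longleftrightarrow> x $ 2 \<noteq> 0"
  "chart 1 (affine_point x) $ 2 = x $ 2 / x $ 1" "chart 2 (affine_point x) $ 1 = x $ 1 / x $ 2"
  "chart 2 (affine_point x) $ 3 = 1 / x $ 2"
  by (simp_all add: affine_point_def abs_cp2_in_chart_domain affine_point_nonzero chart_abs_cp2)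

lemma chart_point_at_infinity:
  "point_at_infinity \<zeta> \<in> chart_domain 2" "chart 2 (point_at_infinity \<zeta>) $ 1 = \<zeta>"
  "chart 2 (point_at_infinity \<zeta>) $ 3 = 0"
  "point_at_infinity \<zeta> \<in> chart_domain 1 \<longleftrightarrow> \<zeta> \<noteq> 0" "chart 1 (point_at_infinity \<zeta>) $ 2 = 1 / \<zeta>"
  by (simp_all add: point_at_infinity_def abs_cp2_in_chart_domain infinity_vector_nonzero chart_abs_cp2)

lemma chart_infinity:
  "abs_cp2 (vector [1, 0, 0]) \<in> chart_domain 1" "chart 1 (abs_cp2 (vector [1, 0, 0])) $ 2 = 0"
proof -
  have "(vector [1, 0, 0] :: complex^3) \<noteq> 0" by (auto simp: vec_eq_iff forall_3)
  then show "abs_cp2 (vector [1, 0, 0]) \<in> chart_domain 1" "chart 1 (abs_cp2 (vector [1, 0, 0])) $ 2 = 0"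
    by (simp_all add: abs_cp2_in_chart_domain chart_abs_cp2)
qed

lemma open_chart_vimage: "open A \<Longrightarrow> open (chart_domain i \<inter> (\<lambda>P. chart i P $ j) -` A)"
  by (rule continuous_open_preimage[OF continuous_on_chart open_chart_domain])

lemma small_ratio_neighbourhood:
  obtains V where "open V" "point_at_infinity 0 \<in> V"
    "\<And>x. affine_point x \<in> V \<Longrightarrow> x $ 2 \<noteq> 0 \<and> norm (x $ 1) < norm (x $ 2)"
proof (rule that)
  let ?V = "chart_domain 2 \<inter> (\<lambda>P. chart 2 P $ 1) -` ball 0 1"
  show "open ?V" by (rule open_chart_vimage) simp
  show "point_at_infinity 0 \<in> ?V" by (simp add: chart_point_at_infinity)
  show "x $ 2 \<noteq> 0 \<and> norm (x $ 1) < norm (x $ 2)" if "affine_point x \<in> ?V" for x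
    using that by (auto simp: chart_affine_point norm_divide divide_less_eq split: if_splits)
qed

text \<open>Near a point at infinity away from \<open>[0:1:0]\<close> and \<open>[1:0:0]\<close> the
  two affine coordinates are large and comparable. The third chart coordinate is
  \<open>1 / w\<close>; keeping it below \<open>norm \<rho> / 2\<close> in modulus, together with
  \<open>\<bar>z / w\<bar> > norm \<rho> / 2\<close>, forces
  \<open>\<bar>z\<bar> > 1\<close>.\<close>

lemma nonzero_ratio_neighbourhood:
  assumes "\<rho> \<noteq> 0"
  shows "\<exists>V C. open V \<and> point_at_infinity \<rho> \<in> V \<and> (\<forall>x. affine_point x \<in> V \<longrightarrow>
    1 < norm (x $ 1) \<and> norm (x $ 1) \<le> C * norm (x $ 2) \<and> norm (x $ 2) \<le> C * norm (x $ 1))"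
proof -
  let ?m = "norm \<rho>"
  define V where "V = (chart_domain 2 \<inter> (\<lambda>P. chart 2 P $ 1) -` (ball 0 (2 * ?m) - cball 0 (?m / 2))) \<inter>
      (chart_domain 2 \<inter> (\<lambda>P. chart 2 P $ 3) -` ball 0 (?m / 2))"
  define C where "C = max (2 * ?m) (2 / ?m)"
  have m: "0 < ?m" using assms by simp
  have "open V" unfolding V_def by (intro open_Int open_chart_vimage open_ball open_Diff closed_cball)
  moreover have "point_at_infinity \<rho> \<in> V" using m by (simp add: V_def chart_point_at_infinity)
  moreover have "1 < norm (x $ 1) \<and> norm (x $ 1) \<le> C * norm (x $ 2) \<and> norm (x $ 2) \<le> C * norm (x $ 1)"
    if "affine_point x \<in> V" for x
  proof -
    let ?y = "norm (x $ 1)" and ?z = "norm (x $ 2)"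
    have z: "0 < ?z" "?y / ?z < 2 * ?m" "?m / 2 < ?y / ?z" "1 / ?z < ?m / 2"
      using that by (auto simp: V_def chart_affine_point norm_divide)
    have y1: "?y < 2 * ?m * ?z" using z(1,2) by (simp add: divide_less_eq)
    have y2: "?m / 2 * ?z < ?y" using z(1,3) by (simp add: less_divide_eq)
    have "1 < ?m / 2 * ?z" using z(1,4) by (simp add: divide_less_eq)
    then have 1: "1 < ?y" using y2 by linarith
    have "2 * ?m * ?z \<le> C * ?z" unfolding C_def by (intro mult_right_mono) auto
    then have 2: "?y \<le> C * ?z" using y1 by linarith
    have "?z < 2 / ?m * ?y" using y2 m by (simp add: field_simps)
    moreover have "2 / ?m * ?y \<le> C * ?y" unfolding C_def by (intro mult_right_mono) auto
    ultimately have "?z \<le> C * ?y" by linarith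
    with 1 2 show ?thesis by blast
  qed
  ultimately show ?thesis by blast
qed

text \<open>In the factorization of \<open>Re (z^2)\<close> the factor
  \<open>\<bar>Re z\<bar> + \<bar>Im z\<bar>\<close> is at most \<open>2 * norm z\<close>, so the
  other one must exceed \<open>2\<close>, the threshold of the sectors.\<close>

lemma depth_bound:
  assumes "4 * norm z < Re (z\<^sup>2)"
  shows "2 < \<bar>Re z\<bar> - \<bar>Im z\<bar>"
proof (rule ccontr)
  assume "\<not> ?thesis"
  then have k: "\<bar>Re z\<bar> - \<bar>Im z\<bar> \<le> 2" by simp
  have s: "\<bar>Re z\<bar> + \<bar>Im z\<bar> \<le> 2 * norm z" using abs_Re_le_cmod[of z] abs_Im_le_cmod[of z] by simp
  have "Re (z\<^sup>2) = (\<bar>Re z\<bar> - \<bar>Im z\<bar>) * (\<bar>Re z\<bar> + \<bar>Im z\<bar>)"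
    by (simp add: power2_eq_square algebra_simps abs_mult_self_eq)
  also have "\<dots> \<le> 2 * (\<bar>Re z\<bar> + \<bar>Im z\<bar>)" using k by (intro mult_right_mono) auto
  also have "\<dots> \<le> 4 * norm z" using s by simp
  finally show False using assms by simp
qed

text \<open>The left side is \<open>4 Y^(3/2)\<close>, which is of smaller order than
  \<open>Y^2\<close>.\<close>

lemma growth_comparison:
  fixes c L :: real
  assumes "0 < c"
  shows "\<forall>\<^sub>F Y in at_top. 4 * exp (3 / 2 * ln Y) < 2 / 3 * (c * Y\<^sup>2) - 3 / 2 * ln Y - L"
  using assms by real_asymp

section \<open>The boundary of the basins\<close>

context henon_map
begin

lemma iterate_continuous_cp2: "continuous_on U (iterate F n)"
proof -
  have "continuous_on U (affine_point \<circ> (F ^^ n))"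
    by (intro continuous_on_compose iterate_continuous continuous_on_affine_point)
  then show ?thesis by (simp add: iterate_def[abs_def] o_def)
qed

lemma fatou_equicontinuous:
  assumes p: "p \<in> fatou_set F" and e: "0 < e"
  shows "\<exists>d>0. ball p d \<subseteq> fatou_set F \<and> (\<forall>n. \<forall>q\<in>ball p d. dist (iterate F n q) (iterate F n p) < e)"
proof -
  obtain U where U: "open U" "p \<in> U" "normal_family (range (iterate F)) U"
    using p unfolding fatou_set_def by blast
  then have "U \<subseteq> fatou_set F" unfolding fatou_set_def by blast
  then show ?thesis
    using normal_family_equicontinuous[OF U iterate_continuous_cp2 e] by blast
qed

text \<open>Convergence is assumed at \<open>p\<close> alone; equicontinuity keeps the orbits of all
  nearby points within \<open>e / 2\<close> of that of \<open>p\<close>, for all iterates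
  simultaneously.\<close>

lemma fatou_neighbourhood:
  assumes p: "p \<in> fatou_set F" and P: "(\<lambda>k. iterate F (m k) p) \<longlonglongrightarrow> P" and V: "open V" "P \<in> V"
  shows "\<exists>d>0. ball p d \<subseteq> fatou_set F \<and> (\<exists>N. \<forall>k\<ge>N. \<forall>q\<in>ball p d. iterate F (m k) q \<in> V)"
proof -
  obtain e where e: "0 < e" "ball P e \<subseteq> V" using V open_contains_ball by blast
  obtain d where d: "0 < d" "ball p d \<subseteq> fatou_set F"
    "\<forall>n. \<forall>q\<in>ball p d. dist (iterate F n q) (iterate F n p) < e / 2"
    using fatou_equicontinuous[OF p, of "e / 2"] e(1) by auto
  have "\<forall>\<^sub>F k in sequentially. dist (iterate F (m k) p) P < e / 2"
    using tendstoD[OF P, of "e / 2"] e(1) by simp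
  then obtain N where N: "\<forall>k\<ge>N. dist (iterate F (m k) p) P < e / 2"
    unfolding eventually_sequentially by blast
  have "iterate F (m k) q \<in> V" if "k \<ge> N" "q \<in> ball p d" for k q
  proof -
    have "dist (iterate F (m k) q) (iterate F (m k) p) < e / 2" using d(3) that(2) by blast
    moreover have "dist (iterate F (m k) p) P < e / 2" using N that(1) by blast
    ultimately have "dist P (iterate F (m k) q) < e"
      using dist_triangle_half_r by (metis dist_commute)
    then show ?thesis using e(2) by auto
  qed
  with d show ?thesis by blast
qed

text \<open>Equicontinuity at a boundary point transports the limits from the nearby basin.\<close>

lemma boundary_limit:
  assumes p: "p \<in> fatou_set F" "p \<in> closure basins"
  shows "\<exists>P\<in>line_at_infinity. (\<lambda>k. iterate F (2 * k) p) \<longlonglongrightarrow> P \<and>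
    (\<forall>q. (\<forall>n. q n \<in> basins) \<longrightarrow> q \<longlonglongrightarrow> p \<longrightarrow> (\<lambda>n. limit_even (q n)) \<longlonglongrightarrow> P)"
proof -
  obtain U where U: "open U" "p \<in> U" "normal_family (range (iterate F)) U"
    using p(1) unfolding fatou_set_def by blast
  have "range (\<lambda>k. iterate F (2 * k)) \<subseteq> range (iterate F)" by blast
  then obtain r h where r: "strict_mono r" "converges_on_compacts ((\<lambda>k. iterate F (2 * k)) \<circ> r) h U"
    using U(3) unfolding normal_family_def by blast
  define P where "P = h p"
  have "compact {p}" "{p} \<subseteq> U" using U(2) by auto
  then have "uniform_limit {p} ((\<lambda>k. iterate F (2 * k)) \<circ> r) h sequentially"
    using r(2) unfolding converges_on_compacts_def by blast
  from tendsto_uniform_limitI[OF this, of p]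
  have rP: "(\<lambda>k. iterate F (2 * r k) p) \<longlonglongrightarrow> P" by (simp add: P_def)
  \<comment> \<open>So far \<open>P\<close> is a limit along the subsequence \<open>r\<close> only.
    Nearby points of the basins, whose even iterates converge outright, are used to upgrade this to
    convergence of the whole sequence of even iterates.\<close>
  have close: "\<exists>d>0. \<forall>q\<in>ball p d \<inter> basins. dist P (limit_even q) \<le> e \<and>
      (\<forall>\<^sub>F k in sequentially. dist (iterate F (2 * k) p) (limit_even q) \<le> e)" if "0 < e" for e
  proof -
    obtain d where d: "0 < d" "\<forall>n. \<forall>q\<in>ball p d. dist (iterate F n q) (iterate F n p) < e / 2"
      using fatou_equicontinuous[OF p(1), of "e / 2"] \<open>0 < e\<close> half_gt_zero by blast
    have "dist P (limit_even q) \<le> e \<and>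
        (\<forall>\<^sub>F k in sequentially. dist (iterate F (2 * k) p) (limit_even q) \<le> e)"
      if q: "q \<in> ball p d" "q \<in> basins" for q
    proof -
      have "\<forall>\<^sub>F k in sequentially. dist (iterate F (2 * k) q) (limit_even q) < e / 2"
        using tendstoD[OF limit_even_tendsto[OF q(2)], of "e / 2"] \<open>0 < e\<close> by simp
      then have ev: "\<forall>\<^sub>F k in sequentially. dist (iterate F (2 * k) p) (limit_even q) \<le> e"
      proof eventually_elim
        case (elim k)
        have "dist (iterate F (2 * k) q) (iterate F (2 * k) p) < e / 2" using d(2) q(1) by blast
        then show ?case
          using elim dist_triangle3[of "iterate F (2 * k) p" "limit_even q" "iterate F (2 * k) q"]
          by linarith
      qed
      have "(\<lambda>k. dist (iterate F (2 * r k) p) (limit_even q)) \<longlonglongrightarrow> dist P (limit_even q)"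
        by (intro tendsto_dist rP tendsto_const)
      moreover have "\<forall>\<^sub>F k in sequentially. dist (iterate F (2 * r k) p) (limit_even q) \<le> e"
        by (rule eventually_compose_filterlim[OF ev filterlim_subseq[OF r(1)]])
      ultimately have "dist P (limit_even q) \<le> e" by (rule tendsto_upperbound) simp
      with ev show ?thesis by blast
    qed
    with d(1) show ?thesis by blast
  qed
  have "(\<lambda>k. iterate F (2 * k) p) \<longlonglongrightarrow> P"
  proof (rule tendstoI)
    fix e :: real assume "0 < e"
    then obtain d where d: "0 < d" "\<forall>q\<in>ball p d \<inter> basins. dist P (limit_even q) \<le> e / 3 \<and>
        (\<forall>\<^sub>F k in sequentially. dist (iterate F (2 * k) p) (limit_even q) \<le> e / 3)"
      using close[of "e / 3"] by auto
    obtain q where q: "q \<in> basins" "dist q p < d"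
      using p(2) d(1) unfolding closure_approachable by blast
    then have "q \<in> ball p d \<inter> basins" by (simp add: dist_commute)
    with d(2) have dP: "dist P (limit_even q) \<le> e / 3"
      and "\<forall>\<^sub>F k in sequentially. dist (iterate F (2 * k) p) (limit_even q) \<le> e / 3" by blast+
    from this(2) show "\<forall>\<^sub>F k in sequentially. dist (iterate F (2 * k) p) P < e"
    proof eventually_elim
      case (elim k)
      then show ?case
        using dP \<open>0 < e\<close> dist_triangle2[of "iterate F (2 * k) p" P "limit_even q"] by linarith
    qed
  qed
  moreover have seq: "(\<lambda>n. limit_even (q n)) \<longlonglongrightarrow> P" if q: "\<forall>n. q n \<in> basins" "q \<longlonglongrightarrow> p" for q
  proof (rule tendstoI)
    fix e :: real assume "0 < e"
    then obtain d where d: "0 < d" "\<forall>q\<in>ball p d \<inter> basins. dist P (limit_even q) \<le> e / 2"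
      using close[of "e / 2"] by auto
    from tendstoD[OF q(2) d(1)] show "\<forall>\<^sub>F n in sequentially. dist (limit_even (q n)) P < e"
    proof eventually_elim
      case (elim n)
      then have "q n \<in> ball p d \<inter> basins" using q(1) by (simp add: dist_commute)
      then have "dist P (limit_even (q n)) \<le> e / 2" using d(2) by blast
      then show ?case using \<open>0 < e\<close> by (simp add: dist_commute)
    qed
  qed
  moreover have "P \<in> line_at_infinity"
  proof -
    obtain q where q: "\<forall>n. q n \<in> basins" "q \<longlonglongrightarrow> p" using p(2) unfolding closure_sequential by blast
    have "closed line_at_infinity" unfolding line_at_infinity_eq by (simp add: open_chart_domain closed_Compl)
    moreover have "limit_even (q n) \<in> line_at_infinity" for n
      using q(1) limit_in_line_at_infinity by blast
    ultimately show ?thesis by (rule closed_sequentially[OF _ _ seq[OF q]])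
  qed
  ultimately show ?thesis by blast
qed

lemma F_continuous: "continuous_on U F"
  using iterate_continuous[of U 1] by simp

lemma F_closure:
  assumes "a \<in> {1, -1}" "b \<in> {1, -1}" "p \<in> closure (basin a b)"
  shows "F p \<in> closure (basin (- b) a)"
proof -
  have "F ` closure (basin a b) \<subseteq> closure (basin (- b) a)"
    using F_basin[OF assms(1,2)] closure_subset
    by (intro image_closure_subset[OF F_continuous closed_closure]) simp
  with assms(3) show ?thesis by blast
qed

text \<open>Normality of the iterates \<open>F^(n+1)\<close> near \<open>p\<close> is normality of
  \<open>F^n\<close> near \<open>F p\<close>, seen through the continuous inverse of
  \<open>F\<close>.\<close>

lemma F_fatou:
  assumes "p \<in> fatou_set F"
  shows "F p \<in> fatou_set F"
proof -
  obtain U where U: "open U" "p \<in> U" "normal_family (range (iterate F)) U"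
    using assms unfolding fatou_set_def by blast
  define G where "G = inv_into UNIV F"
  have G: "F (G x) = x" "G (F x) = x" for x
    using F_bij by (simp_all add: G_def f_inv_into_f bij_is_surj inv_into_f_f bij_is_inj)
  have contG: "continuous_on A G" for A
    using F_biholomorphism holomorphic_map_continuous_on continuous_on_subset subset_UNIV
    unfolding biholomorphism_def G_def by blast
  have "normal_family (range (iterate F)) (G -` U)"
    unfolding normal_family_def
  proof (intro allI impI)
    fix f :: "nat \<Rightarrow> complex^2 \<Rightarrow> cp2" assume "range f \<subseteq> range (iterate F)"
    then have "\<forall>j. \<exists>n. f j = iterate F n" by blast
    then obtain n where n: "\<And>j. f j = iterate F (n j)" by metis
    have "range (\<lambda>j. iterate F (Suc (n j))) \<subseteq> range (iterate F)" by blast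
    then obtain r h where r: "strict_mono r" "converges_on_compacts ((\<lambda>j. iterate F (Suc (n j))) \<circ> r) h U"
      using U(3) unfolding normal_family_def by blast
    have "converges_on_compacts (f \<circ> r) (\<lambda>x. h (G x)) (G -` U)"
      unfolding converges_on_compacts_def
    proof (intro allI impI)
      fix K assume K: "compact K \<and> K \<subseteq> G -` U"
      have "compact (G ` K)" using K contG compact_continuous_image by blast
      moreover have "G ` K \<subseteq> U" using K by blast
      ultimately have "uniform_limit (G ` K) ((\<lambda>j. iterate F (Suc (n j))) \<circ> r) h sequentially"
        using r(2) unfolding converges_on_compacts_def by blast
      then have "uniform_limit K (\<lambda>k x. ((\<lambda>j. iterate F (Suc (n j))) \<circ> r) k (G x)) (\<lambda>x. h (G x)) sequentially"
        by (rule uniform_limit_compose') auto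
      moreover have "(\<lambda>k x. ((\<lambda>j. iterate F (Suc (n j))) \<circ> r) k (G x)) = f \<circ> r"
        by (simp add: fun_eq_iff iterate_Suc G n)
      ultimately show "uniform_limit K (f \<circ> r) (\<lambda>x. h (G x)) sequentially" by simp
    qed
    with r(1) show "\<exists>r h. strict_mono r \<and> converges_on_compacts (f \<circ> r) h (G -` U)" by blast
  qed
  moreover have "open (G -` U)" by (rule open_vimage[OF U(1) contG])
  moreover have "F p \<in> G -` U" using U(2) G by simp
  ultimately show ?thesis unfolding fatou_set_def by blast
qed

lemma F_closure_basins: "p \<in> closure basins \<Longrightarrow> F p \<in> closure basins"
proof -
  have "F ` closure basins \<subseteq> closure basins"
    using F_mem_basins closure_subset
    by (intro image_closure_subset[OF F_continuous closed_closure]) blast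
  then show "p \<in> closure basins \<Longrightarrow> F p \<in> closure basins" by blast
qed

text \<open>At basin points the ratios of \<open>q\<close> and \<open>F q\<close> are related by
  \<open>\<zeta> \<mapsto> -\<delta> / \<zeta>\<close>. This relation passes to the limit along
  basin points tending to \<open>p\<close>, since by \<open>boundary_limit\<close> the limits at
  \<open>p\<close> and \<open>F p\<close> are those of the values at these points.\<close>

lemma boundary_limits:
  assumes p: "p \<in> fatou_set F" "p \<in> closure basins"
  shows "(\<exists>\<rho>. \<rho> \<noteq> 0 \<and> (\<lambda>k. iterate F (2 * k) p) \<longlonglongrightarrow> point_at_infinity \<rho> \<and>
      (\<lambda>k. iterate F (2 * k) (F p)) \<longlonglongrightarrow> point_at_infinity (- of_real \<delta> / \<rho>)) \<or>
    (\<lambda>k. iterate F (2 * k) p) \<longlonglongrightarrow> point_at_infinity 0 \<or>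
    (\<lambda>k. iterate F (2 * k) p) \<longlonglongrightarrow> abs_cp2 (vector [1, 0, 0]) \<and>
      (\<lambda>k. iterate F (2 * k) (F p)) \<longlonglongrightarrow> point_at_infinity 0"
proof -
  obtain P where P: "P \<in> line_at_infinity" "(\<lambda>k. iterate F (2 * k) p) \<longlonglongrightarrow> P"
    "\<forall>q. (\<forall>n. q n \<in> basins) \<longrightarrow> q \<longlonglongrightarrow> p \<longrightarrow> (\<lambda>n. limit_even (q n)) \<longlonglongrightarrow> P"
    using boundary_limit[OF p] by blast
  obtain Q where Q: "(\<lambda>k. iterate F (2 * k) (F p)) \<longlonglongrightarrow> Q"
    "\<forall>q. (\<forall>n. q n \<in> basins) \<longrightarrow> q \<longlonglongrightarrow> F p \<longrightarrow> (\<lambda>n. limit_even (q n)) \<longlonglongrightarrow> Q"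
    using boundary_limit[OF F_fatou[OF p(1)] F_closure_basins[OF p(2)]] by blast
  obtain q where q: "\<forall>n. q n \<in> basins" "q \<longlonglongrightarrow> p" using p(2) unfolding closure_sequential by blast
  have "(\<lambda>n. limit_even (q n)) \<longlonglongrightarrow> P" using P(3) q by blast
  then have qP: "(\<lambda>n. point_at_infinity (ratio (q n))) \<longlonglongrightarrow> P" using q(1) by (simp add: limit_even_eq)
  have "(\<lambda>n. F (q n)) \<longlonglongrightarrow> F p"
    by (rule continuous_on_tendsto_compose[OF F_continuous[of UNIV] q(2)]) auto
  moreover have "\<forall>n. F (q n) \<in> basins" using q(1) F_mem_basins by blast
  ultimately have "(\<lambda>n. limit_odd (q n)) \<longlonglongrightarrow> Q"
    using Q(2)[rule_format, of "\<lambda>n. F (q n)"] unfolding limit_odd_def by blast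
  then have qQ: "(\<lambda>n. point_at_infinity (- of_real \<delta> / ratio (q n))) \<longlonglongrightarrow> Q"
    using q(1) by (simp add: limit_odd_eq)
  from line_at_infinity_cases[OF P(1)] show ?thesis
  proof
    assume "\<exists>\<rho>. P = point_at_infinity \<rho>"
    then obtain \<rho> where \<rho>: "P = point_at_infinity \<rho>" by blast
    show ?thesis
    proof (cases "\<rho> = 0")
      case True
      with P(2) \<rho> show ?thesis by blast
    next
      case False
      have "P \<in> chart_domain 2" by (simp add: \<rho> chart_point_at_infinity)
      from tendsto_chart(1)[OF qP this, of 1]
      have "(\<lambda>n. ratio (q n)) \<longlonglongrightarrow> \<rho>" by (simp add: \<rho> chart_point_at_infinity)
      then have "(\<lambda>n. - of_real \<delta> / ratio (q n)) \<longlonglongrightarrow> - of_real \<delta> / \<rho>"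
        using False by (intro tendsto_divide tendsto_const)
      from LIMSEQ_unique[OF qQ tendsto_point_at_infinity[OF this]]
      have "Q = point_at_infinity (- of_real \<delta> / \<rho>)" .
      with False P(2) Q(1) \<rho> show ?thesis by blast
    qed
  next
    assume P1: "P = abs_cp2 (vector [1, 0, 0])"
    have "P \<in> chart_domain 1" by (simp only: P1 chart_infinity)
    from tendsto_chart(1)[OF qP this, of 2]
    have "(\<lambda>n. 1 / ratio (q n)) \<longlonglongrightarrow> 0" by (simp only: P1 chart_infinity chart_point_at_infinity)
    from tendsto_mult[OF tendsto_const[of "- of_real \<delta>"] this]
    have "(\<lambda>n. - of_real \<delta> / ratio (q n)) \<longlonglongrightarrow> 0" by simp
    from LIMSEQ_unique[OF qQ tendsto_point_at_infinity[OF this]]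
    have "Q = point_at_infinity 0" .
    with Q(1) P(2) P1 show ?thesis by blast
  qed
qed

text \<open>The first coordinate is \<open>(-\<delta>)^k w k\<close> with \<open>w k\<close> tending
  to the first coordinate of \<open>phi\<close>, whose square has positive real part. The square of
  the scalar is positive, so the argument of the squared coordinate converges.\<close>

lemma basin_growth:
  assumes q: "q \<in> basins"
  shows "\<exists>c>0. (\<forall>\<^sub>F k in sequentially. c * (norm ((F ^^ (2 * k)) q $ 1))\<^sup>2 \<le> Re (((F ^^ (2 * k)) q $ 1)\<^sup>2))"
    and "filterlim (\<lambda>k. norm ((F ^^ (2 * k)) q $ 1)) at_top sequentially"
proof -
  obtain a b where ab: "a \<in> {1, -1}" "b \<in> {1, -1}" "q \<in> basin a b" by (rule basins_cases[OF q])
  define w where "w = (\<lambda>k. phi_approx k q $ 1)"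
  define w0 where "w0 = phi q $ 1"
  have "0 < depth a w0" using phi_basin_subset[OF ab] by (simp add: sector_def w0_def)
  then have pos: "0 < Re (w0\<^sup>2)" by (simp only: depth_pos_iff[OF ab(1)])
  then have nz: "0 < norm w0" by auto
  have lim: "w \<longlonglongrightarrow> w0" unfolding w_def w0_def by (rule tendsto_vec_nth[OF phi_limit[OF q]])
  have eq: "(F ^^ (2 * k)) q $ 1 = (- of_real \<delta>) ^ k * w k" for k
    using delta by (simp add: w_def phi_approx_def)
  \<comment> \<open>Half of the cosine of the limiting argument of the square; the half leaves a
    strict inequality in the limit.\<close>
  define c where "c = Re (w0\<^sup>2) / (2 * (norm w0)\<^sup>2)"
  have c: "0 < c" using pos nz by (simp add: c_def)
  have "(\<lambda>k. Re ((w k)\<^sup>2) - c * (norm (w k))\<^sup>2) \<longlonglongrightarrow> Re (w0\<^sup>2) - c * (norm w0)\<^sup>2"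
    by (intro tendsto_intros lim)
  moreover have "0 < Re (w0\<^sup>2) - c * (norm w0)\<^sup>2" using pos nz by (simp add: c_def)
  ultimately have "\<forall>\<^sub>F k in sequentially. 0 < Re ((w k)\<^sup>2) - c * (norm (w k))\<^sup>2"
    by (rule order_tendstoD(1))
  then have "\<forall>\<^sub>F k in sequentially. c * (norm ((F ^^ (2 * k)) q $ 1))\<^sup>2 \<le> Re (((F ^^ (2 * k)) q $ 1)\<^sup>2)"
  proof eventually_elim
    case (elim k)
    have s: "((- of_real \<delta>) ^ k * w k)\<^sup>2 = of_real ((\<delta>\<^sup>2) ^ k) * (w k)\<^sup>2"
      by (simp add: power_mult_distrib power_mult[symmetric] mult.commute[of k 2])
    then have r: "Re (((F ^^ (2 * k)) q $ 1)\<^sup>2) = (\<delta>\<^sup>2) ^ k * Re ((w k)\<^sup>2)"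
      unfolding eq s by (simp del: of_real_power)
    have n: "(norm ((F ^^ (2 * k)) q $ 1))\<^sup>2 = (\<delta>\<^sup>2) ^ k * (norm (w k))\<^sup>2"
      unfolding eq using delta
      by (simp add: norm_mult norm_power power_mult_distrib power_mult[symmetric] mult.commute[of k 2])
    have "(\<delta>\<^sup>2) ^ k * (c * (norm (w k))\<^sup>2) \<le> (\<delta>\<^sup>2) ^ k * Re ((w k)\<^sup>2)"
      using elim by (intro mult_left_mono) auto
    then show ?case unfolding r n by (simp only: mult.left_commute)
  qed
  with c show "\<exists>c>0. (\<forall>\<^sub>F k in sequentially. c * (norm ((F ^^ (2 * k)) q $ 1))\<^sup>2 \<le> Re (((F ^^ (2 * k)) q $ 1)\<^sup>2))"
    by blast
  have "filterlim (\<lambda>k. norm (w k) * \<delta> ^ k) at_top sequentially"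
    using delta
    by (intro filterlim_tendsto_pos_mult_at_top[OF tendsto_norm[OF lim] nz]) real_asymp
  then show "filterlim (\<lambda>k. norm ((F ^^ (2 * k)) q $ 1)) at_top sequentially"
    unfolding eq using delta by (simp add: norm_mult norm_power mult.commute)
qed

text \<open>The complex line through \<open>p\<close> and \<open>q\<close> is parametrized so that
  \<open>q\<close> sits at \<open>1/5\<close> while the whole unit disc stays inside the ball, as
  the Harnack estimate at \<open>1/5\<close> requires.\<close>

lemma slice_in_ball:
  fixes p q :: "complex^2"
  assumes "dist q p < d / 5" "t \<in> ball 0 1"
  shows "p + t *s (5 *s (q - p)) \<in> ball p d"
proof -
  have "norm t * norm (q - p) \<le> 1 * norm (q - p)" using assms(2) by (intro mult_right_mono) auto
  moreover have "dist p (p + t *s (5 *s (q - p))) = norm t * (5 * norm (q - p))"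
    unfolding dist_norm by (simp add: norm_scale_complex del: vector_ssub_ldistrib)
  ultimately show ?thesis using assms(1) by (simp add: dist_norm)
qed

lemma slice_at_fifth: "p + (1 / 5) *s (5 *s (q - p)) = (q :: complex^2)"
  by (simp add: vec_eq_iff)

text \<open>Near \<open>p\<close> the function \<open>exp (- z\<^sub>n\<^sup>2) / z\<^sub>n = (z\<^sub>n\<^sub>+\<^sub>1 + \<delta> z\<^sub>n\<^sub>-\<^sub>1) / z\<^sub>n\<close> is bounded, where
  \<open>z\<^sub>n\<close> is the first coordinate of the \<open>n\<close>-th iterate. The Harnack inequality for its
  logarithm and for \<open>ln \<bar>z\<^sub>n\<bar>\<close> on the complex line through \<open>p\<close> and \<open>q\<close> has the constant
  \<open>(1 + 1/5) / (1 - 1/5) = 3/2\<close>; any exponent below \<open>2\<close> in the first estimate would do, since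
  \<open>Re (z\<^sub>n\<^sup>2)\<close> grows like \<open>\<bar>z\<^sub>n\<bar>\<^sup>2\<close> at \<open>q\<close>.\<close>

lemma boundary_harnack:
  assumes bounds: "\<And>n y. n \<ge> N \<Longrightarrow> y \<in> ball p d \<Longrightarrow> 1 < norm ((F ^^ n) y $ 1) \<and>
      norm ((F ^^ n) y $ 1) \<le> C * norm ((F ^^ n) y $ 2) \<and> norm ((F ^^ n) y $ 2) \<le> C * norm ((F ^^ n) y $ 1)"
    and q: "dist q p < d / 5" and n: "n \<ge> N"
  shows "norm ((F ^^ n) p $ 1) \<le> exp (3 / 2 * ln (norm ((F ^^ n) q $ 1)))"
    and "2 / 3 * Re (((F ^^ n) q $ 1)\<^sup>2) - 3 / 2 * ln (norm ((F ^^ n) q $ 1)) - ln (C + \<delta> * C + 1)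
      \<le> Re (((F ^^ n) p $ 1)\<^sup>2)"
proof -
  define s where "s = (\<lambda>t. p + t *s (5 *s (q - p)))"
  define X where "X = (\<lambda>t. (F ^^ n) (s t) $ 1)"
  have s: "s t \<in> ball p d" if "t \<in> ball 0 1" for t
    unfolding s_def by (rule slice_in_ball[OF q that])
  have s0: "s 0 = p" "s (1 / 5) = q" by (simp_all add: s_def slice_at_fifth)
  have holX: "X holomorphic_on ball 0 1"
    unfolding X_def s_def by (rule holomorphic_on_slice[OF iterate_holomorphic[of n UNIV]]) simp
  have X1: "1 < norm (X t)" if "t \<in> ball 0 1" for t
    using bounds[OF n s[OF that]] by (simp add: X_def)
  then have Xnz: "X t \<noteq> 0" if "t \<in> ball 0 1" for t using that by fastforce
  \<comment> \<open>The summand \<open>1\<close> makes the bound on the modulus of \<open>g\<close>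
    strict, and makes \<open>ln M\<close> positive so that its share can be discarded at the
    end.\<close>
  define M where "M = C + \<delta> * C + 1"
  have expX: "norm (exp (- (X t)\<^sup>2)) \<le> (C + \<delta> * C) * norm (X t)" if "t \<in> ball 0 1" for t
  proof -
    let ?x = "(F ^^ n) (s t)"
    have "exp (- (X t)\<^sup>2) = F ?x $ 1 + of_real \<delta> * ?x $ 2" by (simp add: F_1 X_def)
    then have "norm (exp (- (X t)\<^sup>2)) \<le> norm (F ?x $ 1) + norm (of_real \<delta> * ?x $ 2)"
      using norm_triangle_ineq by metis
    moreover have "norm (F ?x $ 1) \<le> C * norm (X t)"
      using bounds[of "Suc n" "s t"] n s[OF that] by (simp add: F_2 X_def)
    moreover have "norm (of_real \<delta> * ?x $ 2) \<le> \<delta> * (C * norm (X t))"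
      using bounds[OF n s[OF that]] delta by (simp add: norm_mult X_def mult_left_mono)
    ultimately show ?thesis by (simp add: algebra_simps)
  qed
  have "0 < (C + \<delta> * C) * norm (X 0)" using expX[of 0] by (intro less_le_trans[OF _ expX[of 0]]) auto
  then have "0 < C + \<delta> * C" using X1[of 0] by (simp add: zero_less_mult_iff)
  then have M: "1 < M" by (simp add: M_def)
  define f where "f = (\<lambda>t. inverse (X t))"
  have "ln (norm (f (1 / 5))) \<le> 2 / 3 * ln (norm (f 0))"
  proof (rule harnack_ln_norm(2))
    show "f holomorphic_on ball 0 1" unfolding f_def by (intro holomorphic_intros holX Xnz)
    show "f t \<noteq> 0" if "t \<in> ball 0 1" for t using Xnz[OF that] by (simp add: f_def)
    show "norm (f t) < 1" if "t \<in> ball 0 1" for t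
      using X1[OF that] by (simp add: f_def norm_inverse inverse_less_1_iff)
  qed
  then have ln_le: "ln (norm (X 0)) \<le> 3 / 2 * ln (norm (X (1 / 5)))"
    using Xnz[of 0] Xnz[of "1 / 5"] by (simp add: f_def norm_inverse ln_inverse)
  have "norm (X 0) = exp (ln (norm (X 0)))" using Xnz[of 0] by simp
  also have "\<dots> \<le> exp (3 / 2 * ln (norm (X (1 / 5))))" using ln_le by simp
  finally show "norm ((F ^^ n) p $ 1) \<le> exp (3 / 2 * ln (norm ((F ^^ n) q $ 1)))"
    by (simp only: X_def s0)
  define g where "g = (\<lambda>t. exp (- (X t)\<^sup>2) / (X t * of_real M))"
  have "ln (norm (g 0)) \<le> 2 / 3 * ln (norm (g (1 / 5)))"
  proof (rule harnack_ln_norm(1))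
    show "g holomorphic_on ball 0 1"
      unfolding g_def using M Xnz by (intro holomorphic_intros holX) auto
    show "g t \<noteq> 0" if "t \<in> ball 0 1" for t using Xnz[OF that] M by (simp add: g_def)
    show "norm (g t) < 1" if "t \<in> ball 0 1" for t
    proof -
      have "norm (exp (- (X t)\<^sup>2)) < norm (X t) * M"
        using expX[OF that] X1[OF that] by (simp add: M_def algebra_simps)
      moreover have "0 < norm (X t) * M" using X1[OF that] M by (intro mult_pos_pos) auto
      ultimately show ?thesis using M by (simp add: g_def norm_divide norm_mult divide_less_eq)
    qed
  qed
  moreover have "ln (norm (g t)) = - Re ((X t)\<^sup>2) - ln (norm (X t)) - ln M" if "t \<in> ball 0 1" for t
    using Xnz[OF that] M by (simp add: g_def norm_divide norm_mult ln_div ln_mult)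
  ultimately have "- Re ((X 0)\<^sup>2) - ln (norm (X 0)) - ln M
      \<le> 2 / 3 * (- Re ((X (1 / 5))\<^sup>2) - ln (norm (X (1 / 5))) - ln M)" by simp
  moreover have "0 < ln M" using M by simp
  moreover have "0 < ln (norm (X (1 / 5)))" by (rule ln_gt_zero, rule X1) simp
  ultimately have "2 / 3 * Re ((X (1 / 5))\<^sup>2) - 3 / 2 * ln (norm (X (1 / 5))) - ln M \<le> Re ((X 0)\<^sup>2)"
    using ln_le by argo
  then show "2 / 3 * Re (((F ^^ n) q $ 1)\<^sup>2) - 3 / 2 * ln (norm ((F ^^ n) q $ 1)) - ln (C + \<delta> * C + 1)
      \<le> Re (((F ^^ n) p $ 1)\<^sup>2)" by (simp only: X_def s0 M_def)
qed

text \<open>Stated for a general sequence of times \<open>m\<close>, since it is applied to the even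
  and to the odd iterates. The lower bound on \<open>Re (z^2)\<close> at \<open>p\<close> is of
  order \<open>Y^2\<close>, while \<open>norm z\<close> at \<open>p\<close> is at most
  \<open>Y^(3/2)\<close>.\<close>

lemma boundary_depth:
  assumes bounds: "\<And>n y. n \<ge> N \<Longrightarrow> y \<in> ball p d \<Longrightarrow> 1 < norm ((F ^^ n) y $ 1) \<and>
      norm ((F ^^ n) y $ 1) \<le> C * norm ((F ^^ n) y $ 2) \<and> norm ((F ^^ n) y $ 2) \<le> C * norm ((F ^^ n) y $ 1)"
    and q: "dist q p < d / 5" and m: "\<And>k. k \<le> m k"
    and c: "0 < c" "\<forall>\<^sub>F k in sequentially. c * (norm ((F ^^ m k) q $ 1))\<^sup>2 \<le> Re (((F ^^ m k) q $ 1)\<^sup>2)"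
    and lim: "filterlim (\<lambda>k. norm ((F ^^ m k) q $ 1)) at_top sequentially"
  shows "\<forall>\<^sub>F k in sequentially. 2 < \<bar>Re ((F ^^ m k) p $ 1)\<bar> - \<bar>Im ((F ^^ m k) p $ 1)\<bar>"
proof -
  define L where "L = ln (C + \<delta> * C + 1)"
  define Y where "Y = (\<lambda>k. norm ((F ^^ m k) q $ 1))"
  have "\<forall>\<^sub>F k in sequentially. 4 * exp (3 / 2 * ln (Y k)) < 2 / 3 * (c * (Y k)\<^sup>2) - 3 / 2 * ln (Y k) - L"
    using eventually_compose_filterlim[OF growth_comparison[OF c(1)] lim] by (simp only: Y_def)
  moreover have "\<forall>\<^sub>F k in sequentially. c * (Y k)\<^sup>2 \<le> Re (((F ^^ m k) q $ 1)\<^sup>2)"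
    using c(2) by (simp only: Y_def)
  moreover have "\<forall>\<^sub>F k in sequentially. N \<le> k" by (rule eventually_ge_at_top)
  ultimately show ?thesis
  proof eventually_elim
    case (elim k)
    have n: "N \<le> m k" using elim(3) m[of k] by simp
    have "norm ((F ^^ m k) p $ 1) \<le> exp (3 / 2 * ln (Y k))"
      unfolding Y_def by (rule boundary_harnack(1)[OF bounds q n])
    moreover have "2 / 3 * Re (((F ^^ m k) q $ 1)\<^sup>2) - 3 / 2 * ln (Y k) - L \<le> Re (((F ^^ m k) p $ 1)\<^sup>2)"
      unfolding Y_def L_def by (rule boundary_harnack(2)[OF bounds q n])
    ultimately have "4 * norm ((F ^^ m k) p $ 1) < Re (((F ^^ m k) p $ 1)\<^sup>2)"
      using elim(1,2) by linarith
    then show ?case by (rule depth_bound)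
  qed
qed

text \<open>A sector constrains two consecutive terms of the orbit, so the depth estimate is needed
  for both parities. The limits at \<open>p\<close> and at \<open>F p\<close> supply the two-sided
  bounds for even and odd times respectively.\<close>

lemma boundary_nonzero_ratio:
  assumes ab: "a \<in> {1, -1}" "b \<in> {1, -1}" and p: "p \<in> fatou_set F" "p \<in> closure (basin a b)"
    and \<rho>: "\<rho> \<noteq> 0" "(\<lambda>k. iterate F (2 * k) p) \<longlonglongrightarrow> point_at_infinity \<rho>"
      "(\<lambda>k. iterate F (2 * k) (F p)) \<longlonglongrightarrow> point_at_infinity (- of_real \<delta> / \<rho>)"
  shows "p \<in> basin a b"
proof -
  obtain V1 C1 where V1: "open V1" "point_at_infinity \<rho> \<in> V1" "\<forall>x. affine_point x \<in> V1 \<longrightarrow>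
      1 < norm (x $ 1) \<and> norm (x $ 1) \<le> C1 * norm (x $ 2) \<and> norm (x $ 2) \<le> C1 * norm (x $ 1)"
    using nonzero_ratio_neighbourhood[OF \<rho>(1)] by blast
  have "- of_real \<delta> / \<rho> \<noteq> 0" using \<rho>(1) delta by simp
  from nonzero_ratio_neighbourhood[OF this]
  obtain V2 C2 where V2: "open V2" "point_at_infinity (- of_real \<delta> / \<rho>) \<in> V2"
    "\<forall>x. affine_point x \<in> V2 \<longrightarrow>
      1 < norm (x $ 1) \<and> norm (x $ 1) \<le> C2 * norm (x $ 2) \<and> norm (x $ 2) \<le> C2 * norm (x $ 1)"
    by blast
  obtain d1 N1 where d1: "0 < d1" "\<forall>k\<ge>N1. \<forall>y\<in>ball p d1. iterate F (2 * k) y \<in> V1"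
    using fatou_neighbourhood[OF p(1) \<rho>(2) V1(1,2)] by blast
  have "(\<lambda>k. iterate F (Suc (2 * k)) p) \<longlonglongrightarrow> point_at_infinity (- of_real \<delta> / \<rho>)"
    using \<rho>(3) by (simp only: iterate_Suc)
  from fatou_neighbourhood[OF p(1) this V2(1,2)]
  obtain d2 N2 where d2: "0 < d2" "\<forall>k\<ge>N2. \<forall>y\<in>ball p d2. iterate F (Suc (2 * k)) y \<in> V2" by blast
  \<comment> \<open>With the threshold \<open>2 M + 1\<close>, where \<open>M = max N1 N2\<close>,
    the half of an index of either parity is at least \<open>M\<close>.\<close>
  define d C N where "d = min d1 d2" and "C = max C1 C2" and "N = Suc (2 * max N1 N2)"
  have bounds: "1 < norm ((F ^^ n) y $ 1) \<and> norm ((F ^^ n) y $ 1) \<le> C * norm ((F ^^ n) y $ 2) \<and>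
      norm ((F ^^ n) y $ 2) \<le> C * norm ((F ^^ n) y $ 1)" if n: "n \<ge> N" and y: "y \<in> ball p d" for n y
  proof -
    let ?x = "(F ^^ n) y"
    have mono: "C1 * norm u \<le> C * norm u" "C2 * norm u \<le> C * norm u" for u :: complex
      by (simp_all add: C_def mult_right_mono)
    have "affine_point ?x \<in> V1 \<or> affine_point ?x \<in> V2"
    proof (cases "even n")
      case True
      then obtain k where k: "n = 2 * k" by (rule evenE)
      have "k \<ge> N1" "y \<in> ball p d1" using n y by (simp_all add: k N_def d_def)
      then show ?thesis using d1(2) by (simp add: k iterate_def)
    next
      case False
      then obtain k where k: "n = Suc (2 * k)" using oddE by fastforce
      have "k \<ge> N2" "y \<in> ball p d2" using n y by (simp_all add: k N_def d_def)
      then have "iterate F (Suc (2 * k)) y \<in> V2" using d2(2) by blast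
      then show ?thesis unfolding k iterate_def by blast
    qed
    then show ?thesis
    proof
      assume "affine_point ?x \<in> V1"
      then show ?thesis using V1(3) mono(1) order_trans by blast
    next
      assume "affine_point ?x \<in> V2"
      then show ?thesis using V2(3) mono(2) order_trans by blast
    qed
  qed
  have "0 < d / 5" using d1(1) d2(1) by (simp add: d_def)
  then obtain q where q: "q \<in> basin a b" "dist q p < d / 5"
    using p(2) unfolding closure_approachable by blast
  have qb: "q \<in> basins" using q(1) basin_subset[OF ab] by blast
  obtain c where c: "0 < c" "\<forall>\<^sub>F k in sequentially.
      c * (norm ((F ^^ (2 * k)) q $ 1))\<^sup>2 \<le> Re (((F ^^ (2 * k)) q $ 1)\<^sup>2)"
    using basin_growth(1)[OF qb] by blast
  have even: "\<forall>\<^sub>F k in sequentially. 2 < \<bar>Re ((F ^^ (2 * k)) p $ 1)\<bar> - \<bar>Im ((F ^^ (2 * k)) p $ 1)\<bar>"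
    by (rule boundary_depth[OF bounds q(2) _ c basin_growth(2)[OF qb]]) simp_all
  have FF: "(F ^^ (2 * k)) (F q) = (F ^^ Suc (2 * k)) q" for k
    by (simp only: funpow_Suc_right o_apply)
  obtain c' where c': "0 < c'" "\<forall>\<^sub>F k in sequentially.
      c' * (norm ((F ^^ Suc (2 * k)) q $ 1))\<^sup>2 \<le> Re (((F ^^ Suc (2 * k)) q $ 1)\<^sup>2)"
    using basin_growth(1)[OF F_mem_basins[OF qb]] unfolding FF by blast
  have odd: "\<forall>\<^sub>F k in sequentially.
      2 < \<bar>Re ((F ^^ Suc (2 * k)) p $ 1)\<bar> - \<bar>Im ((F ^^ Suc (2 * k)) p $ 1)\<bar>"
    by (rule boundary_depth[OF bounds q(2) _ c' basin_growth(2)[OF F_mem_basins[OF qb], unfolded FF]])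
      simp_all
  obtain K1 where K1: "\<forall>k\<ge>K1. 2 < \<bar>Re ((F ^^ (2 * k)) p $ 1)\<bar> - \<bar>Im ((F ^^ (2 * k)) p $ 1)\<bar>"
    using even unfolding eventually_sequentially by blast
  obtain K2 where K2: "\<forall>k\<ge>K2. 2 < \<bar>Re ((F ^^ Suc (2 * k)) p $ 1)\<bar> - \<bar>Im ((F ^^ Suc (2 * k)) p $ 1)\<bar>"
    using odd unfolding eventually_sequentially by blast
  \<comment> \<open>The successor ensures \<open>m > 0\<close>, so that \<open>4 * m - 1\<close> is
    the odd index \<open>2 * (2 * m - 1) + 1\<close> without truncation.\<close>
  define m where "m = Suc (max K1 K2)"
  define x where "x = (F ^^ (4 * m)) p"
  have "2 * m \<ge> K1" "2 * m - 1 \<ge> K2" by (simp_all add: m_def)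
  moreover have "2 * (2 * m) = 4 * m" "Suc (2 * (2 * m - 1)) = 4 * m - 1" by (simp_all add: m_def)
  ultimately have k1: "2 < \<bar>Re (x $ 1)\<bar> - \<bar>Im (x $ 1)\<bar>"
    and k2: "2 < \<bar>Re ((F ^^ (4 * m - 1)) p $ 1)\<bar> - \<bar>Im ((F ^^ (4 * m - 1)) p $ 1)\<bar>"
    using K1 K2 unfolding x_def by metis+
  have "4 * m = Suc (4 * m - 1)" by (simp add: m_def)
  then have "x = F ((F ^^ (4 * m - 1)) p)" unfolding x_def by (metis funpow.simps(2) o_apply)
  then have x2: "x $ 2 = (F ^^ (4 * m - 1)) p $ 1" by (simp only: F_2)
  have sign: "\<exists>s\<in>{1, -1}. depth s z = \<bar>Re z\<bar> - \<bar>Im z\<bar>" for z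
    by (cases "0 \<le> Re z") (auto simp: depth_def)
  obtain a' where a': "a' \<in> {1, -1}" "depth a' (x $ 1) = \<bar>Re (x $ 1)\<bar> - \<bar>Im (x $ 1)\<bar>"
    using sign by blast
  obtain b' where b': "b' \<in> {1, -1}" "depth b' (x $ 2) = \<bar>Re (x $ 2)\<bar> - \<bar>Im (x $ 2)\<bar>"
    using sign by blast
  have "x \<in> sector 2 a' b'" unfolding sector_def using a'(2) b'(2) k1 k2 x2 by simp
  then have p': "p \<in> basin a' b'" unfolding basin_def x_def by blast
  \<comment> \<open>The signs found at \<open>p\<close> could a priori differ from \<open>a\<close>
    and \<open>b\<close>; the open basin around \<open>p\<close> meets \<open>basin a b\<close>
    because \<open>p\<close> lies in its closure, and distinct basins are disjoint.\<close>
  with p(2) obtain y where "y \<in> basin a' b'" "y \<in> basin a b"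
    using open_Int_closure_eq_empty[OF open_basin[of a' b'], of "basin a b"] by blast
  from basin_disjoint[OF a'(1) b'(1) ab this] p' show ?thesis by simp
qed


lemma ratio_tendsto:
  assumes "(\<lambda>k. iterate F (2 * k) y) \<longlonglongrightarrow> point_at_infinity \<zeta>"
  shows "(\<lambda>k. (F ^^ (2 * k)) y $ 1 / (F ^^ (2 * k)) y $ 2) \<longlonglongrightarrow> \<zeta>"
  using tendsto_chart(1)[OF assms chart_point_at_infinity(1), of 1]
  by (simp only: iterate_def chart_affine_point chart_point_at_infinity)

text \<open>A limit of the ratios \<open>z/w\<close> on a disc through the boundary point has real part of
  constant sign off its discrete zero set, so by the open mapping theorem it has no zero.\<close>

lemma boundary_zero_ratio:
  assumes ab: "a \<in> {1, -1}" "b \<in> {1, -1}" and p: "p \<in> fatou_set F" "p \<in> closure (basin a b)"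
    and lim0: "(\<lambda>k. iterate F (2 * k) p) \<longlonglongrightarrow> point_at_infinity 0"
  shows False
proof -
  obtain V where V: "open V" "point_at_infinity 0 \<in> V"
    "\<And>x. affine_point x \<in> V \<Longrightarrow> x $ 2 \<noteq> 0 \<and> norm (x $ 1) < norm (x $ 2)"
    by (rule small_ratio_neighbourhood) blast
  obtain d N where d: "0 < d" "ball p d \<subseteq> fatou_set F" "\<forall>k\<ge>N. \<forall>y\<in>ball p d. iterate F (2 * k) y \<in> V"
    using fatou_neighbourhood[OF p(1) lim0 V(1,2)] by blast
  have small: "(F ^^ (2 * k)) y $ 2 \<noteq> 0 \<and> norm ((F ^^ (2 * k)) y $ 1) < norm ((F ^^ (2 * k)) y $ 2)"
    if "k \<ge> N" "y \<in> ball p d" for k y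
  proof -
    have "iterate F (2 * k) y \<in> V" using d(3) that by blast
    then show ?thesis unfolding iterate_def by (rule V(3))
  qed
  have "0 < d / 5" using d(1) by simp
  then obtain q where q: "q \<in> basin a b" "dist q p < d / 5"
    using p(2) unfolding closure_approachable by blast
  define s where "s = (\<lambda>t :: complex. p + t *s (5 *s (q - p)))"
  have s: "s t \<in> ball p d" if "t \<in> ball 0 1" for t
    unfolding s_def by (rule slice_in_ball[OF q(2) that])
  have s0: "s 0 = p" "s (1 / 5) = q" by (simp_all add: s_def slice_at_fifth)
  have conts: "continuous_on A s" for A
    unfolding s_def
    by (intro continuous_on_add continuous_on_const linear_continuous_on bounded_linear_scale_vector)
  \<comment> \<open>The shift by \<open>N\<close> starts the sequence where the denominators are
    nonzero on the disc and the ratios have modulus below \<open>1\<close>.\<close>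
  define f where "f = (\<lambda>k t. (F ^^ (2 * (k + N))) (s t) $ 1 / (F ^^ (2 * (k + N))) (s t) $ 2)"
  have holf: "f k holomorphic_on ball 0 1" for k
    unfolding f_def s_def
    by (intro holomorphic_on_divide holomorphic_on_slice[OF iterate_holomorphic[of _ UNIV]] UNIV_I)
      (use small[of "k + N"] s in \<open>simp add: s_def\<close>)
  have boundf: "norm (f k t) \<le> 1" if "t \<in> ball 0 1" for k t
    using small[of "k + N", OF _ s[OF that]] by (simp add: f_def norm_divide divide_le_eq)
  define H where "H = {h. h holomorphic_on ball 0 1 \<and> (\<forall>t\<in>ball 0 1. norm (h t) \<le> (1::real))}"
  \<comment> \<open>The uniform bound \<open>1\<close> gives a holomorphic limit on the entire disc,
    including parameters for which the convergence of the full sequence of ratios has not been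
    established.\<close>
  have "\<exists>g r. g holomorphic_on ball 0 1 \<and> strict_mono (r :: nat \<Rightarrow> nat) \<and>
      (\<forall>t\<in>ball 0 1. (\<lambda>k. f (r k) t) \<longlonglongrightarrow> g t)"
  proof (rule Montel[of "ball 0 1" H f])
    show "h holomorphic_on ball 0 1" if "h \<in> H" for h using that unfolding H_def by blast
    show "\<exists>B. \<forall>h\<in>H. \<forall>z\<in>K. norm (h z) \<le> B" if "K \<subseteq> ball 0 1" for K
      using that unfolding H_def by (intro exI[of _ 1]) blast
    show "range f \<subseteq> H" unfolding H_def using holf boundf by blast
  qed blast+
  then obtain g r where g: "g holomorphic_on ball 0 1" "strict_mono (r :: nat \<Rightarrow> nat)"
    "\<And>t. t \<in> ball 0 1 \<Longrightarrow> (\<lambda>k. f (r k) t) \<longlonglongrightarrow> g t" by blast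
  have "strict_mono (\<lambda>k. r k + N)" using g(2) by (simp add: strict_mono_def)
  note sub = filterlim_subseq[OF this]
  have g_eq: "g t = \<zeta>" if "t \<in> ball 0 1" "(\<lambda>k. iterate F (2 * k) (s t)) \<longlonglongrightarrow> point_at_infinity \<zeta>" for t \<zeta>
  proof (rule LIMSEQ_unique[OF g(3)[OF that(1)]])
    show "(\<lambda>k. f (r k) t) \<longlonglongrightarrow> \<zeta>"
      unfolding f_def by (rule filterlim_compose[OF ratio_tendsto[OF that(2)] sub])
  qed
  have g_basin: "g t = ratio (s t)" if "t \<in> ball 0 1" "s t \<in> basin a b" for t
  proof -
    have "s t \<in> basins" using that(2) basin_subset[OF ab] by blast
    then show ?thesis
      using limit_even_tendsto[of "s t"] limit_even_eq[of "s t"] by (intro g_eq[OF that(1)]) simp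
  qed
  have g0: "g 0 = 0" using lim0 by (intro g_eq) (simp_all add: s0)
  \<comment> \<open>A pole of the limiting ratio is impossible on this disc, since there
    \<open>\<bar>z\<bar> < \<bar>w\<bar>\<close> at all late even times; a zero is excluded by
    \<open>g t \<noteq> 0\<close>.\<close>
  have in_basin: "s t \<in> basin a b" if t: "t \<in> ball 0 1" "s t \<in> closure (basin a b)" "g t \<noteq> 0" for t
  proof -
    have y: "s t \<in> fatou_set F" using d(2) s[OF t(1)] by blast
    have "s t \<in> closure basins" using t(2) closure_mono[OF basin_subset[OF ab]] by blast
    from boundary_limits[OF y this] show ?thesis
    proof (elim disjE exE conjE)
      fix \<rho>
      assume "\<rho> \<noteq> 0" "(\<lambda>k. iterate F (2 * k) (s t)) \<longlonglongrightarrow> point_at_infinity \<rho>"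
        "(\<lambda>k. iterate F (2 * k) (F (s t))) \<longlonglongrightarrow> point_at_infinity (- of_real \<delta> / \<rho>)"
      then show ?thesis by (rule boundary_nonzero_ratio[OF ab y t(2)])
    next
      assume "(\<lambda>k. iterate F (2 * k) (s t)) \<longlonglongrightarrow> point_at_infinity 0"
      then show ?thesis using g_eq[OF t(1)] t(3) by blast
    next
      assume inf: "(\<lambda>k. iterate F (2 * k) (s t)) \<longlonglongrightarrow> abs_cp2 (vector [1, 0, 0])"
      have "(\<lambda>k. (F ^^ (2 * k)) (s t) $ 2 / (F ^^ (2 * k)) (s t) $ 1) \<longlonglongrightarrow> 0"
        using tendsto_chart(1)[OF inf chart_infinity(1), of 2]
        by (simp only: iterate_def chart_affine_point chart_infinity)
      from tendstoD[OF this zero_less_one]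
      have "\<forall>\<^sub>F k in sequentially. norm ((F ^^ (2 * k)) (s t) $ 2 / (F ^^ (2 * k)) (s t) $ 1) < 1"
        by (simp only: dist_0_norm dist_commute[of _ 0])
      moreover have "\<forall>\<^sub>F k in sequentially. (F ^^ (2 * k)) (s t) $ 1 \<noteq> 0"
        using tendsto_chart(2)[OF inf chart_infinity(1)] by (simp only: iterate_def chart_affine_point)
      moreover have "\<forall>\<^sub>F k in sequentially. N \<le> k" by (rule eventually_ge_at_top)
      ultimately have "\<forall>\<^sub>F k in sequentially. False"
      proof eventually_elim
        case (elim k)
        then show False using small[OF elim(3) s[OF t(1)]] by (simp add: norm_divide divide_less_eq)
      qed
      then show ?thesis by simp
    qed
  qed
  have fifth: "1 / 5 \<in> ball (0 :: complex) 1" "0 \<in> ball (0 :: complex) 1" by simp_all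
  have "g (1 / 5) = ratio q" using g_basin[OF fifth(1)] q(1) by (simp add: s0)
  moreover have "0 < of_int (a * b) * Re (ratio q)" by (rule ratio_sign[OF ab q(1)])
  ultimately have g5: "g (1 / 5) \<noteq> 0" by auto
  have nonconst: "\<not> g constant_on ball 0 1"
    using g0 g5 fifth unfolding constant_on_def by metis
  define Z where "Z = {t \<in> ball 0 1. g t = 0}"
  have "countable Z"
    unfolding Z_def
    by (rule holomorphic_countable_zeros[OF g(1) open_ball connected_ball _ nonconst])
      (rule fsigma_ball)
  then have conn: "connected (ball 0 1 - Z)"
    by (intro connected_open_diff_countable) auto
  \<comment> \<open>Deleting the countable zero set keeps the disc connected. On the rest,
    membership in the basin is relatively open, and by \<open>in_basin\<close> also relatively
    closed; it holds at \<open>1/5\<close>, hence everywhere.\<close>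
  define E where "E = (ball 0 1 - Z) \<inter> s -` basin a b"
  have "openin (top_of_set (ball 0 1 - Z)) E"
    unfolding E_def by (rule continuous_openin_preimage_gen[OF conts open_basin])
  moreover have "E = (ball 0 1 - Z) \<inter> s -` closure (basin a b)"
    unfolding E_def Z_def using in_basin closure_subset[of "basin a b"] by blast
  then have "closedin (top_of_set (ball 0 1 - Z)) E"
    using continuous_closedin_preimage[OF conts closed_closure] by simp
  moreover have "1 / 5 \<in> E" using q(1) g5 fifth by (simp add: E_def Z_def s0)
  ultimately have E: "E = ball 0 1 - Z" using conn unfolding connected_clopen by blast
  have sign: "g t = 0 \<or> 0 < of_int (a * b) * Re (g t)" if "t \<in> ball 0 1" for t
  proof (cases "g t = 0")
    case False
    then have "t \<in> E" using that by (simp add: E Z_def)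
    then have st: "s t \<in> basin a b" by (simp add: E_def)
    show ?thesis using ratio_sign[OF ab st] g_basin[OF that st] by simp
  qed simp
  have "open (g ` ball 0 1)"
    by (rule open_mapping_thm[OF g(1) open_ball connected_ball open_ball subset_refl nonconst])
  moreover have "0 \<in> g ` ball 0 1" using g0 fifth(2) by (metis imageI)
  ultimately obtain e where e: "0 < e" "ball 0 e \<subseteq> g ` ball 0 1" using open_contains_ball by blast
  \<comment> \<open>A value near \<open>0\<close> whose real part has the sign forbidden by
    \<open>sign\<close>, although openness of the image forces \<open>g\<close> to attain
    it.\<close>
  define z where "z = complex_of_real (- (of_int (a * b) * (e / 2)))"
  have z: "norm z = e / 2" "of_int (a * b) * Re z = - (e / 2)"
    unfolding z_def norm_of_real Re_complex_of_real using ab e(1) by (auto simp: abs_mult)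
  then have "z \<in> g ` ball 0 1" using e by auto
  then obtain t where t: "t \<in> ball 0 1" "g t = z" by blast
  from sign[OF t(1)] show False using t(2) z e(1) by auto
qed

section \<open>The basins as a cycle of Fatou components\<close>

lemma fatou_closure_basin:
  assumes ab: "a \<in> {1, -1}" "b \<in> {1, -1}" and p: "p \<in> fatou_set F" "p \<in> closure (basin a b)"
  shows "p \<in> basin a b"
proof -
  have "p \<in> closure basins" using p(2) closure_mono[OF basin_subset[OF ab]] by blast
  from boundary_limits[OF p(1) this] show ?thesis
  proof (elim disjE exE conjE)
    fix \<rho>
    assume "\<rho> \<noteq> 0" "(\<lambda>k. iterate F (2 * k) p) \<longlonglongrightarrow> point_at_infinity \<rho>"
      "(\<lambda>k. iterate F (2 * k) (F p)) \<longlonglongrightarrow> point_at_infinity (- of_real \<delta> / \<rho>)"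
    then show ?thesis by (rule boundary_nonzero_ratio[OF ab p])
  next
    assume "(\<lambda>k. iterate F (2 * k) p) \<longlonglongrightarrow> point_at_infinity 0"
    then show ?thesis using boundary_zero_ratio[OF ab p] by blast
  next
    assume lim: "(\<lambda>k. iterate F (2 * k) (F p)) \<longlonglongrightarrow> point_at_infinity 0"
    have "- b \<in> {1, -1}" using ab by auto
    from boundary_zero_ratio[OF this ab(1) F_fatou[OF p(1)] F_closure[OF ab p(2)] lim]
    show ?thesis ..
  qed
qed

text \<open>In any connected subset of the Fatou set that contains it, the basin is relatively open,
  and relatively closed because it contains all its limit points in the Fatou set.\<close>

lemma basin_fatou_component:
  assumes ab: "a \<in> {1, -1}" "b \<in> {1, -1}"
  shows "fatou_component F (basin a b)"
  unfolding fatou_component_def in_components_maximal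
proof (intro conjI allI impI)
  show "basin a b \<noteq> {}" by (rule basin_nonempty[OF ab])
  show "basin a b \<subseteq> fatou_set F" using basin_subset[OF ab] basins_subset_fatou by blast
  show "connected (basin a b)" by (rule basin_connected[OF ab])
  fix D assume D: "D \<noteq> {} \<and> basin a b \<subseteq> D \<and> D \<subseteq> fatou_set F \<and> connected D"
  have 1: "basin a b = D \<inter> basin a b" using D by blast
  have 2: "basin a b = D \<inter> closure (basin a b)"
    using D fatou_closure_basin[OF ab] closure_subset[of "basin a b"] by blast
  have "openin (top_of_set D) (basin a b)" by (subst 1) (rule openin_open_Int[OF open_basin])
  moreover have "closedin (top_of_set D) (basin a b)"
    by (subst 2) (rule closedin_closed_Int[OF closed_closure])
  ultimately have "basin a b = {} \<or> basin a b = D" using D unfolding connected_clopen by blast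
  then show "D = basin a b" using basin_nonempty[OF ab] by blast
qed

lemma basin_cycle: "fatou_cycle F 4 {basin a b | a b. a \<in> {1, -1} \<and> b \<in> {1, -1}}"
proof -
  \<comment> \<open>The orbit of \<open>(1, 1)\<close> under the action
    \<open>(a, b) \<mapsto> (-b, a)\<close> of \<open>F\<close> on signs.\<close>
  define A B :: "nat \<Rightarrow> int" where "A = (!) [1, -1, -1, 1]" and "B = (!) [1, 1, -1, -1]"
  define X where "X = (\<lambda>k. basin (A k) (B k))"
  have cases: "k = 0 \<or> k = 1 \<or> k = 2 \<or> k = 3" if "k < 4" for k :: nat using that by linarith
  have vals: "A 0 = 1" "A 1 = -1" "A 2 = -1" "A 3 = 1" "B 0 = 1" "B 1 = 1" "B 2 = -1" "B 3 = -1"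
    by (simp_all add: A_def B_def eval_nat_numeral)
  have AB: "A k \<in> {1, -1}" "B k \<in> {1, -1}" if "k < 4" for k
    using cases[OF that] vals by auto
  have inj: "inj_on X {..<4}"
  proof (rule inj_onI)
    fix i j :: nat assume ij: "i \<in> {..<4}" "j \<in> {..<4}" "X i = X j"
    then have i: "i < 4" and j: "j < 4" by simp_all
    obtain p where p: "p \<in> X i" using basin_nonempty[OF AB[OF i]] unfolding X_def by blast
    have "p \<in> basin (A i) (B i)" "p \<in> basin (A j) (B j)" using p ij(3) by (simp_all only: X_def)
    note eq = basin_disjoint[OF AB[OF i] AB[OF j] this]
    show "i = j" using cases[OF i] cases[OF j] eq vals by (elim disjE) simp_all
  qed
  have image: "X ` {..<4} = {basin a b | a b. a \<in> {1, -1} \<and> b \<in> {1, -1}}"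
  proof
    show "X ` {..<4} \<subseteq> {basin a b | a b. a \<in> {1, -1} \<and> b \<in> {1, -1}}"
    proof
      fix S assume "S \<in> X ` {..<4}"
      then obtain k where k: "k < 4" "S = basin (A k) (B k)" unfolding X_def by blast
      show "S \<in> {basin a b | a b. a \<in> {1, -1} \<and> b \<in> {1, -1}}"
        unfolding k(2) by (rule CollectI, rule exI[of _ "A k"], rule exI[of _ "B k"])
          (simp only: AB[OF k(1)] simp_thms)
    qed
    have X: "X 0 = basin 1 1" "X 1 = basin (-1) 1" "X 2 = basin (-1) (-1)" "X 3 = basin 1 (-1)"
      unfolding X_def vals by (rule refl)+
    have mem: "X k \<in> X ` {..<4}" if "k < 4" for k using that by simp
    show "{basin a b | a b. a \<in> {1, -1} \<and> b \<in> {1, -1}} \<subseteq> X ` {..<4}"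
    proof
      fix S assume "S \<in> {basin a b | a b. a \<in> {1, -1} \<and> b \<in> {1, -1}}"
      then obtain a b where S: "S = basin a b" "a = 1 \<or> a = -1" "b = 1 \<or> b = -1" by blast
      from S(2,3) have "S = X 0 \<or> S = X 1 \<or> S = X 2 \<or> S = X 3"
        unfolding X S(1) by (elim disjE) simp_all
      then show "S \<in> X ` {..<4}" using mem[of 0] mem[of 1] mem[of 2] mem[of 3] by (elim disjE) simp_all
    qed
  qed
  have step: "F ` X k = X (Suc k mod 4)" if k: "k < 4" for k
  proof -
    have "Suc 0 mod 4 = (1 :: nat)" "Suc 1 mod 4 = (2 :: nat)" "Suc 2 mod 4 = (3 :: nat)" "Suc 3 mod 4 = (0 :: nat)"
      by simp_all
    then have "A (Suc k mod 4) = - B k" "B (Suc k mod 4) = A k"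
      using cases[OF k] by (elim disjE; simp only: vals minus_minus)+
    then show ?thesis unfolding X_def using F_basin[OF AB[OF k]] by (simp only:)
  qed
  show ?thesis
    unfolding fatou_cycle_def
  proof (intro exI[of _ X] conjI allI impI)
    show "bij_betw X {..<4} {basin a b | a b. a \<in> {1, -1} \<and> b \<in> {1, -1}}"
      unfolding bij_betw_def using inj image by (rule conjI)
    fix k :: nat assume k: "k < 4"
    show "fatou_component F (X k)" unfolding X_def by (rule basin_fatou_component[OF AB[OF k]])
    show "F ` X k = X (Suc k mod 4)" by (rule step[OF k])
  qed
qed

end

theorem theorem1p1:
  fixes \<delta> :: real
  assumes "\<delta> > 2"
  shows "\<exists>(\<Omega> :: int \<Rightarrow> int \<Rightarrow> (complex^2) set) (h1 :: complex^2 \<Rightarrow> cp2) (h2 :: complex^2 \<Rightarrow> cp2).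
    fatou_cycle (henon \<delta>) 4 {\<Omega> a b | a b. a \<in> {1, -1} \<and> b \<in> {1, -1}} \<and>
    (\<forall>a\<in>{1, -1}. \<forall>b\<in>{1, -1}. biholomorphic (\<Omega> a b) half_plane_squared) \<and>
    (\<forall>a\<in>{1, -1}. \<forall>b\<in>{1, -1}. exactly_two_limit_functions (henon \<delta>) (\<Omega> a b) h1 h2) \<and>
    exactly_two_limit_functions (henon \<delta>) (\<Union>a\<in>{1, -1}. \<Union>b\<in>{1, -1}. \<Omega> a b) h1 h2 \<and>
    (\<forall>h\<in>{h1, h2}. \<forall>a\<in>{1, -1}. \<forall>b\<in>{1, -1}.
       has_generic_rank h (\<Omega> a b) 1 \<and> h ` \<Omega> a b \<subseteq> line_at_infinity) \<and>
    (\<forall>a\<in>{1, -1}.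
       h1 ` \<Omega> a a = point_at_infinity ` right_half_plane \<and>
       h2 ` \<Omega> a (- a) = point_at_infinity ` right_half_plane \<and>
       h1 ` \<Omega> a (- a) = point_at_infinity ` uminus ` right_half_plane \<and>
       h2 ` \<Omega> a a = point_at_infinity ` uminus ` right_half_plane) \<and>
    (\<exists>\<phi> :: complex^2 \<Rightarrow> complex^2.
       let U = (\<Union>a\<in>{1, -1}. \<Union>b\<in>{1, -1}. \<Omega> a b) in
       biholomorphism \<phi> U (\<phi> ` U) \<and>
       (\<forall>p\<in>U. \<phi> (henon \<delta> p) = henon_linear_part \<delta> (\<phi> p)))"
proof -
  interpret henon_map \<delta> by unfold_locales (rule assms)
  show ?thesis
  proof (rule exI[of _ basin], rule exI[of _ limit_even], rule exI[of _ limit_odd],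
      intro conjI, fold basins_def)
    show "fatou_cycle F 4 {basin a b | a b. a \<in> {1, -1} \<and> b \<in> {1, -1}}" by (rule basin_cycle)
    show "\<forall>a\<in>{1, -1}. \<forall>b\<in>{1, -1}. biholomorphic (basin a b) half_plane_squared"
      by (intro ballI basin_biholomorphic)
    show "\<forall>a\<in>{1, -1}. \<forall>b\<in>{1, -1}. exactly_two_limit_functions F (basin a b) limit_even limit_odd"
      by (intro ballI exactly_two_limits basin_subset basin_nonempty)
    have "basins \<noteq> {}" using basin_nonempty[of 1 1] basin_subset[of 1 1] by auto
    then show "exactly_two_limit_functions F basins limit_even limit_odd"
      by (rule exactly_two_limits[OF subset_refl])
    show "\<forall>h\<in>{limit_even, limit_odd}. \<forall>a\<in>{1, -1}. \<forall>b\<in>{1, -1}.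
        has_generic_rank h (basin a b) 1 \<and> h ` basin a b \<subseteq> line_at_infinity"
    proof (intro ballI conjI image_subsetI)
      fix h :: "complex^2 \<Rightarrow> cp2" and a b :: int
      assume h: "h \<in> {limit_even, limit_odd}" and ab: "a \<in> {1, -1}" "b \<in> {1, -1}"
      show "has_generic_rank h (basin a b) 1" by (rule limit_generic_rank[OF ab h])
      show "h p \<in> line_at_infinity" if "p \<in> basin a b" for p
        by (rule limit_in_line_at_infinity[OF subsetD[OF basin_subset[OF ab] that] h])
    qed
    show "\<forall>a\<in>{1, -1}.
       limit_even ` basin a a = point_at_infinity ` right_half_plane \<and>
       limit_odd ` basin a (- a) = point_at_infinity ` right_half_plane \<and>
       limit_even ` basin a (- a) = point_at_infinity ` uminus ` right_half_plane \<and>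
       limit_odd ` basin a a = point_at_infinity ` uminus ` right_half_plane"
    proof
      fix a :: int assume a: "a \<in> {1, -1}"
      then have a': "- a \<in> {1, -1}" by auto
      show "limit_even ` basin a a = point_at_infinity ` right_half_plane \<and>
         limit_odd ` basin a (- a) = point_at_infinity ` right_half_plane \<and>
         limit_even ` basin a (- a) = point_at_infinity ` uminus ` right_half_plane \<and>
         limit_odd ` basin a a = point_at_infinity ` uminus ` right_half_plane"
        unfolding limit_even_image[OF a a] limit_even_image[OF a a'] limit_odd_image[OF a a]
          limit_odd_image[OF a a'] ratio_image[OF a] neg_inverse_image by simp
    qed
    have "biholomorphism phi basins (phi ` basins)"
      by (rule biholomorphism_image[OF open_basins phi_inj_on phi_regular_at])
    then show "\<exists>\<phi>. let U = basins in biholomorphism \<phi> U (\<phi> ` U) \<and>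
        (\<forall>p\<in>U. \<phi> (F p) = henon_linear_part \<delta> (\<phi> p))"
      by (intro exI[of _ phi]) (simp add: Let_def phi_F)
  qed
qed

end
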